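(* Let $p$ be a prime number, $G$ a transitive group of degree $n\in p\mathbb{Z}\setminus p^{2}\mathbb{Z}$, and $H$ a corresponding subgroup of $G$. Assume that a $p$-Sylow subgroup $S_{p}$ of $G$ is normal in $G$. (i) One has $\operatorname{Sha}_{\omega}^{2}(G,J_{G/H})[p^{\infty}]\neq 0$ if and only if (a) $S_{p}\cong (C_{p})^{2}$; (b) $[S_{p},G]=S_{p}$; and (c) $N_{G}(S_{p}\cap H)=Z_{G}(S_{p}\cap H)$. Conversely, if (a), (b) and (c) hold, then for every admissible set $\mathcal{D}$ of subgroups of $G$, $\operatorname{Sha}_{\mathcal{D}}^{2}(G,J_{G/H})[p^{\infty}]$ is $0$ if some $D\in\mathcal{D}$ contains $S_{p}$, and is isomorphic to $\mathbb{Z}/p$ otherwise. (ii) For every admissible set $\mathcal{D}$ of subgroups of $G$, $\operatorname{Sha}_{\mathcal{D}}^{2}(G,J_{G/H})^{(p)}\cong \operatorname{Sha}_{\mathcal{D}_{/S_{p}}}^{2}(G/S_{p},J_{G/HS_{p}})$, where $\mathcal{D}_{/S_{p}}:=\{DS_{p}/S_{p}\mid D\in\mathcal{D}\}$.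
   Context: A transitive group of degree $n$ is a subgroup $G$ of the symmetric group $\mathfrak{S}_n$ acting transitively on $\{1,\dots,n\}$; a corresponding subgroup is a stabilizer $\mathrm{Stab}_G(i)$. For a finite group $G$ and subgroup $H$, $\operatorname{Ind}_H^G\mathbb{Z}:=\mathrm{Hom}_{\mathbb{Z}[H]}(\mathbb{Z}[G],\mathbb{Z})$ with $G$-action $(g\varphi)(g')=\varphi(g'g)$, and $J_{G/H}$ is the cokernel of the $G$-map $\mathbb{Z}\to\operatorname{Ind}_H^G\mathbb{Z}$ sending $1$ to the constant function $1$. For a set $\mathcal{D}$ of subgroups and a $G$-module $M$, $\operatorname{Sha}^2_{\mathcal{D}}(G,M):=\ker\big(H^2(G,M)\to\bigoplus_{D\in\mathcal{D}}H^2(D,M)\big)$ (restriction maps); $\operatorname{Sha}^2_\omega$ is the case where $\mathcal{D}$ is the set of all cyclic subgroups. A finite set $\mathcal{D}$ of subgroups of $G$ is admissible if it contains all cyclic subgroups of $G$ and is stable under conjugation. $J_{G/HS_p}$ is regarded as a $G/S_p$-lattice. $A[p^\infty]$, $A^{(p)}$ denote $p$-primary and prime-to-$p$ torsion parts; $[A,B]$ is the commutator subgroup generated by $aba^{-1}b^{-1}$; $N_G$, $Z_G$ are normalizer and centralizer. *)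

theory Defs
  imports "HOL-Algebra.Sym_Groups" "HOL-Algebra.Group_Action" "HOL-Algebra.Elementary_Groups"
    "HOL-Algebra.Product_Groups" "HOL-Computational_Algebra.Primes"
begin

section \<open>Transitive groups and subgroups\<close>

definition transitive_group :: "nat \<Rightarrow> (nat \<Rightarrow> nat) monoid \<Rightarrow> bool" where
  "transitive_group n G \<longleftrightarrow>
     G = (sym_group n)\<lparr>carrier := carrier G\<rparr> \<and> subgroup (carrier G) (sym_group n) \<and>
     (\<forall>i\<in>{1..n}. \<forall>j\<in>{1..n}. \<exists>g\<in>carrier G. g i = j)"

definition corresponding_subgroup :: "nat \<Rightarrow> (nat \<Rightarrow> nat) monoid \<Rightarrow> (nat \<Rightarrow> nat) set \<Rightarrow> bool" where
  "corresponding_subgroup n G H \<longleftrightarrow> (\<exists>i\<in>{1..n}. H = stabilizer G (\<lambda>g. g) i)"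

definition sylow_subgroup :: "nat \<Rightarrow> ('a, 'x) monoid_scheme \<Rightarrow> 'a set \<Rightarrow> bool" where
  "sylow_subgroup p G S \<longleftrightarrow> subgroup S G \<and> card S = p ^ multiplicity p (order G)"

definition commutator_subgroup :: "('a, 'x) monoid_scheme \<Rightarrow> 'a set \<Rightarrow> 'a set \<Rightarrow> 'a set" where
  "commutator_subgroup G A B =
     generate G {a \<otimes>\<^bsub>G\<^esub> b \<otimes>\<^bsub>G\<^esub> inv\<^bsub>G\<^esub> a \<otimes>\<^bsub>G\<^esub> inv\<^bsub>G\<^esub> b | a b. a \<in> A \<and> b \<in> B}"

definition centralizer :: "('a, 'x) monoid_scheme \<Rightarrow> 'a set \<Rightarrow> 'a set" where
  "centralizer G K = {g \<in> carrier G. \<forall>k\<in>K. g \<otimes>\<^bsub>G\<^esub> k = k \<otimes>\<^bsub>G\<^esub> g}"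

definition cyclic_subgroups :: "('a, 'x) monoid_scheme \<Rightarrow> 'a set set" where
  "cyclic_subgroups G = {generate G {g} | g. g \<in> carrier G}"

definition admissible :: "('a, 'x) monoid_scheme \<Rightarrow> 'a set set \<Rightarrow> bool" where
  "admissible G \<D> \<longleftrightarrow>
     finite \<D> \<and> (\<forall>D\<in>\<D>. subgroup D G) \<and> cyclic_subgroups G \<subseteq> \<D> \<and>
     (\<forall>D\<in>\<D>. \<forall>g\<in>carrier G. g <#\<^bsub>G\<^esub> D #>\<^bsub>G\<^esub> inv\<^bsub>G\<^esub> g \<in> \<D>)"

definition quotient_subgroups :: "('a, 'x) monoid_scheme \<Rightarrow> 'a set \<Rightarrow> 'a set set \<Rightarrow> 'a set set set" where
  "quotient_subgroups G S \<D> =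
     (\<lambda>D. carrier ((G\<lparr>carrier := D <#>\<^bsub>G\<^esub> S\<rparr>) Mod S)) ` \<D>"

definition primary_part :: "nat \<Rightarrow> ('a, 'x) monoid_scheme \<Rightarrow> ('a, 'x) monoid_scheme" where
  "primary_part p A =
     A\<lparr>carrier := {x \<in> carrier A. \<exists>k::nat. x [^]\<^bsub>A\<^esub> (p ^ k) = \<one>\<^bsub>A\<^esub>}\<rparr>"

definition prime_to_part :: "nat \<Rightarrow> ('a, 'x) monoid_scheme \<Rightarrow> ('a, 'x) monoid_scheme" where
  "prime_to_part p A =
     A\<lparr>carrier := {x \<in> carrier A. \<exists>m::nat. m > 0 \<and> coprime m p \<and> x [^]\<^bsub>A\<^esub> m = \<one>\<^bsub>A\<^esub>}\<rparr>"


section \<open>Second cohomology\<close>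

text \<open>
  A \<open>G\<close>-module consists of an abelian group \<open>M\<close>, written multiplicatively,
  and an action \<open>act\<close>. Cohomology is that of the complex of inhomogeneous cochains.
\<close>

definition cochains1 :: "('g, 'x) monoid_scheme \<Rightarrow> ('m, 'y) monoid_scheme \<Rightarrow> ('g \<Rightarrow> 'm) monoid" where
  "cochains1 G M = product_group (carrier G) (\<lambda>_. M)"

definition cochains2 ::
    "('g, 'x) monoid_scheme \<Rightarrow> ('m, 'y) monoid_scheme \<Rightarrow> ('g \<times> 'g \<Rightarrow> 'm) monoid" where
  "cochains2 G M = product_group (carrier G \<times> carrier G) (\<lambda>_. M)"

definition cochains3 ::
    "('g, 'x) monoid_scheme \<Rightarrow> ('m, 'y) monoid_scheme \<Rightarrow> ('g \<times> 'g \<times> 'g \<Rightarrow> 'm) monoid" where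
  "cochains3 G M = product_group (carrier G \<times> carrier G \<times> carrier G) (\<lambda>_. M)"

definition diff1 ::
    "('g, 'x) monoid_scheme \<Rightarrow> ('m, 'y) monoid_scheme \<Rightarrow> ('g \<Rightarrow> 'm \<Rightarrow> 'm) \<Rightarrow>
     ('g \<Rightarrow> 'm) \<Rightarrow> 'g \<times> 'g \<Rightarrow> 'm" where
  "diff1 G M act b =
     (\<lambda>(g, h) \<in> carrier G \<times> carrier G.
        act g (b h) \<otimes>\<^bsub>M\<^esub> inv\<^bsub>M\<^esub> b (g \<otimes>\<^bsub>G\<^esub> h) \<otimes>\<^bsub>M\<^esub> b g)"

definition diff2 ::
    "('g, 'x) monoid_scheme \<Rightarrow> ('m, 'y) monoid_scheme \<Rightarrow> ('g \<Rightarrow> 'm \<Rightarrow> 'm) \<Rightarrow>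
     ('g \<times> 'g \<Rightarrow> 'm) \<Rightarrow> 'g \<times> 'g \<times> 'g \<Rightarrow> 'm" where
  "diff2 G M act c =
     (\<lambda>(g, h, k) \<in> carrier G \<times> carrier G \<times> carrier G.
        act g (c (h, k)) \<otimes>\<^bsub>M\<^esub> inv\<^bsub>M\<^esub> c (g \<otimes>\<^bsub>G\<^esub> h, k)
          \<otimes>\<^bsub>M\<^esub> c (g, h \<otimes>\<^bsub>G\<^esub> k) \<otimes>\<^bsub>M\<^esub> inv\<^bsub>M\<^esub> c (g, h))"

definition cocycles2 ::
    "('g, 'x) monoid_scheme \<Rightarrow> ('m, 'y) monoid_scheme \<Rightarrow> ('g \<Rightarrow> 'm \<Rightarrow> 'm) \<Rightarrow>
     ('g \<times> 'g \<Rightarrow> 'm) monoid" where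
  "cocycles2 G M act =
     (cochains2 G M)\<lparr>carrier := kernel (cochains2 G M) (cochains3 G M) (diff2 G M act)\<rparr>"

definition coboundaries2 ::
    "('g, 'x) monoid_scheme \<Rightarrow> ('m, 'y) monoid_scheme \<Rightarrow> ('g \<Rightarrow> 'm \<Rightarrow> 'm) \<Rightarrow>
     ('g \<times> 'g \<Rightarrow> 'm) set" where
  "coboundaries2 G M act = diff1 G M act ` carrier (cochains1 G M)"

definition H2 ::
    "('g, 'x) monoid_scheme \<Rightarrow> ('m, 'y) monoid_scheme \<Rightarrow> ('g \<Rightarrow> 'm \<Rightarrow> 'm) \<Rightarrow>
     ('g \<times> 'g \<Rightarrow> 'm) set monoid" where
  "H2 G M act = cocycles2 G M act Mod coboundaries2 G M act"

text \<open>
  The class of a cocycle is sent to the class of its restriction to \<open>D\<close>; all members of a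
  class give the same value, which \<^const>\<open>the_elem\<close> extracts.
\<close>

definition res2 ::
    "('g, 'x) monoid_scheme \<Rightarrow> ('m, 'y) monoid_scheme \<Rightarrow> ('g \<Rightarrow> 'm \<Rightarrow> 'm) \<Rightarrow> 'g set \<Rightarrow>
     ('g \<times> 'g \<Rightarrow> 'm) set \<Rightarrow> ('g \<times> 'g \<Rightarrow> 'm) set" where
  "res2 G M act D x =
     the_elem ((\<lambda>c. r_coset (cocycles2 (G\<lparr>carrier := D\<rparr>) M act)
                         (coboundaries2 (G\<lparr>carrier := D\<rparr>) M act)
                         (restrict c (D \<times> D))) ` x)"

definition Sha2 ::
    "('g, 'x) monoid_scheme \<Rightarrow> 'g set set \<Rightarrow> ('m, 'y) monoid_scheme \<Rightarrow> ('g \<Rightarrow> 'm \<Rightarrow> 'm) \<Rightarrow>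
     ('g \<times> 'g \<Rightarrow> 'm) set monoid" where
  "Sha2 G \<D> M act =
     (H2 G M act)
       \<lparr>carrier := kernel (H2 G M act)
          (sum_group \<D> (\<lambda>D. H2 (G\<lparr>carrier := D\<rparr>) M act))
          (\<lambda>x. \<lambda>D\<in>\<D>. res2 G M act D x)\<rparr>"

abbreviation Sha2_omega ::
    "('g, 'x) monoid_scheme \<Rightarrow> ('m, 'y) monoid_scheme \<Rightarrow> ('g \<Rightarrow> 'm \<Rightarrow> 'm) \<Rightarrow>
     ('g \<times> 'g \<Rightarrow> 'm) set monoid" where
  "Sha2_omega G M act \<equiv> Sha2 G (cyclic_subgroups G) M act"


section \<open>The lattice of a subgroup\<close>

text \<open>
  Elements of \<open>Hom\<^bsub>\<int>[H]\<^esub>(\<int>[G], \<int>)\<close> are given by their values on the basis \<open>G\<close> of \<open>\<int>[G]\<close>;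
  since \<open>H\<close> acts trivially on \<open>\<int>\<close>, equivariance reads \<open>\<phi> (h g) = \<phi> g\<close>.
\<close>

definition Ind_int :: "('a, 'x) monoid_scheme \<Rightarrow> 'a set \<Rightarrow> ('a \<Rightarrow> int) monoid" where
  "Ind_int G H =
     (product_group (carrier G) (\<lambda>_. integer_group))
       \<lparr>carrier := {\<phi> \<in> carrier G \<rightarrow>\<^sub>E UNIV. \<forall>h\<in>H. \<forall>g\<in>carrier G. \<phi> (h \<otimes>\<^bsub>G\<^esub> g) = \<phi> g}\<rparr>"

definition Ind_act :: "('a, 'x) monoid_scheme \<Rightarrow> 'a \<Rightarrow> ('a \<Rightarrow> int) \<Rightarrow> ('a \<Rightarrow> int)" where
  "Ind_act G g \<phi> = (\<lambda>g'\<in>carrier G. \<phi> (g' \<otimes>\<^bsub>G\<^esub> g))"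

definition J :: "('a, 'x) monoid_scheme \<Rightarrow> 'a set \<Rightarrow> ('a \<Rightarrow> int) set monoid" where
  "J G H = Ind_int G H Mod range (\<lambda>n::int. \<lambda>g\<in>carrier G. n)"

definition J_act :: "('a, 'x) monoid_scheme \<Rightarrow> 'a \<Rightarrow> ('a \<Rightarrow> int) set \<Rightarrow> ('a \<Rightarrow> int) set" where
  "J_act G g x = Ind_act G g ` x"

text \<open>
  The action of \<open>G Mod S\<close> induced by an action of \<open>G\<close> for which \<open>S\<close> acts trivially: all
  representatives of a coset act in the same way.
\<close>

definition quotient_act :: "('g \<Rightarrow> 'm \<Rightarrow> 'm) \<Rightarrow> 'g set \<Rightarrow> 'm \<Rightarrow> 'm" where
  "quotient_act act C m = the_elem ((\<lambda>g. act g m) ` C)"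

end

theory Submission
  imports Defs Complex_Main "HOL-Library.Function_Algebras" "HOL-Algebra.Multiplicative_Group"
begin

text \<open>
  Tensoring \<open>J\<close> with the exact sequence of \<open>\<int>\<close>, \<open>\<real>\<close> and the circle \<open>\<real>/\<int>\<close> identifies \<open>H\<^sup>2(G, J)\<close> with
  the first cohomology of \<open>\<real>/\<int>\<close>-valued functions on the right cosets of \<open>H\<close>, modulo constants.
  A class is thus a function \<open>b g x\<close>, left \<open>H\<close>-invariant in \<open>x\<close>, for which \<open>b g x + b h (x g) - b (g h) x\<close> does not depend
  on \<open>x\<close>; it is trivial iff \<open>b g x = m (x g) - m x + e g\<close>.

  Prime-to-\<open>p\<close> classes vanish on \<open>S\<close> and hence come from \<open>G/S\<close>, which gives (ii).

  Classes of \<open>p\<close>-power order are detected on \<open>S\<close>. The point stabilisers \<open>K\<^sub>x\<close> in \<open>S\<close> have index \<open>p\<close> and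
  intersect trivially, so \<open>S\<close> is elementary abelian. Local triviality on cyclic subgroups makes
  \<open>b k x\<close> independent of \<open>x\<close> among the \<open>x\<close> with \<open>k \<in> K\<^sub>x\<close>. This splits the obstruction cocycle on \<open>S\<close> and
  leaves compatible characters of the \<open>K\<^sub>x\<close>, which glue to a character of \<open>S\<close> unless \<open>S\<close> has order
  \<open>p\<^sup>2\<close>. In that case the \<open>G\<close>-invariant families of characters modulo \<open>G\<close>-invariant characters of
  \<open>S\<close> form a group of order \<open>p\<close> or \<open>1\<close>: it is nonzero exactly when the normaliser of \<open>K = S \<inter> H\<close>
  acts trivially on \<open>K\<close> and \<open>S\<close> has no invariant character, that is \<open>[S, G] = S\<close>. The transfer
  \<open>H \<rightarrow> K\<close> realises a nonzero element.
\<close>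

text \<open>An element of \<open>J G H\<close> is a function modulo constants. It is pinned down by
  requiring the value 0 at the identity, which accounts for the terms at \<open>\<one>\<close> in
  the cocycle conditions. Circle values become available because \<real> is uniquely divisible:
  averaging over a finite group turns every real cocycle into a coboundary. The same calculus has to
  serve \<open>G\<close> and \<open>G Mod S\<close>. The quotient acts through chosen
  representatives, which multiply correctly only up to \<open>S\<close>. Invariant functions do not
  see this error, so both cases are instances of one locale with a map \<open>\<tau>\<close> that
  need not be a homomorphism. The order \<open>p\<^sup>2\<close> is exceptional for this reason: in
  a larger \<open>S\<close>, two distinct stabilisers share a nontrivial \<open>w\<close>, and its
  powers connect every stabiliser with these two, so local constancy leaves no freedom. In order
  \<open>p\<^sup>2\<close> distinct stabilisers meet trivially, and only the action of
  \<open>G\<close> relates their characters. The stabilisers are conjugate of prime order, so one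
  value in the p-torsion of the circle fixes the family; hence the bound \<open>p\<close>.\<close>

primrec ntimes :: "nat \<Rightarrow> 'a::ab_group_add \<Rightarrow> 'a" (infixr "\<cdot>" 75) where
  "0 \<cdot> a = 0"
| "Suc n \<cdot> a = a + n \<cdot> a"

lemma ntimes_add_right: "n \<cdot> (a + b) = n \<cdot> a + n \<cdot> b"
  by (induction n) (auto simp: algebra_simps)

lemma ntimes_zero_right [simp]: "n \<cdot> (0::'a::ab_group_add) = 0"
  by (induction n) auto

lemma ntimes_minus_right: "n \<cdot> (- a) = - (n \<cdot> a)"
  by (induction n) (auto simp: algebra_simps)

lemma ntimes_diff_right: "n \<cdot> (a - b) = n \<cdot> a - n \<cdot> b"
  by (induction n) (auto simp: algebra_simps)

lemma ntimes_add_left: "(m + n) \<cdot> a = m \<cdot> a + n \<cdot> a"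
  by (induction m) (auto simp: algebra_simps)

lemma ntimes_mult: "(m * n) \<cdot> a = m \<cdot> n \<cdot> a"
  by (induction m) (auto simp: ntimes_add_left)

lemma ntimes_one [simp]: "Suc 0 \<cdot> a = a" "1 \<cdot> a = a"
  by auto

lemma ntimes_commute: "m \<cdot> n \<cdot> a = n \<cdot> m \<cdot> a"
  by (metis ntimes_mult mult.commute)

lemma ntimes_sum: "n \<cdot> (\<Sum>i\<in>I. f i) = (\<Sum>i\<in>I. n \<cdot> f i)"
  by (induction I rule: infinite_finite_induct) (auto simp: ntimes_add_right)

lemma sum_constant_ntimes: "(\<Sum>i\<in>I. a) = card I \<cdot> a"
  by (induction I rule: infinite_finite_induct) auto

text \<open>The coefficients are natural numbers because \<open>ntimes\<close> takes only those.
  Positivity of \<open>m\<close> rules out the pair \<open>m = 0\<close>, \<open>n = 1\<close>, for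
  which no such coefficients exist.\<close>

lemma coprime_bezout_nat:
  fixes m n :: nat
  assumes "coprime m n" "0 < m"
  obtains x y where "x * m = y * n + 1"
  using bezout_nat[of m n] assms that by (auto simp: mult.commute)

lemma ntimes_coprime_zero:
  fixes m n :: nat
  assumes "coprime m n" "m \<cdot> a = 0" "n \<cdot> a = 0"
  shows "a = 0"
proof (cases "m = 0")
  case True
  then show ?thesis using assms by simp
next
  case False
  then obtain x y where xy: "x * m = y * n + 1"
    using coprime_bezout_nat[OF assms(1)] by blast
  have "(x * m) \<cdot> a = 0" "(y * n) \<cdot> a = 0"
    using assms by (simp_all add: ntimes_mult)
  then show ?thesis by (simp add: xy ntimes_add_left)
qed

\<comment> \<open>The circle group and its torsion\<close>
quotient_type circle = real / "\<lambda>x y. x - y \<in> \<int>"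
proof (rule equivpI)
  show "reflp (\<lambda>x y::real. x - y \<in> \<int>)" by (simp add: reflp_def)
  show "symp (\<lambda>x y::real. x - y \<in> \<int>)"
    by (metis (no_types, lifting) sympI Ints_minus minus_diff_eq)
  show "transp (\<lambda>x y::real. x - y \<in> \<int>)"
  proof (rule transpI)
    fix x y z :: real
    assume "x - y \<in> \<int>" "y - z \<in> \<int>"
    then have "(x - y) + (y - z) \<in> \<int>" by (rule Ints_add)
    then show "x - z \<in> \<int>" by simp
  qed
qed

instantiation circle :: ab_group_add
begin

lift_definition zero_circle :: circle is 0 .

lift_definition plus_circle :: "circle \<Rightarrow> circle \<Rightarrow> circle" is "(+)"
proof -
  fix a b c d :: real
  assume "a - b \<in> \<int>" "c - d \<in> \<int>"
  then have "(a - b) + (c - d) \<in> \<int>" by (rule Ints_add)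
  then show "a + c - (b + d) \<in> \<int>" by (simp add: algebra_simps)
qed

lift_definition minus_circle :: "circle \<Rightarrow> circle \<Rightarrow> circle" is "(-)"
proof -
  fix a b c d :: real
  assume "a - b \<in> \<int>" "c - d \<in> \<int>"
  then have "(a - b) - (c - d) \<in> \<int>" by (rule Ints_diff)
  then show "a - c - (b - d) \<in> \<int>" by (simp add: algebra_simps)
qed

lift_definition uminus_circle :: "circle \<Rightarrow> circle" is uminus
  by (metis Ints_minus minus_diff_minus minus_minus)

instance
  by standard (transfer; simp add: algebra_simps)+

end

lift_definition circ :: "real \<Rightarrow> circle" is "\<lambda>x. x" .

lemma circ_add: "circ (x + y) = circ x + circ y" by transfer simp
lemma circ_diff: "circ (x - y) = circ x - circ y" by transfer simp
lemma circ_zero: "circ 0 = 0" by transfer simp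
lemma circ_eq_iff: "circ x = circ y \<longleftrightarrow> x - y \<in> \<int>" by transfer simp
lemma circ_eq_0_iff: "circ x = 0 \<longleftrightarrow> x \<in> \<int>" by transfer simp
lemma circ_rep [simp]: "circ (rep_circle a) = a"
  by (metis Quotient3_abs_rep Quotient3_circle circ.abs_eq)
lemma ntimes_circ: "n \<cdot> circ x = circ (real n * x)"
  by (induction n) (auto simp: circ_zero circ_add algebra_simps)

text \<open>Divisibility lets a cocycle whose \<open>n\<close>-fold multiple is a coboundary be
  corrected to one with values in the \<open>n\<close>-torsion.\<close>

lemma circle_divisible:
  fixes a :: circle
  assumes "0 < n"
  obtains b where "n \<cdot> b = a"
proof
  show "n \<cdot> circ (rep_circle a / real n) = a"
    using assms by (simp add: ntimes_circ)
qed

lemma circle_torsion: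
  fixes a :: circle
  assumes "0 < n" "n \<cdot> a = 0"
  obtains k where "a = k \<cdot> circ (1 / real n)"
proof -
  have "real n * rep_circle a \<in> \<int>"
    using assms(2) by (metis circ_eq_0_iff circ_rep ntimes_circ)
  then obtain z where z: "real n * rep_circle a = of_int z" by (auto elim: Ints_cases)
  \<comment> \<open>Reducing \<open>z\<close> modulo \<open>n\<close> makes the multiplier a natural
    number; the discarded part, divided by \<open>n\<close>, is an integer and vanishes in the
    circle.\<close>
  define k where "k = nat (z mod int n)"
  have k: "int k = z mod int n" using assms(1) by (simp add: k_def)
  have "rep_circle a - real k / real n = of_int (z div int n)"
  proof -
    have "real_of_int z = real_of_int (z div int n) * real n + real k"
      by (metis k div_mult_mod_eq of_int_add of_int_mult of_int_of_nat_eq)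
    then show ?thesis using z assms(1) by (simp add: field_simps)
  qed
  then have "circ (rep_circle a) = circ (real k / real n)" unfolding circ_eq_iff by simp
  then show ?thesis using that[of k] by (simp add: ntimes_circ)
qed

lemma ntimes_circ_inverse_eq_0_iff:
  assumes "0 < n"
  shows "k \<cdot> circ (1 / real n) = 0 \<longleftrightarrow> n dvd k"
proof
  assume "k \<cdot> circ (1 / real n) = 0"
  then obtain z where "real k / real n = of_int z"
    by (auto simp: ntimes_circ circ_eq_0_iff elim: Ints_cases)
  then have "real_of_int (int k) = of_int (z * int n)" using assms by (simp add: field_simps)
  then have "int k = z * int n" by linarith
  then show "n dvd k" by (metis dvd_triv_right int_dvd_int_iff)
next
  assume "n dvd k"
  then show "k \<cdot> circ (1 / real n) = 0"
    using assms by (auto simp: ntimes_circ circ_eq_0_iff dvd_def)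
qed

section \<open>Second cohomology of a module\<close>

locale module_action = Q?: group Q + M?: comm_group M
  for Q :: "('g, 'x) monoid_scheme" (structure) and M :: "('m, 'y) monoid_scheme" (structure) +
  fixes act :: "'g \<Rightarrow> 'm \<Rightarrow> 'm"
  assumes act_hom: "g \<in> carrier Q \<Longrightarrow> act g \<in> hom M M"
    and act_mult: "\<lbrakk>g \<in> carrier Q; h \<in> carrier Q; m \<in> carrier M\<rbrakk> \<Longrightarrow> act (g \<otimes>\<^bsub>Q\<^esub> h) m = act g (act h m)"
begin

lemma act_closed [simp, intro]: "\<lbrakk>g \<in> carrier Q; m \<in> carrier M\<rbrakk> \<Longrightarrow> act g m \<in> carrier M"
  using act_hom by (auto simp: hom_def)

lemma act_times: "\<lbrakk>g \<in> carrier Q; m \<in> carrier M; m' \<in> carrier M\<rbrakk>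
    \<Longrightarrow> act g (m \<otimes>\<^bsub>M\<^esub> m') = act g m \<otimes>\<^bsub>M\<^esub> act g m'"
  using act_hom by (auto simp: hom_def)

lemma act_inv: "\<lbrakk>g \<in> carrier Q; m \<in> carrier M\<rbrakk> \<Longrightarrow> act g (inv\<^bsub>M\<^esub> m) = inv\<^bsub>M\<^esub> (act g m)"
  using group_hom.hom_inv[of M M "act g"] act_hom M.is_group
  by (simp add: group_hom_def group_hom_axioms_def)

lemma comm_group_product: "comm_group (product_group I (\<lambda>_. M))"
proof (rule group.group_comm_groupI)
  show "group (product_group I (\<lambda>_. M))" by simp
qed (auto simp: M.m_comm PiE_iff intro!: restrict_ext)

lemma comm_group_cochains2: "comm_group (cochains2 Q M)"
  unfolding cochains2_def by (rule comm_group_product)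

lemma comm_group_cochains1: "comm_group (cochains1 Q M)"
  unfolding cochains1_def by (rule comm_group_product)

lemma group_cochains3: "group (cochains3 Q M)"
  unfolding cochains3_def by simp

lemma diff2_hom: "diff2 Q M act \<in> hom (cochains2 Q M) (cochains3 Q M)"
proof (rule homI)
  fix c assume "c \<in> carrier (cochains2 Q M)"
  then have c: "\<And>g h. g \<in> carrier Q \<Longrightarrow> h \<in> carrier Q \<Longrightarrow> c (g, h) \<in> carrier M"
    by (auto simp: cochains2_def)
  then show "diff2 Q M act c \<in> carrier (cochains3 Q M)"
    by (auto simp: diff2_def cochains3_def)
next
  fix c d assume "c \<in> carrier (cochains2 Q M)" "d \<in> carrier (cochains2 Q M)"
  then have c: "\<And>g h. g \<in> carrier Q \<Longrightarrow> h \<in> carrier Q \<Longrightarrow> c (g, h) \<in> carrier M"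
    and d: "\<And>g h. g \<in> carrier Q \<Longrightarrow> h \<in> carrier Q \<Longrightarrow> d (g, h) \<in> carrier M"
    by (auto simp: cochains2_def)
  show "diff2 Q M act (c \<otimes>\<^bsub>cochains2 Q M\<^esub> d) =
      diff2 Q M act c \<otimes>\<^bsub>cochains3 Q M\<^esub> diff2 Q M act d"
    by (auto simp: diff2_def cochains3_def cochains2_def c d act_times act_inv M.inv_mult M.m_ac
        intro!: ext)
qed

lemma diff1_hom: "diff1 Q M act \<in> hom (cochains1 Q M) (cochains2 Q M)"
proof (rule homI)
  fix c assume "c \<in> carrier (cochains1 Q M)"
  then have c: "\<And>g. g \<in> carrier Q \<Longrightarrow> c g \<in> carrier M"
    by (auto simp: cochains1_def)
  then show "diff1 Q M act c \<in> carrier (cochains2 Q M)"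
    by (auto simp: diff1_def cochains2_def)
next
  fix c d assume "c \<in> carrier (cochains1 Q M)" "d \<in> carrier (cochains1 Q M)"
  then have c: "\<And>g. g \<in> carrier Q \<Longrightarrow> c g \<in> carrier M"
    and d: "\<And>g. g \<in> carrier Q \<Longrightarrow> d g \<in> carrier M"
    by (auto simp: cochains1_def)
  show "diff1 Q M act (c \<otimes>\<^bsub>cochains1 Q M\<^esub> d) =
      diff1 Q M act c \<otimes>\<^bsub>cochains2 Q M\<^esub> diff1 Q M act d"
    by (auto simp: diff1_def cochains1_def cochains2_def c d act_times act_inv M.inv_mult M.m_ac
        intro!: ext)
qed

lemma cocycles2_iff: "c \<in> carrier (cocycles2 Q M act) \<longleftrightarrow>
   c \<in> carrier Q \<times> carrier Q \<rightarrow>\<^sub>E carrier M \<and>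
   (\<forall>g\<in>carrier Q. \<forall>h\<in>carrier Q. \<forall>k\<in>carrier Q.
      act g (c (h, k)) \<otimes>\<^bsub>M\<^esub> inv\<^bsub>M\<^esub> c (g \<otimes>\<^bsub>Q\<^esub> h, k)
          \<otimes>\<^bsub>M\<^esub> c (g, h \<otimes>\<^bsub>Q\<^esub> k) \<otimes>\<^bsub>M\<^esub> inv\<^bsub>M\<^esub> c (g, h) = \<one>\<^bsub>M\<^esub>)"
  unfolding cocycles2_def kernel_def cochains2_def cochains3_def diff2_def
  by (auto simp: fun_eq_iff restrict_def split: if_splits)

lemma subgroup_cocycles2: "subgroup (carrier (cocycles2 Q M act)) (cochains2 Q M)"
proof -
  interpret group_hom "cochains2 Q M" "cochains3 Q M" "diff2 Q M act"
    using diff2_hom comm_group_cochains2 group_cochains3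
    by (simp add: group_hom_def group_hom_axioms_def comm_group_def)
  show ?thesis using subgroup_kernel by (simp add: cocycles2_def)
qed

lemma comm_group_cocycles2: "comm_group (cocycles2 Q M act)"
proof -
  interpret C: comm_group "cochains2 Q M" by (rule comm_group_cochains2)
  have "group ((cochains2 Q M)\<lparr>carrier := carrier (cocycles2 Q M act)\<rparr>)"
    by (rule C.subgroup_imp_group[OF subgroup_cocycles2])
  then have "group (cocycles2 Q M act)" by (simp add: cocycles2_def)
  then show ?thesis
    by (rule group.group_comm_groupI) (auto simp: cocycles2_def kernel_def C.m_comm)
qed

lemma coboundaries2_subset: "coboundaries2 Q M act \<subseteq> carrier (cocycles2 Q M act)"
proof
  fix c assume "c \<in> coboundaries2 Q M act"
  then obtain b where b: "b \<in> carrier (cochains1 Q M)" and c: "c = diff1 Q M act b"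
    by (auto simp: coboundaries2_def)
  have bM: "\<And>g. g \<in> carrier Q \<Longrightarrow> b g \<in> carrier M" using b by (auto simp: cochains1_def)
  have inv_cancel: "\<And>x y. \<lbrakk>x \<in> carrier M; y \<in> carrier M\<rbrakk> \<Longrightarrow> x \<otimes>\<^bsub>M\<^esub> (inv\<^bsub>M\<^esub> x \<otimes>\<^bsub>M\<^esub> y) = y"
    by (simp add: M.m_assoc[symmetric])
  have inv_cancel': "\<And>x y. \<lbrakk>x \<in> carrier M; y \<in> carrier M\<rbrakk> \<Longrightarrow> inv\<^bsub>M\<^esub> x \<otimes>\<^bsub>M\<^esub> (x \<otimes>\<^bsub>M\<^esub> y) = y"
    by (simp add: M.m_assoc[symmetric])
  show "c \<in> carrier (cocycles2 Q M act)"
    unfolding cocycles2_iff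
  proof (intro conjI ballI)
    show "c \<in> carrier Q \<times> carrier Q \<rightarrow>\<^sub>E carrier M"
      using diff1_hom b by (auto simp: c hom_def cochains2_def)
    fix g h k assume ghk: "g \<in> carrier Q" "h \<in> carrier Q" "k \<in> carrier Q"
    show "act g (c (h, k)) \<otimes>\<^bsub>M\<^esub> inv\<^bsub>M\<^esub> c (g \<otimes>\<^bsub>Q\<^esub> h, k)
          \<otimes>\<^bsub>M\<^esub> c (g, h \<otimes>\<^bsub>Q\<^esub> k) \<otimes>\<^bsub>M\<^esub> inv\<^bsub>M\<^esub> c (g, h) = \<one>\<^bsub>M\<^esub>"
      using ghk bM
      by (simp add: c diff1_def act_times act_inv act_mult M.inv_mult M.m_ac Q.m_assoc
          inv_cancel inv_cancel')
  qed
qed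

lemma subgroup_coboundaries2: "subgroup (coboundaries2 Q M act) (cocycles2 Q M act)"
proof -
  interpret group_hom "cochains1 Q M" "cochains2 Q M" "diff1 Q M act"
    using diff1_hom comm_group_cochains2 comm_group_cochains1
    by (simp add: group_hom_def group_hom_axioms_def comm_group_def)
  have "subgroup (coboundaries2 Q M act) (cochains2 Q M)"
    unfolding coboundaries2_def by (rule img_is_subgroup)
  then have "subgroup (coboundaries2 Q M act) ((cochains2 Q M)\<lparr>carrier := carrier (cocycles2 Q M act)\<rparr>)"
    using group.subgroup_incl[OF H.is_group] subgroup_cocycles2 coboundaries2_subset by blast
  then show ?thesis by (simp add: cocycles2_def)
qed

lemma comm_group_H2: "comm_group (H2 Q M act)"
  unfolding H2_def using comm_group.abelian_FactGroup[OF comm_group_cocycles2] subgroup_coboundaries2 by blast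

lemma normal_coboundaries2: "coboundaries2 Q M act \<lhd> cocycles2 Q M act"
  using comm_group.subgroup_imp_normal[OF comm_group_cocycles2] subgroup_coboundaries2 by blast

definition cls :: "('g \<times> 'g \<Rightarrow> 'm) \<Rightarrow> ('g \<times> 'g \<Rightarrow> 'm) set" where
  "cls c = coboundaries2 Q M act #>\<^bsub>cocycles2 Q M act\<^esub> c"

lemma carrier_H2: "carrier (H2 Q M act) = cls ` carrier (cocycles2 Q M act)"
  by (auto simp: H2_def FactGroup_def RCOSETS_def cls_def)

lemma cls_mult: "\<lbrakk>c \<in> carrier (cocycles2 Q M act); d \<in> carrier (cocycles2 Q M act)\<rbrakk> \<Longrightarrow>
   cls (c \<otimes>\<^bsub>cocycles2 Q M act\<^esub> d) = cls c \<otimes>\<^bsub>H2 Q M act\<^esub> cls d"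
  using normal.rcos_sum[OF normal_coboundaries2] by (simp add: cls_def H2_def FactGroup_def)

lemma cls_eq_iff:
  assumes c: "c \<in> carrier (cocycles2 Q M act)" and d: "d \<in> carrier (cocycles2 Q M act)"
  shows "cls c = cls d \<longleftrightarrow> (\<exists>b\<in>coboundaries2 Q M act. c = b \<otimes>\<^bsub>cocycles2 Q M act\<^esub> d)"
proof -
  interpret Z: comm_group "cocycles2 Q M act" by (rule comm_group_cocycles2)
  have "cls c = cls d \<longleftrightarrow> c \<in> cls d"
    using Z.repr_independence[OF _ d subgroup_coboundaries2, of c] 
      Z.rcos_self[OF c subgroup_coboundaries2] by (auto simp: cls_def)
  then show ?thesis by (auto simp: cls_def r_coset_def)
qed

lemma cls_eq_one_iff:
  assumes c: "c \<in> carrier (cocycles2 Q M act)"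
  shows "cls c = \<one>\<^bsub>H2 Q M act\<^esub> \<longleftrightarrow> c \<in> coboundaries2 Q M act"
proof -
  interpret Z: comm_group "cocycles2 Q M act" by (rule comm_group_cocycles2)
  show ?thesis
    using Z.coset_join1 Z.coset_join2 c subgroup_coboundaries2 coboundaries2_subset
    by (auto simp: cls_def H2_def FactGroup_def)
qed

lemma module_action_subgroup:
  assumes "subgroup D Q"
  shows "module_action (Q\<lparr>carrier := D\<rparr>) M act"
proof -
  interpret D: group "Q\<lparr>carrier := D\<rparr>"
    using Q.subgroup_imp_group[OF assms] .
  show ?thesis
    using subgroup.subset[OF assms]
    by unfold_locales (auto simp: act_hom act_mult subset_iff)
qed

lemma restrict_cocycle:
  assumes D: "subgroup D Q" and c: "c \<in> carrier (cocycles2 Q M act)"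
  shows "restrict c (D \<times> D) \<in> carrier (cocycles2 (Q\<lparr>carrier := D\<rparr>) M act)"
proof -
  interpret D: module_action "Q\<lparr>carrier := D\<rparr>" M act by (rule module_action_subgroup[OF D])
  show ?thesis
    using c subgroup.subset[OF D] subgroup.m_closed[OF D]
    unfolding cocycles2_iff D.cocycles2_iff by (auto simp: subset_iff PiE_iff)
qed

lemma restrict_coboundary:
  assumes D: "subgroup D Q" and c: "c \<in> coboundaries2 Q M act"
  shows "restrict c (D \<times> D) \<in> coboundaries2 (Q\<lparr>carrier := D\<rparr>) M act"
proof -
  obtain b where b: "b \<in> carrier Q \<rightarrow>\<^sub>E carrier M" and cb: "c = diff1 Q M act b"
    using c by (auto simp: coboundaries2_def cochains1_def)
  have "restrict c (D \<times> D) = diff1 (Q\<lparr>carrier := D\<rparr>) M act (restrict b D)"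
    using subgroup.subset[OF D] subgroup.m_closed[OF D]
    by (auto simp: cb diff1_def fun_eq_iff restrict_def subset_iff)
  moreover have "restrict b D \<in> carrier (cochains1 (Q\<lparr>carrier := D\<rparr>) M)"
    using b subgroup.subset[OF D] by (auto simp: cochains1_def)
  ultimately show ?thesis unfolding coboundaries2_def by blast
qed

text \<open>Members of one class differ by a coboundary, and a coboundary restricts to a coboundary
  on \<open>D\<close>. The image in the definition of \<open>res2\<close> is therefore a singleton,
  and \<open>the_elem\<close> returns its member.\<close>

lemma res2_cls:
  assumes D: "subgroup D Q" and c: "c \<in> carrier (cocycles2 Q M act)"
  shows "res2 Q M act D (cls c) = module_action.cls (Q\<lparr>carrier := D\<rparr>) M act (restrict c (D \<times> D))"
proof -
  interpret D: module_action "Q\<lparr>carrier := D\<rparr>" M act by (rule module_action_subgroup[OF D])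
  have "D.cls (restrict d (D \<times> D)) = D.cls (restrict c (D \<times> D))" if d: "d \<in> cls c" for d
  proof -
    obtain b where b: "b \<in> coboundaries2 Q M act" and dd: "d = b \<otimes>\<^bsub>cocycles2 Q M act\<^esub> c"
      using d by (auto simp: cls_def r_coset_def)
    have dc: "d \<in> carrier (cocycles2 Q M act)"
      using dd b c coboundaries2_subset comm_group.axioms(2)[OF comm_group_cocycles2]
      by (metis group.is_monoid monoid.m_closed subset_eq)
    have eq: "restrict d (D \<times> D) =
        restrict b (D \<times> D) \<otimes>\<^bsub>cocycles2 (Q\<lparr>carrier := D\<rparr>) M act\<^esub> restrict c (D \<times> D)"
      using subgroup.subset[OF D] by (auto simp: dd cocycles2_def cochains2_def fun_eq_iff restrict_def subset_iff)
    show ?thesis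
      unfolding D.cls_eq_iff[OF restrict_cocycle[OF D dc] restrict_cocycle[OF D c]]
      using eq restrict_coboundary[OF D b] by blast
  qed
  moreover have "c \<in> cls c"
    unfolding cls_def using group.rcos_self[OF comm_group.axioms(2)[OF comm_group_cocycles2] c subgroup_coboundaries2] .
  ultimately have "(\<lambda>d. D.cls (restrict d (D \<times> D))) ` cls c = {D.cls (restrict c (D \<times> D))}"
    by blast
  then show ?thesis by (simp add: res2_def D.cls_def)
qed

lemma cls_in_Sha2_iff:
  assumes fin: "finite \<D>" and D: "\<And>D. D \<in> \<D> \<Longrightarrow> subgroup D Q"
    and c: "c \<in> carrier (cocycles2 Q M act)"
  shows "cls c \<in> carrier (Sha2 Q \<D> M act) \<longleftrightarrow>
    (\<forall>D\<in>\<D>. restrict c (D \<times> D) \<in> coboundaries2 (Q\<lparr>carrier := D\<rparr>) M act)"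
proof -
  have "cls c \<in> carrier (Sha2 Q \<D> M act) \<longleftrightarrow>
     (\<lambda>D\<in>\<D>. res2 Q M act D (cls c)) = (\<lambda>D\<in>\<D>. \<one>\<^bsub>H2 (Q\<lparr>carrier := D\<rparr>) M act\<^esub>)"
    using c by (simp add: Sha2_def kernel_def carrier_H2)
  also have "\<dots> \<longleftrightarrow> (\<forall>D\<in>\<D>. res2 Q M act D (cls c) = \<one>\<^bsub>H2 (Q\<lparr>carrier := D\<rparr>) M act\<^esub>)"
    by (auto simp: fun_eq_iff restrict_def)
  also have "\<dots> \<longleftrightarrow> (\<forall>D\<in>\<D>. restrict c (D \<times> D) \<in> coboundaries2 (Q\<lparr>carrier := D\<rparr>) M act)"
    using module_action.cls_eq_one_iff[OF module_action_subgroup[OF D] restrict_cocycle[OF D c]]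
    by (simp add: res2_cls[OF D c])
  finally show ?thesis .
qed

end

section \<open>The lattice of a subgroup\<close>

locale coset_module = G?: group G for G :: "('a, 'x) monoid_scheme" (structure) +
  fixes H :: "'a set"
  assumes subgroup_H: "subgroup H G"
begin

text \<open>These are the functions on the right cosets of \<open>H\<close>. The value type is left
  open because integers, reals and the circle all occur.\<close>

definition hinv :: "('a \<Rightarrow> 'b) \<Rightarrow> bool" where
  "hinv m \<longleftrightarrow> (\<forall>x\<in>carrier G. \<forall>h\<in>H. m (h \<otimes> x) = m x)"

lemma hinvD: "\<lbrakk>hinv m; x \<in> carrier G; h \<in> H\<rbrakk> \<Longrightarrow> m (h \<otimes> x) = m x"
  by (simp add: hinv_def)

lemma H_carrier: "h \<in> H \<Longrightarrow> h \<in> carrier G"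
  using subgroup.subset[OF subgroup_H] by blast

lemma hinv_translate: "\<lbrakk>hinv m; g \<in> carrier G\<rbrakk> \<Longrightarrow> hinv (\<lambda>x. m (x \<otimes> g))"
  using H_carrier by (auto simp: hinv_def G.m_assoc)

abbreviation constfuns where "constfuns \<equiv> range (\<lambda>n::int. \<lambda>g\<in>carrier G. n)"

lemma Ind_int_iff: "\<phi> \<in> carrier (Ind_int G H) \<longleftrightarrow> \<phi> \<in> extensional (carrier G) \<and> hinv \<phi>"
  by (auto simp: Ind_int_def hinv_def PiE_def)

lemma Ind_int_mult: "\<phi> \<otimes>\<^bsub>Ind_int G H\<^esub> \<psi> = (\<lambda>x\<in>carrier G. \<phi> x + \<psi> x)"
  by (simp add: Ind_int_def)

lemma Ind_int_one: "\<one>\<^bsub>Ind_int G H\<^esub> = (\<lambda>x\<in>carrier G. 0)"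
  by (simp add: Ind_int_def)

lemma comm_group_Ind_int: "comm_group (Ind_int G H)"
proof (rule comm_groupI)
  fix \<phi> assume p: "\<phi> \<in> carrier (Ind_int G H)"
  show "\<exists>\<psi>\<in>carrier (Ind_int G H). \<psi> \<otimes>\<^bsub>Ind_int G H\<^esub> \<phi> = \<one>\<^bsub>Ind_int G H\<^esub>"
    by (rule bexI[of _ "\<lambda>x\<in>carrier G. - \<phi> x"])
      (use p H_carrier in \<open>auto simp: Ind_int_iff Ind_int_mult Ind_int_one hinv_def intro!: restrict_ext\<close>)
next
  fix \<phi> \<psi> assume p: "\<phi> \<in> carrier (Ind_int G H)" "\<psi> \<in> carrier (Ind_int G H)"
  show "\<phi> \<otimes>\<^bsub>Ind_int G H\<^esub> \<psi> \<in> carrier (Ind_int G H)"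
    using p H_carrier by (auto simp: Ind_int_iff Ind_int_mult hinv_def)
  show "\<phi> \<otimes>\<^bsub>Ind_int G H\<^esub> \<psi> = \<psi> \<otimes>\<^bsub>Ind_int G H\<^esub> \<phi>"
    by (auto simp: Ind_int_mult intro!: restrict_ext)
  fix \<chi>
  show "\<phi> \<otimes>\<^bsub>Ind_int G H\<^esub> \<psi> \<otimes>\<^bsub>Ind_int G H\<^esub> \<chi> = \<phi> \<otimes>\<^bsub>Ind_int G H\<^esub> (\<psi> \<otimes>\<^bsub>Ind_int G H\<^esub> \<chi>)"
    by (auto simp: Ind_int_mult intro!: restrict_ext)
next
  show "\<one>\<^bsub>Ind_int G H\<^esub> \<in> carrier (Ind_int G H)"
    using H_carrier by (auto simp: Ind_int_iff Ind_int_one hinv_def)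
  fix \<phi> assume "\<phi> \<in> carrier (Ind_int G H)"
  then have "restrict \<phi> (carrier G) = \<phi>" by (simp add: Ind_int_iff extensional_restrict)
  then show "\<one>\<^bsub>Ind_int G H\<^esub> \<otimes>\<^bsub>Ind_int G H\<^esub> \<phi> = \<phi>"
    by (simp add: Ind_int_mult Ind_int_one cong: restrict_cong)
qed

lemma subgroup_constfuns: "subgroup constfuns (Ind_int G H)"
proof -
  interpret I: comm_group "Ind_int G H" by (rule comm_group_Ind_int)
  have inv: "inv\<^bsub>Ind_int G H\<^esub> (\<lambda>g\<in>carrier G. n) = (\<lambda>g\<in>carrier G. - n)" for n
    by (rule I.inv_equality)
      (use H_carrier in \<open>auto simp: Ind_int_iff Ind_int_mult Ind_int_one hinv_def intro!: restrict_ext\<close>)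
  show ?thesis
  proof (rule I.subgroupI)
    show "constfuns \<subseteq> carrier (Ind_int G H)" using H_carrier by (auto simp: Ind_int_iff hinv_def)
    show "a \<otimes>\<^bsub>Ind_int G H\<^esub> b \<in> constfuns" if ab: "a \<in> constfuns" "b \<in> constfuns" for a b
    proof -
      obtain m n where "a = (\<lambda>n. \<lambda>g\<in>carrier G. n) m" "b = (\<lambda>n. \<lambda>g\<in>carrier G. n) n"
        using ab by blast
      then have "a \<otimes>\<^bsub>Ind_int G H\<^esub> b = (\<lambda>g\<in>carrier G. m + n)"
        by (auto simp: Ind_int_mult intro!: restrict_ext)
      then show ?thesis by blast
    qed
  qed (auto simp: inv)
qed

lemma comm_group_J: "comm_group (J G H)"
  unfolding J_def using comm_group.abelian_FactGroup[OF comm_group_Ind_int subgroup_constfuns] .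

text \<open>The restriction allows any total function to stand for an element of
  \<open>J G H\<close>, although the elements of \<open>Ind_int G H\<close> are extensional.\<close>

definition proj :: "('a \<Rightarrow> int) \<Rightarrow> ('a \<Rightarrow> int) set" where
  "proj \<phi> = constfuns #>\<^bsub>Ind_int G H\<^esub> restrict \<phi> (carrier G)"

lemma proj_iff: "\<psi> \<in> proj \<phi> \<longleftrightarrow> (\<exists>n. \<psi> = (\<lambda>x\<in>carrier G. n + \<phi> x))"
proof -
  have "(\<lambda>x\<in>carrier G. n) \<otimes>\<^bsub>Ind_int G H\<^esub> restrict \<phi> (carrier G) = (\<lambda>x\<in>carrier G. n + \<phi> x)" for n
    by (auto simp: Ind_int_mult intro!: restrict_ext)
  then show ?thesis by (auto simp: proj_def r_coset_def)
qed

lemma proj_eq_iff: "proj \<phi> = proj \<psi> \<longleftrightarrow> (\<forall>x\<in>carrier G. \<phi> x - \<psi> x = \<phi> \<one> - \<psi> \<one>)"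
proof
  assume "proj \<phi> = proj \<psi>"
  moreover have "restrict \<phi> (carrier G) \<in> proj \<phi>" unfolding proj_iff by (rule exI[of _ 0]) simp
  ultimately obtain n where "restrict \<phi> (carrier G) = (\<lambda>x\<in>carrier G. n + \<psi> x)"
    by (auto simp: proj_iff)
  then have "\<phi> x = n + \<psi> x" if "x \<in> carrier G" for x
    using that by (metis restrict_apply')
  then show "\<forall>x\<in>carrier G. \<phi> x - \<psi> x = \<phi> \<one> - \<psi> \<one>" by simp
next
  assume *: "\<forall>x\<in>carrier G. \<phi> x - \<psi> x = \<phi> \<one> - \<psi> \<one>"
  define d where "d = \<phi> \<one> - \<psi> \<one>"
  have a: "\<phi> x = d + \<psi> x" if "x \<in> carrier G" for x
    using * that d_def by fastforce
  have "(\<lambda>x\<in>carrier G. n + \<phi> x) = (\<lambda>x\<in>carrier G. (n + d) + \<psi> x)" for n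
    by (auto simp: a intro!: restrict_ext)
  moreover have "(\<lambda>x\<in>carrier G. n + \<psi> x) = (\<lambda>x\<in>carrier G. (n - d) + \<phi> x)" for n
    by (auto simp: a intro!: restrict_ext)
  ultimately show "proj \<phi> = proj \<psi>" unfolding set_eq_iff proj_iff by metis
qed

lemma restrict_in_Ind: "hinv \<phi> \<Longrightarrow> restrict \<phi> (carrier G) \<in> carrier (Ind_int G H)"
  using H_carrier by (auto simp: Ind_int_iff hinv_def)

lemma carrier_J: "carrier (J G H) = proj ` {\<phi>. hinv \<phi>}"
proof
  show "carrier (J G H) \<subseteq> proj ` {\<phi>. hinv \<phi>}"
  proof
    fix m assume "m \<in> carrier (J G H)"
    then obtain \<phi> where p: "\<phi> \<in> carrier (Ind_int G H)" "m = constfuns #>\<^bsub>Ind_int G H\<^esub> \<phi>"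
      by (auto simp: J_def FactGroup_def RCOSETS_def)
    then have "restrict \<phi> (carrier G) = \<phi>" by (simp add: Ind_int_iff extensional_restrict)
    then show "m \<in> proj ` {\<phi>. hinv \<phi>}" using p by (auto simp: proj_def Ind_int_iff intro!: image_eqI[of _ _ \<phi>])
  qed
  show "proj ` {\<phi>. hinv \<phi>} \<subseteq> carrier (J G H)"
    using restrict_in_Ind by (auto simp: J_def FactGroup_def RCOSETS_def proj_def)
qed

lemma proj_closed [simp, intro]: "hinv \<phi> \<Longrightarrow> proj \<phi> \<in> carrier (J G H)"
  by (auto simp: carrier_J)

text \<open>Representatives vanishing at the identity turn an equation in \<open>J G H\<close> into
  an equation of integer functions, with no unknown constant left over.\<close>

lemma J_cases:
  assumes "m \<in> carrier (J G H)"
  obtains \<phi> where "hinv \<phi>" "m = proj \<phi>" "\<phi> \<one> = 0"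
proof -
  obtain \<phi> where p: "hinv \<phi>" "m = proj \<phi>" using assms by (auto simp: carrier_J)
  have "proj \<phi> = proj (\<lambda>x. \<phi> x - \<phi> \<one>)" by (simp add: proj_eq_iff)
  moreover have "hinv (\<lambda>x. \<phi> x - \<phi> \<one>)" using p(1) by (simp add: hinv_def)
  ultimately show ?thesis using that p by simp
qed

lemma proj_mult: "\<lbrakk>hinv \<phi>; hinv \<psi>\<rbrakk> \<Longrightarrow> proj \<phi> \<otimes>\<^bsub>J G H\<^esub> proj \<psi> = proj (\<lambda>x. \<phi> x + \<psi> x)"
proof -
  assume p: "hinv \<phi>" "hinv \<psi>"
  have "constfuns \<lhd> Ind_int G H"
    by (rule comm_group.subgroup_imp_normal[OF comm_group_Ind_int subgroup_constfuns])
  then have "proj \<phi> \<otimes>\<^bsub>J G H\<^esub> proj \<psi> =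
      constfuns #>\<^bsub>Ind_int G H\<^esub> (restrict \<phi> (carrier G) \<otimes>\<^bsub>Ind_int G H\<^esub> restrict \<psi> (carrier G))"
    using p restrict_in_Ind normal.rcos_sum by (fastforce simp: proj_def J_def FactGroup_def)
  also have "\<dots> = proj (\<lambda>x. \<phi> x + \<psi> x)"
    unfolding proj_def by (rule arg_cong[where f = "r_coset _ _"]) (auto simp: Ind_int_mult fun_eq_iff)
  finally show ?thesis .
qed

lemma proj_one: "\<one>\<^bsub>J G H\<^esub> = proj (\<lambda>_. 0)"
proof -
  have "(\<lambda>x\<in>carrier G. 0::int) \<in> constfuns" by blast
  then have "proj (\<lambda>_. 0) = constfuns"
    using group.coset_join2[OF comm_group.axioms(2)[OF comm_group_Ind_int] _ subgroup_constfuns]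
      restrict_in_Ind[of "\<lambda>_. 0"] by (simp add: proj_def hinv_def)
  then show ?thesis by (simp add: J_def FactGroup_def)
qed

lemma proj_eq_one_iff: "proj \<phi> = \<one>\<^bsub>J G H\<^esub> \<longleftrightarrow> (\<forall>x\<in>carrier G. \<phi> x = \<phi> \<one>)"
  unfolding proj_one proj_eq_iff by auto

lemma proj_inv:
  assumes "hinv \<phi>" shows "inv\<^bsub>J G H\<^esub> proj \<phi> = proj (\<lambda>x. - \<phi> x)"
proof -
  interpret J: comm_group "J G H" by (rule comm_group_J)
  have "hinv (\<lambda>x. - \<phi> x)" using assms by (simp add: hinv_def)
  then show ?thesis
    using assms by (intro J.inv_equality) (auto simp: proj_mult proj_one)
qed

lemma J_act_proj:
  assumes g: "g \<in> carrier G"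
  shows "J_act G g (proj \<phi>) = proj (\<lambda>x. \<phi> (x \<otimes> g))"
proof -
  have "Ind_act G g (\<lambda>x\<in>carrier G. n + \<phi> x) = (\<lambda>x\<in>carrier G. n + \<phi> (x \<otimes> g))" for n
    using g by (auto simp: Ind_act_def intro!: restrict_ext)
  then show ?thesis
    unfolding set_eq_iff J_act_def image_iff Bex_def proj_iff by metis
qed

end

section \<open>Crossed homomorphisms with values in the circle\<close>

text \<open>The group \<open>Q\<close> acts on the cosets through \<open>\<tau>\<close>, which is
  the identity for \<open>G\<close> itself and a choice of representatives for a quotient. In the
  latter case products are respected only up to a factor from \<open>H\<close> on the left, and left
  invariant functions ignore such a factor.\<close>

locale coset_cocycles = coset_module G H + Q?: group Q
  for G :: "('a, 'x) monoid_scheme" (structure) and H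
    and Q :: "('c, 'y) monoid_scheme" (structure) +
  fixes \<tau> :: "'c \<Rightarrow> 'a"
  assumes finite_G: "finite (carrier G)" and finite_Q: "finite (carrier Q)"
    and tau_closed [simp, intro]: "\<gamma> \<in> carrier Q \<Longrightarrow> \<tau> \<gamma> \<in> carrier G"
    and tau_mult: "\<lbrakk>\<gamma> \<in> carrier Q; \<delta> \<in> carrier Q; x \<in> carrier G\<rbrakk> \<Longrightarrow>
        \<exists>h\<in>H. x \<otimes>\<^bsub>G\<^esub> \<tau> (\<gamma> \<otimes>\<^bsub>Q\<^esub> \<delta>) = h \<otimes>\<^bsub>G\<^esub> (x \<otimes>\<^bsub>G\<^esub> \<tau> \<gamma> \<otimes>\<^bsub>G\<^esub> \<tau> \<delta>)"
begin

lemma hinv_tau_mult: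
  assumes "hinv m" "\<gamma> \<in> carrier Q" "\<delta> \<in> carrier Q" "x \<in> carrier G"
  shows "m (x \<otimes>\<^bsub>G\<^esub> \<tau> (\<gamma> \<otimes>\<^bsub>Q\<^esub> \<delta>)) = m (x \<otimes>\<^bsub>G\<^esub> \<tau> \<gamma> \<otimes>\<^bsub>G\<^esub> \<tau> \<delta>)"
proof -
  obtain h where "h \<in> H" "x \<otimes>\<^bsub>G\<^esub> \<tau> (\<gamma> \<otimes>\<^bsub>Q\<^esub> \<delta>) = h \<otimes>\<^bsub>G\<^esub> (x \<otimes>\<^bsub>G\<^esub> \<tau> \<gamma> \<otimes>\<^bsub>G\<^esub> \<tau> \<delta>)"
    using tau_mult assms by blast
  then show ?thesis using hinvD[OF assms(1)] assms by simp
qed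

lemma hinv_tau_mult_one:
  assumes "hinv m" "\<gamma> \<in> carrier Q" "\<delta> \<in> carrier Q"
  shows "m (\<tau> (\<gamma> \<otimes>\<^bsub>Q\<^esub> \<delta>)) = m (\<tau> \<gamma> \<otimes>\<^bsub>G\<^esub> \<tau> \<delta>)"
  using hinv_tau_mult[OF assms, of "\<one>\<^bsub>G\<^esub>"] assms by simp

lemma module_action_J:
  assumes act: "\<And>\<gamma> m. \<lbrakk>\<gamma> \<in> carrier Q; m \<in> carrier (J G H)\<rbrakk> \<Longrightarrow> act \<gamma> m = J_act G (\<tau> \<gamma>) m"
  shows "module_action Q (J G H) act"
proof -
  interpret J: comm_group "J G H" by (rule comm_group_J)
  have cl: "act \<gamma> (proj \<phi>) = proj (\<lambda>x. \<phi> (x \<otimes>\<^bsub>G\<^esub> \<tau> \<gamma>))" if "\<gamma> \<in> carrier Q" "hinv \<phi>" for \<gamma> \<phi>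
    using that by (simp add: act J_act_proj)
  show ?thesis
  proof unfold_locales
    fix \<gamma> assume g: "\<gamma> \<in> carrier Q"
    show "act \<gamma> \<in> hom (J G H) (J G H)"
    proof (rule homI)
      fix m assume "m \<in> carrier (J G H)"
      then show "act \<gamma> m \<in> carrier (J G H)"
        using g by (elim J_cases) (auto simp: cl hinv_translate)
    next
      fix m n assume "m \<in> carrier (J G H)" "n \<in> carrier (J G H)"
      then obtain \<phi> \<psi> where p: "hinv \<phi>" "m = proj \<phi>" "hinv \<psi>" "n = proj \<psi>"
        by (metis J_cases)
      have "hinv (\<lambda>x. \<phi> x + \<psi> x)" using p by (simp add: hinv_def)
      then show "act \<gamma> (m \<otimes>\<^bsub>J G H\<^esub> n) = act \<gamma> m \<otimes>\<^bsub>J G H\<^esub> act \<gamma> n"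
        using p g by (simp add: cl proj_mult hinv_translate)
    qed
  next
    fix \<gamma> \<delta> m assume g: "\<gamma> \<in> carrier Q" "\<delta> \<in> carrier Q" "m \<in> carrier (J G H)"
    then obtain \<phi> where p: "hinv \<phi>" "m = proj \<phi>" by (metis J_cases)
    have "proj (\<lambda>x. \<phi> (x \<otimes>\<^bsub>G\<^esub> \<tau> (\<gamma> \<otimes>\<^bsub>Q\<^esub> \<delta>))) = proj (\<lambda>x. \<phi> (x \<otimes>\<^bsub>G\<^esub> \<tau> \<gamma> \<otimes>\<^bsub>G\<^esub> \<tau> \<delta>))"
      using g p by (simp add: proj_eq_iff hinv_tau_mult hinv_tau_mult_one)
    then show "act (\<gamma> \<otimes>\<^bsub>Q\<^esub> \<delta>) m = act \<gamma> (act \<delta> m)"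
      using g p by (simp add: cl hinv_translate)
  qed
qed

text \<open>The right-hand side is the left-hand side at the identity, so the defect is a constant
  function: \<open>b\<close> is a crossed homomorphism into invariant functions modulo constants.
  The set \<open>K\<close> is a parameter so that restriction to a subgroup is mere inclusion of
  sets.\<close>

definition cocyc :: "'c set \<Rightarrow> ('c \<Rightarrow> 'a \<Rightarrow> 'b::ab_group_add) \<Rightarrow> bool" where
  "cocyc K b \<longleftrightarrow> (\<forall>\<gamma>\<in>K. hinv (b \<gamma>)) \<and>
    (\<forall>\<gamma>\<in>K. \<forall>\<delta>\<in>K. \<forall>x\<in>carrier G. b \<gamma> x + b \<delta> (x \<otimes>\<^bsub>G\<^esub> \<tau> \<gamma>) - b (\<gamma> \<otimes>\<^bsub>Q\<^esub> \<delta>) x =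
       b \<gamma> \<one>\<^bsub>G\<^esub> + b \<delta> (\<tau> \<gamma>) - b (\<gamma> \<otimes>\<^bsub>Q\<^esub> \<delta>) \<one>\<^bsub>G\<^esub>)"

text \<open>The arbitrary function \<open>e\<close> absorbs the constants modulo which coboundaries
  are taken.\<close>

definition triv :: "'c set \<Rightarrow> ('c \<Rightarrow> 'a \<Rightarrow> 'b::ab_group_add) \<Rightarrow> bool" where
  "triv K b \<longleftrightarrow> (\<exists>m e. hinv m \<and> (\<forall>\<gamma>\<in>K. \<forall>x\<in>carrier G. b \<gamma> x = m (x \<otimes>\<^bsub>G\<^esub> \<tau> \<gamma>) - m x + e \<gamma>))"

lemma trivI: "\<lbrakk>hinv m; \<And>\<gamma> x. \<lbrakk>\<gamma> \<in> K; x \<in> carrier G\<rbrakk> \<Longrightarrow> b \<gamma> x = m (x \<otimes>\<^bsub>G\<^esub> \<tau> \<gamma>) - m x + e \<gamma>\<rbrakk> \<Longrightarrow> triv K b"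
  unfolding triv_def by blast

lemma cocycI: "\<lbrakk>\<And>\<gamma>. \<gamma> \<in> K \<Longrightarrow> hinv (b \<gamma>);
   \<And>\<gamma> \<delta> x. \<lbrakk>\<gamma> \<in> K; \<delta> \<in> K; x \<in> carrier G\<rbrakk> \<Longrightarrow> b \<gamma> x + b \<delta> (x \<otimes>\<^bsub>G\<^esub> \<tau> \<gamma>) - b (\<gamma> \<otimes>\<^bsub>Q\<^esub> \<delta>) x =
       b \<gamma> \<one>\<^bsub>G\<^esub> + b \<delta> (\<tau> \<gamma>) - b (\<gamma> \<otimes>\<^bsub>Q\<^esub> \<delta>) \<one>\<^bsub>G\<^esub>\<rbrakk> \<Longrightarrow> cocyc K b"
  unfolding cocyc_def by blast

lemma cocyc_hinv: "\<lbrakk>cocyc K b; \<gamma> \<in> K\<rbrakk> \<Longrightarrow> hinv (b \<gamma>)"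
  unfolding cocyc_def by blast

lemma cocyc_eq: "\<lbrakk>cocyc K b; \<gamma> \<in> K; \<delta> \<in> K; x \<in> carrier G\<rbrakk> \<Longrightarrow>
   b \<gamma> x + b \<delta> (x \<otimes>\<^bsub>G\<^esub> \<tau> \<gamma>) - b (\<gamma> \<otimes>\<^bsub>Q\<^esub> \<delta>) x =
       b \<gamma> \<one>\<^bsub>G\<^esub> + b \<delta> (\<tau> \<gamma>) - b (\<gamma> \<otimes>\<^bsub>Q\<^esub> \<delta>) \<one>\<^bsub>G\<^esub>"
  unfolding cocyc_def by blast

lemma cocycD: "\<lbrakk>cocyc K b; \<gamma> \<in> K; \<delta> \<in> K; x \<in> carrier G\<rbrakk> \<Longrightarrow>
   b (\<gamma> \<otimes>\<^bsub>Q\<^esub> \<delta>) x = b \<gamma> x + b \<delta> (x \<otimes>\<^bsub>G\<^esub> \<tau> \<gamma>) - (b \<gamma> \<one>\<^bsub>G\<^esub> + b \<delta> (\<tau> \<gamma>) - b (\<gamma> \<otimes>\<^bsub>Q\<^esub> \<delta>) \<one>\<^bsub>G\<^esub>)"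
proof -
  assume "cocyc K b" "\<gamma> \<in> K" "\<delta> \<in> K" "x \<in> carrier G"
  then have eq: "b \<gamma> x + b \<delta> (x \<otimes>\<^bsub>G\<^esub> \<tau> \<gamma>) - b (\<gamma> \<otimes>\<^bsub>Q\<^esub> \<delta>) x =
       b \<gamma> \<one>\<^bsub>G\<^esub> + b \<delta> (\<tau> \<gamma>) - b (\<gamma> \<otimes>\<^bsub>Q\<^esub> \<delta>) \<one>\<^bsub>G\<^esub>"
    unfolding cocyc_def by blast
  show ?thesis unfolding eq[symmetric] by simp
qed

lemma cocyc_subset: "\<lbrakk>cocyc K b; L \<subseteq> K\<rbrakk> \<Longrightarrow> cocyc L b"
  unfolding cocyc_def by blast

lemma triv_subset: "\<lbrakk>triv K b; L \<subseteq> K\<rbrakk> \<Longrightarrow> triv L b"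
  unfolding triv_def by blast

lemma cocyc_add:
  assumes "cocyc K b" "cocyc K b'"
  shows "cocyc K (\<lambda>\<gamma> x. b \<gamma> x + b' \<gamma> x)"
proof (rule cocycI)
  show "hinv (\<lambda>x. b \<gamma> x + b' \<gamma> x)" if "\<gamma> \<in> K" for \<gamma>
    using cocyc_hinv[OF assms(1) that] cocyc_hinv[OF assms(2) that] by (simp add: hinv_def)
  fix \<gamma> \<delta> x assume "\<gamma> \<in> K" "\<delta> \<in> K" "x \<in> carrier G"
  from arg_cong2[where f = "(+)", OF cocyc_eq[OF assms(1) this] cocyc_eq[OF assms(2) this]]
  show "b \<gamma> x + b' \<gamma> x + (b \<delta> (x \<otimes>\<^bsub>G\<^esub> \<tau> \<gamma>) + b' \<delta> (x \<otimes>\<^bsub>G\<^esub> \<tau> \<gamma>))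
      - (b (\<gamma> \<otimes>\<^bsub>Q\<^esub> \<delta>) x + b' (\<gamma> \<otimes>\<^bsub>Q\<^esub> \<delta>) x) =
      b \<gamma> \<one>\<^bsub>G\<^esub> + b' \<gamma> \<one>\<^bsub>G\<^esub> + (b \<delta> (\<tau> \<gamma>) + b' \<delta> (\<tau> \<gamma>))
      - (b (\<gamma> \<otimes>\<^bsub>Q\<^esub> \<delta>) \<one>\<^bsub>G\<^esub> + b' (\<gamma> \<otimes>\<^bsub>Q\<^esub> \<delta>) \<one>\<^bsub>G\<^esub>)"
    by (simp add: algebra_simps)
qed

lemma cocyc_diff:
  assumes "cocyc K b" "cocyc K b'"
  shows "cocyc K (\<lambda>\<gamma> x. b \<gamma> x - b' \<gamma> x)"
proof (rule cocycI)
  show "hinv (\<lambda>x. b \<gamma> x - b' \<gamma> x)" if "\<gamma> \<in> K" for \<gamma>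
    using cocyc_hinv[OF assms(1) that] cocyc_hinv[OF assms(2) that] by (simp add: hinv_def)
  fix \<gamma> \<delta> x assume "\<gamma> \<in> K" "\<delta> \<in> K" "x \<in> carrier G"
  from arg_cong2[where f = "(-)", OF cocyc_eq[OF assms(1) this] cocyc_eq[OF assms(2) this]]
  show "b \<gamma> x - b' \<gamma> x + (b \<delta> (x \<otimes>\<^bsub>G\<^esub> \<tau> \<gamma>) - b' \<delta> (x \<otimes>\<^bsub>G\<^esub> \<tau> \<gamma>))
      - (b (\<gamma> \<otimes>\<^bsub>Q\<^esub> \<delta>) x - b' (\<gamma> \<otimes>\<^bsub>Q\<^esub> \<delta>) x) =
      b \<gamma> \<one>\<^bsub>G\<^esub> - b' \<gamma> \<one>\<^bsub>G\<^esub> + (b \<delta> (\<tau> \<gamma>) - b' \<delta> (\<tau> \<gamma>))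
      - (b (\<gamma> \<otimes>\<^bsub>Q\<^esub> \<delta>) \<one>\<^bsub>G\<^esub> - b' (\<gamma> \<otimes>\<^bsub>Q\<^esub> \<delta>) \<one>\<^bsub>G\<^esub>)"
    by (simp add: algebra_simps)
qed

lemma cocyc_zero: "cocyc K (\<lambda>_ _. 0)"
  by (rule cocycI) (auto simp: hinv_def)

lemma cocyc_ntimes: "cocyc K b \<Longrightarrow> cocyc K (\<lambda>\<gamma> x. n \<cdot> b \<gamma> x)"
  by (induction n) (auto intro: cocyc_add cocyc_zero)

lemma triv_add:
  assumes "triv K b" "triv K b'"
  shows "triv K (\<lambda>\<gamma> x. b \<gamma> x + b' \<gamma> x)"
proof -
  obtain m e where m: "hinv m" "\<And>\<gamma> x. \<lbrakk>\<gamma> \<in> K; x \<in> carrier G\<rbrakk> \<Longrightarrow> b \<gamma> x = m (x \<otimes>\<^bsub>G\<^esub> \<tau> \<gamma>) - m x + e \<gamma>"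
    using assms(1) unfolding triv_def by blast
  obtain m' e' where m': "hinv m'" "\<And>\<gamma> x. \<lbrakk>\<gamma> \<in> K; x \<in> carrier G\<rbrakk> \<Longrightarrow> b' \<gamma> x = m' (x \<otimes>\<^bsub>G\<^esub> \<tau> \<gamma>) - m' x + e' \<gamma>"
    using assms(2) unfolding triv_def by blast
  show ?thesis
  proof (rule trivI[of "\<lambda>x. m x + m' x" _ _ "\<lambda>x. e x + e' x"])
    show "hinv (\<lambda>x. m x + m' x)" using m(1) m'(1) by (simp add: hinv_def)
  qed (simp add: m(2) m'(2) algebra_simps)
qed

lemma triv_diff:
  assumes "triv K b" "triv K b'"
  shows "triv K (\<lambda>\<gamma> x. b \<gamma> x - b' \<gamma> x)"
proof -
  obtain m e where m: "hinv m" "\<And>\<gamma> x. \<lbrakk>\<gamma> \<in> K; x \<in> carrier G\<rbrakk> \<Longrightarrow> b \<gamma> x = m (x \<otimes>\<^bsub>G\<^esub> \<tau> \<gamma>) - m x + e \<gamma>"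
    using assms(1) unfolding triv_def by blast
  obtain m' e' where m': "hinv m'" "\<And>\<gamma> x. \<lbrakk>\<gamma> \<in> K; x \<in> carrier G\<rbrakk> \<Longrightarrow> b' \<gamma> x = m' (x \<otimes>\<^bsub>G\<^esub> \<tau> \<gamma>) - m' x + e' \<gamma>"
    using assms(2) unfolding triv_def by blast
  show ?thesis
  proof (rule trivI[of "\<lambda>x. m x - m' x" _ _ "\<lambda>x. e x - e' x"])
    show "hinv (\<lambda>x. m x - m' x)" using m(1) m'(1) by (simp add: hinv_def)
  qed (simp add: m(2) m'(2) algebra_simps)
qed

lemma triv_zero: "triv K (\<lambda>_ _. 0)"
  by (rule trivI[of "\<lambda>_. 0" _ _ "\<lambda>_. 0"]) (auto simp: hinv_def)

lemma triv_ntimes: "triv K b \<Longrightarrow> triv K (\<lambda>\<gamma> x. n \<cdot> b \<gamma> x)"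
  by (induction n) (auto intro: triv_add triv_zero)

lemma triv_cong: "(\<And>\<gamma> x. \<lbrakk>\<gamma> \<in> K; x \<in> carrier G\<rbrakk> \<Longrightarrow> b \<gamma> x = b' \<gamma> x) \<Longrightarrow> triv K b \<longleftrightarrow> triv K b'"
  unfolding triv_def by simp

text \<open>Bezout coefficients write \<open>b\<close> as a difference of multiples of the two given
  cocycles. In this way a bound at \<open>p\<close> and a bound away from \<open>p\<close> are
  combined.\<close>

lemma triv_coprime:
  fixes m n :: nat
  assumes "coprime m n" "0 < m" "triv K (\<lambda>\<gamma> x. m \<cdot> b \<gamma> x)" "triv K (\<lambda>\<gamma> x. n \<cdot> b \<gamma> x)"
  shows "triv K b"
proof -
  obtain u v where uv: "u * m = v * n + 1" using coprime_bezout_nat assms(1,2) by blast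
  have "triv K (\<lambda>\<gamma> x. u \<cdot> m \<cdot> b \<gamma> x - v \<cdot> n \<cdot> b \<gamma> x)"
    by (rule triv_diff[OF triv_ntimes[OF assms(3)] triv_ntimes[OF assms(4)]])
  moreover have "u \<cdot> m \<cdot> b \<gamma> x - v \<cdot> n \<cdot> b \<gamma> x = b \<gamma> x" for \<gamma> x
    by (simp add: uv ntimes_add_left flip: ntimes_mult)
  ultimately show ?thesis by simp
qed

lemma cocyc_coboundary:
  assumes "hinv m" "K \<subseteq> carrier Q"
  shows "cocyc K (\<lambda>\<gamma> x. m (x \<otimes>\<^bsub>G\<^esub> \<tau> \<gamma>) - m x + e \<gamma>)"
proof (rule cocycI)
  show "hinv (\<lambda>x. m (x \<otimes>\<^bsub>G\<^esub> \<tau> \<gamma>) - m x + e \<gamma>)" if "\<gamma> \<in> K" for \<gamma>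
    using hinv_translate[OF assms(1), of "\<tau> \<gamma>"] assms that by (auto simp: hinv_def)
qed (use assms in \<open>auto simp: hinv_tau_mult hinv_tau_mult_one subset_iff algebra_simps\<close>)

end

locale coset_cohomology = coset_cocycles G H Q \<tau>
  for G :: "('a, 'x) monoid_scheme" (structure) and H
    and Q :: "('c, 'y) monoid_scheme" (structure) and \<tau> +
  fixes act :: "'c \<Rightarrow> ('a \<Rightarrow> int) set \<Rightarrow> ('a \<Rightarrow> int) set"
  assumes act_eq: "\<lbrakk>\<gamma> \<in> carrier Q; m \<in> carrier (J G H)\<rbrakk> \<Longrightarrow> act \<gamma> m = J_act G (\<tau> \<gamma>) m"
begin

sublocale M: module_action Q "J G H" act
  by (rule module_action_J) (rule act_eq)

lemma act_proj: "\<lbrakk>\<gamma> \<in> carrier Q; hinv \<phi>\<rbrakk> \<Longrightarrow> act \<gamma> (proj \<phi>) = proj (\<lambda>x. \<phi> (x \<otimes>\<^bsub>G\<^esub> \<tau> \<gamma>))"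
  by (simp add: act_eq J_act_proj)

section \<open>Real lifts and the connecting map to integral 2-cocycles\<close>

definition dd :: "('c \<Rightarrow> 'a \<Rightarrow> real) \<Rightarrow> 'c \<Rightarrow> 'c \<Rightarrow> 'a \<Rightarrow> real" where
  "dd B \<gamma> \<delta> x = B \<delta> (x \<otimes>\<^bsub>G\<^esub> \<tau> \<gamma>) - B (\<gamma> \<otimes>\<^bsub>Q\<^esub> \<delta>) x + B \<gamma> x
     - (B \<delta> (\<tau> \<gamma>) - B (\<gamma> \<otimes>\<^bsub>Q\<^esub> \<delta>) \<one>\<^bsub>G\<^esub> + B \<gamma> \<one>\<^bsub>G\<^esub>)"

text \<open>Such a \<open>B\<close> is a real lift of a circle cocycle: for invariant
  \<open>B\<close>, integrality of the normalised differential is the cocycle condition modulo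
  \<int>.\<close>

definition integral :: "('c \<Rightarrow> 'a \<Rightarrow> real) \<Rightarrow> bool" where
  "integral B \<longleftrightarrow> (\<forall>\<gamma>\<in>carrier Q. hinv (B \<gamma>)) \<and>
     (\<forall>\<gamma>\<in>carrier Q. \<forall>\<delta>\<in>carrier Q. \<forall>x\<in>carrier G. dd B \<gamma> \<delta> x \<in> \<int>)"

text \<open>This is the connecting map evaluated on a real lift. For integral \<open>B\<close> the
  floor only changes the type of a number that is already an integer.\<close>

definition cc :: "('c \<Rightarrow> 'a \<Rightarrow> real) \<Rightarrow> 'c \<times> 'c \<Rightarrow> ('a \<Rightarrow> int) set" where
  "cc B = (\<lambda>(\<gamma>, \<delta>)\<in>carrier Q \<times> carrier Q. proj (\<lambda>x. \<lfloor>dd B \<gamma> \<delta> x\<rfloor>))"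

lemma integral_hinv: "\<lbrakk>integral B; \<gamma> \<in> carrier Q\<rbrakk> \<Longrightarrow> hinv (B \<gamma>)"
  by (simp add: integral_def)

lemma of_int_floor_dd:
  "\<lbrakk>integral B; \<gamma> \<in> carrier Q; \<delta> \<in> carrier Q; x \<in> carrier G\<rbrakk> \<Longrightarrow> real_of_int \<lfloor>dd B \<gamma> \<delta> x\<rfloor> = dd B \<gamma> \<delta> x"
  unfolding integral_def by (metis Ints_cases floor_of_int)

lemma dd_one [simp]: "\<lbrakk>\<gamma> \<in> carrier Q\<rbrakk> \<Longrightarrow> dd B \<gamma> \<delta> \<one>\<^bsub>G\<^esub> = 0"
  by (simp add: dd_def)

lemma hinv_dd:
  assumes "integral B" "\<gamma> \<in> carrier Q" "\<delta> \<in> carrier Q"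
  shows "hinv (\<lambda>x. \<lfloor>dd B \<gamma> \<delta> x\<rfloor>)"
proof -
  have "hinv (\<lambda>x. B \<delta> (x \<otimes>\<^bsub>G\<^esub> \<tau> \<gamma>))" "hinv (B (\<gamma> \<otimes>\<^bsub>Q\<^esub> \<delta>))" "hinv (B \<gamma>)"
    using hinv_translate[OF integral_hinv[OF assms(1,3)] tau_closed[OF assms(2)]]
      integral_hinv[OF assms(1)] assms(2,3) by auto
  then show ?thesis by (simp add: hinv_def dd_def)
qed

lemma proj_eq_real:
  assumes "\<And>x. x \<in> carrier G \<Longrightarrow> real_of_int (\<phi> x) = real_of_int (\<psi> x) + k"
  shows "proj \<phi> = proj \<psi>"
  unfolding proj_eq_iff
proof
  fix x assume "x \<in> carrier G"
  then have "real_of_int (\<phi> x - \<psi> x) = real_of_int (\<phi> \<one>\<^bsub>G\<^esub> - \<psi> \<one>\<^bsub>G\<^esub>)"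
    using assms[of x] assms[of "\<one>\<^bsub>G\<^esub>"] by simp
  then show "\<phi> x - \<psi> x = \<phi> \<one>\<^bsub>G\<^esub> - \<psi> \<one>\<^bsub>G\<^esub>" by linarith
qed

lemma proj_combination:
  assumes "hinv f1" "hinv f2" "hinv f3" "hinv f4"
  shows "proj f1 \<otimes>\<^bsub>J G H\<^esub> inv\<^bsub>J G H\<^esub> proj f2 \<otimes>\<^bsub>J G H\<^esub> proj f3 \<otimes>\<^bsub>J G H\<^esub> inv\<^bsub>J G H\<^esub> proj f4
     = proj (\<lambda>x. f1 x - f2 x + f3 x - f4 x)"
    and "proj f1 \<otimes>\<^bsub>J G H\<^esub> inv\<^bsub>J G H\<^esub> proj f2 \<otimes>\<^bsub>J G H\<^esub> proj f3 = proj (\<lambda>x. f1 x - f2 x + f3 x)"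
proof -
  have "hinv (\<lambda>x. - f2 x)" "hinv (\<lambda>x. - f4 x)" "hinv (\<lambda>x. f1 x - f2 x)" "hinv (\<lambda>x. f1 x - f2 x + f3 x)"
    using assms by (simp_all add: hinv_def)
  then show "proj f1 \<otimes>\<^bsub>J G H\<^esub> inv\<^bsub>J G H\<^esub> proj f2 \<otimes>\<^bsub>J G H\<^esub> proj f3 \<otimes>\<^bsub>J G H\<^esub> inv\<^bsub>J G H\<^esub> proj f4
     = proj (\<lambda>x. f1 x - f2 x + f3 x - f4 x)"
    "proj f1 \<otimes>\<^bsub>J G H\<^esub> inv\<^bsub>J G H\<^esub> proj f2 \<otimes>\<^bsub>J G H\<^esub> proj f3 = proj (\<lambda>x. f1 x - f2 x + f3 x)"
    using assms by (simp_all add: proj_inv proj_mult)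
qed

text \<open>Before normalisation the square of the differential is zero; subtracting the values at
  the identity leaves the constant on the right, which dies in \<open>J G H\<close>.\<close>

lemma dd_cocycle:
  assumes B: "integral B" and g: "g \<in> carrier Q" "h \<in> carrier Q" "k \<in> carrier Q" and x: "x \<in> carrier G"
  shows "dd B h k (x \<otimes>\<^bsub>G\<^esub> \<tau> g) - dd B (g \<otimes>\<^bsub>Q\<^esub> h) k x + dd B g (h \<otimes>\<^bsub>Q\<^esub> k) x - dd B g h x
    = dd B h k (\<tau> g)"
  using g x hinv_tau_mult[OF integral_hinv[OF B g(3)] g(1,2) x]
    hinv_tau_mult_one[OF integral_hinv[OF B g(3)] g(1,2)]
  by (simp add: dd_def Q.m_assoc)

lemma cc_cocycle:
  assumes B: "integral B"
  shows "cc B \<in> carrier (cocycles2 Q (J G H) act)"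
  unfolding M.cocycles2_iff
proof (intro conjI ballI)
  show "cc B \<in> carrier Q \<times> carrier Q \<rightarrow>\<^sub>E carrier (J G H)"
    using hinv_dd[OF B] by (auto simp: cc_def)
  fix g h k assume g: "g \<in> carrier Q" "h \<in> carrier Q" "k \<in> carrier Q"
  note [simp] = hinv_dd[OF B] act_proj hinv_translate of_int_floor_dd[OF B]
  have "act g (cc B (h, k)) \<otimes>\<^bsub>J G H\<^esub> inv\<^bsub>J G H\<^esub> cc B (g \<otimes>\<^bsub>Q\<^esub> h, k)
        \<otimes>\<^bsub>J G H\<^esub> cc B (g, h \<otimes>\<^bsub>Q\<^esub> k) \<otimes>\<^bsub>J G H\<^esub> inv\<^bsub>J G H\<^esub> cc B (g, h)
     = proj (\<lambda>x. \<lfloor>dd B h k (x \<otimes>\<^bsub>G\<^esub> \<tau> g)\<rfloor> - \<lfloor>dd B (g \<otimes>\<^bsub>Q\<^esub> h) k x\<rfloor> + \<lfloor>dd B g (h \<otimes>\<^bsub>Q\<^esub> k) x\<rfloor> - \<lfloor>dd B g h x\<rfloor>)"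
    using g by (simp add: cc_def proj_combination hinv_translate[OF hinv_dd[OF B]])
  also have "\<dots> = \<one>\<^bsub>J G H\<^esub>"
    unfolding proj_one
    by (rule proj_eq_real[where k = "dd B h k (\<tau> g)"]) (use g in \<open>simp add: dd_cocycle[OF B]\<close>)
  finally show "act g (cc B (h, k)) \<otimes>\<^bsub>J G H\<^esub> inv\<^bsub>J G H\<^esub> cc B (g \<otimes>\<^bsub>Q\<^esub> h, k)
        \<otimes>\<^bsub>J G H\<^esub> cc B (g, h \<otimes>\<^bsub>Q\<^esub> k) \<otimes>\<^bsub>J G H\<^esub> inv\<^bsub>J G H\<^esub> cc B (g, h) = \<one>\<^bsub>J G H\<^esub>" .
qed

lemma integral_add:
  assumes "integral B" "integral C"
  shows "integral (\<lambda>\<gamma> x. B \<gamma> x + C \<gamma> x)"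
    and "cc (\<lambda>\<gamma> x. B \<gamma> x + C \<gamma> x) = cc B \<otimes>\<^bsub>cocycles2 Q (J G H) act\<^esub> cc C"
proof -
  have dd: "dd (\<lambda>\<gamma> x. B \<gamma> x + C \<gamma> x) \<gamma> \<delta> x = dd B \<gamma> \<delta> x + dd C \<gamma> \<delta> x" for \<gamma> \<delta> x
    by (simp add: dd_def)
  show int: "integral (\<lambda>\<gamma> x. B \<gamma> x + C \<gamma> x)"
    using assms unfolding integral_def dd by (auto simp: hinv_def)
  have "proj (\<lambda>x. \<lfloor>dd (\<lambda>\<gamma> x. B \<gamma> x + C \<gamma> x) \<gamma> \<delta> x\<rfloor>) =
      proj (\<lambda>x. \<lfloor>dd B \<gamma> \<delta> x\<rfloor>) \<otimes>\<^bsub>J G H\<^esub> proj (\<lambda>x. \<lfloor>dd C \<gamma> \<delta> x\<rfloor>)" if "\<gamma> \<in> carrier Q" "\<delta> \<in> carrier Q" for \<gamma> \<delta>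
  proof -
    have "proj (\<lambda>x. \<lfloor>dd (\<lambda>\<gamma> x. B \<gamma> x + C \<gamma> x) \<gamma> \<delta> x\<rfloor>) = proj (\<lambda>x. \<lfloor>dd B \<gamma> \<delta> x\<rfloor> + \<lfloor>dd C \<gamma> \<delta> x\<rfloor>)"
    proof (rule proj_eq_real)
      fix x assume x: "x \<in> carrier G"
      show "real_of_int \<lfloor>dd (\<lambda>\<gamma> x. B \<gamma> x + C \<gamma> x) \<gamma> \<delta> x\<rfloor> = real_of_int (\<lfloor>dd B \<gamma> \<delta> x\<rfloor> + \<lfloor>dd C \<gamma> \<delta> x\<rfloor>) + 0"
        using of_int_floor_dd[OF int that x] of_int_floor_dd[OF assms(1) that x]
          of_int_floor_dd[OF assms(2) that x] unfolding dd by linarith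
    qed
    then show ?thesis
      by (simp add: proj_mult hinv_dd[OF assms(1) that] hinv_dd[OF assms(2) that])
  qed
  then show "cc (\<lambda>\<gamma> x. B \<gamma> x + C \<gamma> x) = cc B \<otimes>\<^bsub>cocycles2 Q (J G H) act\<^esub> cc C"
    by (auto simp: cc_def cocycles2_def cochains2_def fun_eq_iff restrict_def)
qed

lemma integral_diff:
  assumes "integral B" "integral C"
  shows "integral (\<lambda>\<gamma> x. B \<gamma> x - C \<gamma> x)"
proof -
  have dd: "dd (\<lambda>\<gamma> x. B \<gamma> x - C \<gamma> x) \<gamma> \<delta> x = dd B \<gamma> \<delta> x - dd C \<gamma> \<delta> x" for \<gamma> \<delta> x
    by (simp add: dd_def)
  show int: "integral (\<lambda>\<gamma> x. B \<gamma> x - C \<gamma> x)"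
    using assms unfolding integral_def dd by (auto simp: hinv_def)
qed

text \<open>Real lifts \<open>M\<close> and \<open>E\<close> of \<open>m\<close> and
  \<open>e\<close> make \<open>N\<close>, the difference of \<open>B\<close> and the lifted
  coboundary, integer valued. Up to constants \<open>N\<close> has the same differential as
  \<open>B\<close>, hence its projection bounds \<open>cc B\<close> on \<open>D\<close>.\<close>

lemma coboundary_if_triv:
  assumes B: "integral B" and D: "subgroup D Q" and t: "triv D (\<lambda>\<gamma> x. circ (B \<gamma> x))"
  shows "restrict (cc B) (D \<times> D) \<in> coboundaries2 (Q\<lparr>carrier := D\<rparr>) (J G H) act"
proof -
  have DQ: "\<gamma> \<in> carrier Q" if "\<gamma> \<in> D" for \<gamma> using that subgroup.subset[OF D] by blast
  obtain m e where m: "hinv m"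
    and me: "\<And>\<gamma> x. \<lbrakk>\<gamma> \<in> D; x \<in> carrier G\<rbrakk> \<Longrightarrow> circ (B \<gamma> x) = m (x \<otimes>\<^bsub>G\<^esub> \<tau> \<gamma>) - m x + e \<gamma>"
    using t unfolding triv_def by blast
  define M where "M = rep_circle \<circ> m"
  define E where "E = rep_circle \<circ> e"
  define N where "N \<gamma> x = B \<gamma> x - (M (x \<otimes>\<^bsub>G\<^esub> \<tau> \<gamma>) - M x + E \<gamma>)" for \<gamma> x
  have hM: "hinv M" using m by (simp add: hinv_def M_def)
  have hN: "hinv (N \<gamma>)" if "\<gamma> \<in> D" for \<gamma>
    using hM integral_hinv[OF B DQ[OF that]] hinv_translate[OF hM tau_closed[OF DQ[OF that]]]
    by (simp add: hinv_def N_def)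
  then have hNf: "hinv (\<lambda>x. \<lfloor>N \<gamma> x\<rfloor>)" if "\<gamma> \<in> D" for \<gamma> using that by (simp add: hinv_def)
  have "circ (N \<gamma> x) = 0" if "\<gamma> \<in> D" "x \<in> carrier G" for \<gamma> x
    using me[OF that] by (simp add: N_def M_def E_def circ_diff circ_add)
  then have fl: "real_of_int \<lfloor>N \<gamma> x\<rfloor> = N \<gamma> x" if "\<gamma> \<in> D" "x \<in> carrier G" for \<gamma> x
    using that by (metis circ_eq_0_iff Ints_cases floor_of_int)
  define \<beta> where "\<beta> = (\<lambda>\<gamma>\<in>D. proj (\<lambda>x. \<lfloor>N \<gamma> x\<rfloor>))"
  have "\<beta> \<in> carrier (cochains1 (Q\<lparr>carrier := D\<rparr>) (J G H))"
    using hNf by (auto simp: \<beta>_def cochains1_def)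
  moreover have "restrict (cc B) (D \<times> D) = diff1 (Q\<lparr>carrier := D\<rparr>) (J G H) act \<beta>"
  proof -
    have "cc B (\<gamma>, \<delta>) = act \<gamma> (\<beta> \<delta>) \<otimes>\<^bsub>J G H\<^esub> inv\<^bsub>J G H\<^esub> \<beta> (\<gamma> \<otimes>\<^bsub>Q\<^esub> \<delta>) \<otimes>\<^bsub>J G H\<^esub> \<beta> \<gamma>"
      if gd: "\<gamma> \<in> D" "\<delta> \<in> D" for \<gamma> \<delta>
    proof -
      have gd': "\<gamma> \<otimes>\<^bsub>Q\<^esub> \<delta> \<in> D" using subgroup.m_closed[OF D] gd by blast
      note q = DQ[OF gd(1)] DQ[OF gd(2)]
      have "act \<gamma> (\<beta> \<delta>) \<otimes>\<^bsub>J G H\<^esub> inv\<^bsub>J G H\<^esub> \<beta> (\<gamma> \<otimes>\<^bsub>Q\<^esub> \<delta>) \<otimes>\<^bsub>J G H\<^esub> \<beta> \<gamma>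
         = proj (\<lambda>x. \<lfloor>N \<delta> (x \<otimes>\<^bsub>G\<^esub> \<tau> \<gamma>)\<rfloor> - \<lfloor>N (\<gamma> \<otimes>\<^bsub>Q\<^esub> \<delta>) x\<rfloor> + \<lfloor>N \<gamma> x\<rfloor>)"
        using gd gd' hNf q hinv_translate[OF hNf[OF gd(2)] tau_closed[OF q(1)]]
        by (simp add: \<beta>_def act_proj proj_combination(2)[OF _ _ _ hNf[OF gd(1)]])
      also have "\<dots> = proj (\<lambda>x. \<lfloor>dd B \<gamma> \<delta> x\<rfloor>)"
      proof (rule proj_eq_real)
        fix x assume x: "x \<in> carrier G"
        have "M (x \<otimes>\<^bsub>G\<^esub> \<tau> (\<gamma> \<otimes>\<^bsub>Q\<^esub> \<delta>)) = M (x \<otimes>\<^bsub>G\<^esub> \<tau> \<gamma> \<otimes>\<^bsub>G\<^esub> \<tau> \<delta>)"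
          using hinv_tau_mult[OF hM q x] .
        then show "real_of_int (\<lfloor>N \<delta> (x \<otimes>\<^bsub>G\<^esub> \<tau> \<gamma>)\<rfloor> - \<lfloor>N (\<gamma> \<otimes>\<^bsub>Q\<^esub> \<delta>) x\<rfloor> + \<lfloor>N \<gamma> x\<rfloor>) =
            real_of_int \<lfloor>dd B \<gamma> \<delta> x\<rfloor> + (B \<delta> (\<tau> \<gamma>) - B (\<gamma> \<otimes>\<^bsub>Q\<^esub> \<delta>) \<one>\<^bsub>G\<^esub> + B \<gamma> \<one>\<^bsub>G\<^esub>
              - E \<delta> + E (\<gamma> \<otimes>\<^bsub>Q\<^esub> \<delta>) - E \<gamma>)"
          using x gd gd' q by (simp add: fl of_int_floor_dd[OF B]) (simp add: N_def dd_def)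
      qed
      finally show ?thesis using q by (simp add: cc_def)
    qed
    then show ?thesis by (auto simp: diff1_def fun_eq_iff restrict_def)
  qed
  ultimately show ?thesis unfolding coboundaries2_def by blast
qed

lemma bij_betw_translate:
  assumes D: "subgroup D Q" and g: "\<gamma> \<in> D"
  shows "bij_betw (\<lambda>\<delta>. \<gamma> \<otimes>\<^bsub>Q\<^esub> \<delta>) D D"
proof (rule bij_betw_byWitness[where f' = "\<lambda>\<delta>. inv\<^bsub>Q\<^esub> \<gamma> \<otimes>\<^bsub>Q\<^esub> \<delta>"])
  have DQ: "\<gamma> \<in> carrier Q" if "\<gamma> \<in> D" for \<gamma> using that subgroup.subset[OF D] by blast
  show "\<forall>a\<in>D. inv\<^bsub>Q\<^esub> \<gamma> \<otimes>\<^bsub>Q\<^esub> (\<gamma> \<otimes>\<^bsub>Q\<^esub> a) = a" "\<forall>a\<in>D. \<gamma> \<otimes>\<^bsub>Q\<^esub> (inv\<^bsub>Q\<^esub> \<gamma> \<otimes>\<^bsub>Q\<^esub> a) = a"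
    using DQ g by (simp_all flip: Q.m_assoc)
qed (use subgroup.m_closed[OF D] subgroup.m_inv_closed[OF D] g in auto)

text \<open>Removing the integer cochain that bounds \<open>cc B\<close> leaves a crossed
  homomorphism \<open>R\<close> into real functions modulo constants. Averaging over
  \<open>D\<close> makes \<open>R\<close> a coboundary, and in the circle \<open>B\<close> agrees
  with it up to constants.\<close>

lemma triv_if_coboundary:
  assumes B: "integral B" and D: "subgroup D Q"
    and c: "restrict (cc B) (D \<times> D) \<in> coboundaries2 (Q\<lparr>carrier := D\<rparr>) (J G H) act"
  shows "triv D (\<lambda>\<gamma> x. circ (B \<gamma> x))"
proof -
  have DQ: "\<gamma> \<in> carrier Q" if "\<gamma> \<in> D" for \<gamma> using that subgroup.subset[OF D] by blast
  have finD: "finite D" using finite_Q subgroup.subset[OF D] finite_subset by blast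
  have "D \<noteq> {}" using subgroup.one_closed[OF D] by blast
  then have cD: "real (card D) > 0" using finD by (simp add: card_gt_0_iff)
  obtain \<beta> where b: "\<beta> \<in> D \<rightarrow>\<^sub>E carrier (J G H)"
    and eq: "restrict (cc B) (D \<times> D) = diff1 (Q\<lparr>carrier := D\<rparr>) (J G H) act \<beta>"
    using c by (auto simp: coboundaries2_def cochains1_def)
  have "\<exists>\<phi>. hinv \<phi> \<and> \<beta> \<gamma> = proj \<phi> \<and> \<phi> \<one>\<^bsub>G\<^esub> = 0" if "\<gamma> \<in> D" for \<gamma>
    using b that J_cases by (metis PiE_mem)
  then obtain \<phi> where \<phi>: "\<And>\<gamma>. \<gamma> \<in> D \<Longrightarrow> hinv (\<phi> \<gamma>)" "\<And>\<gamma>. \<gamma> \<in> D \<Longrightarrow> \<beta> \<gamma> = proj (\<phi> \<gamma>)"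
    "\<And>\<gamma>. \<gamma> \<in> D \<Longrightarrow> \<phi> \<gamma> \<one>\<^bsub>G\<^esub> = 0" by metis
  \<comment> \<open>Subtracting \<open>B \<gamma> \<one>\<close> normalises
    \<open>R \<gamma>\<close> to vanish at the identity, as \<open>\<phi> \<gamma>\<close>
    does.\<close>
  define R where "R \<gamma> x = B \<gamma> x - B \<gamma> \<one>\<^bsub>G\<^esub> - real_of_int (\<phi> \<gamma> x)" for \<gamma> x
  have R: "R \<delta> (x \<otimes>\<^bsub>G\<^esub> \<tau> \<gamma>) - R (\<gamma> \<otimes>\<^bsub>Q\<^esub> \<delta>) x + R \<gamma> x = R \<delta> (\<tau> \<gamma>)"
    if gd: "\<gamma> \<in> D" "\<delta> \<in> D" and x: "x \<in> carrier G" for \<gamma> \<delta> x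
  proof -
    have gd': "\<gamma> \<otimes>\<^bsub>Q\<^esub> \<delta> \<in> D" using subgroup.m_closed[OF D] gd by blast
    note q = DQ[OF gd(1)] DQ[OF gd(2)]
    have "proj (\<lambda>x. \<lfloor>dd B \<gamma> \<delta> x\<rfloor>) = diff1 (Q\<lparr>carrier := D\<rparr>) (J G H) act \<beta> (\<gamma>, \<delta>)"
      using gd q by (simp flip: eq add: cc_def)
    also have "\<dots> = proj (\<lambda>x. \<phi> \<delta> (x \<otimes>\<^bsub>G\<^esub> \<tau> \<gamma>) - \<phi> (\<gamma> \<otimes>\<^bsub>Q\<^esub> \<delta>) x + \<phi> \<gamma> x)"
      using gd gd' q \<phi> hinv_translate[OF \<phi>(1)[OF gd(2)] tau_closed[OF q(1)]]
      by (simp add: diff1_def act_proj proj_combination(2)[OF _ _ _ \<phi>(1)[OF gd(1)]])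
    finally have "\<lfloor>dd B \<gamma> \<delta> x\<rfloor> - (\<phi> \<delta> (x \<otimes>\<^bsub>G\<^esub> \<tau> \<gamma>) - \<phi> (\<gamma> \<otimes>\<^bsub>Q\<^esub> \<delta>) x + \<phi> \<gamma> x) = - \<phi> \<delta> (\<tau> \<gamma>)"
      unfolding proj_eq_iff using x q gd gd' \<phi>(3) by simp
    then have "real_of_int \<lfloor>dd B \<gamma> \<delta> x\<rfloor> - (\<phi> \<delta> (x \<otimes>\<^bsub>G\<^esub> \<tau> \<gamma>) - \<phi> (\<gamma> \<otimes>\<^bsub>Q\<^esub> \<delta>) x + \<phi> \<gamma> x) = - \<phi> \<delta> (\<tau> \<gamma>)"
      by linarith
    then have "dd B \<gamma> \<delta> x - (\<phi> \<delta> (x \<otimes>\<^bsub>G\<^esub> \<tau> \<gamma>) - \<phi> (\<gamma> \<otimes>\<^bsub>Q\<^esub> \<delta>) x + \<phi> \<gamma> x) = - \<phi> \<delta> (\<tau> \<gamma>)"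
      using of_int_floor_dd[OF B q x] by simp
    then show ?thesis by (simp add: R_def dd_def)
  qed
  define T where "T x = (\<Sum>\<delta>\<in>D. R \<delta> x)" for x
  have hT: "hinv T"
    using \<phi>(1) integral_hinv[OF B DQ] H_carrier unfolding hinv_def T_def R_def
    by (intro ballI sum.cong) auto
  have T: "real (card D) * R \<gamma> x = T x - T (x \<otimes>\<^bsub>G\<^esub> \<tau> \<gamma>) + T (\<tau> \<gamma>)" if "\<gamma> \<in> D" "x \<in> carrier G" for \<gamma> x
  proof -
    have "(\<Sum>\<delta>\<in>D. R (\<gamma> \<otimes>\<^bsub>Q\<^esub> \<delta>) x) = T x"
      unfolding T_def by (rule sum.reindex_bij_betw[OF bij_betw_translate[OF D that(1)]])
    moreover have "(\<Sum>\<delta>\<in>D. R \<delta> (x \<otimes>\<^bsub>G\<^esub> \<tau> \<gamma>) - R (\<gamma> \<otimes>\<^bsub>Q\<^esub> \<delta>) x + R \<gamma> x) = T (\<tau> \<gamma>)"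
      unfolding T_def by (rule sum.cong) (use that R in auto)
    ultimately show ?thesis by (simp add: sum.distrib sum_subtractf T_def)
  qed
  show ?thesis
  proof (rule trivI[of "\<lambda>x. circ (- T x / real (card D))" _ _
        "\<lambda>\<gamma>. circ (T (\<tau> \<gamma>) / real (card D) + B \<gamma> \<one>\<^bsub>G\<^esub>)"])
    show "hinv (\<lambda>x. circ (- T x / real (card D)))" using hT by (simp add: hinv_def)
    fix \<gamma> x assume gx: "\<gamma> \<in> D" "x \<in> carrier G"
    have "R \<gamma> x = (T x - T (x \<otimes>\<^bsub>G\<^esub> \<tau> \<gamma>) + T (\<tau> \<gamma>)) / real (card D)"
      using T[OF gx] cD by (simp add: field_simps)
    then have "B \<gamma> x - (- T (x \<otimes>\<^bsub>G\<^esub> \<tau> \<gamma>) / real (card D) - - T x / real (card D)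
        + (T (\<tau> \<gamma>) / real (card D) + B \<gamma> \<one>\<^bsub>G\<^esub>)) = real_of_int (\<phi> \<gamma> x)"
      by (simp add: R_def diff_divide_distrib add_divide_distrib)
    then show "circ (B \<gamma> x) = circ (- T (x \<otimes>\<^bsub>G\<^esub> \<tau> \<gamma>) / real (card D)) - circ (- T x / real (card D))
        + circ (T (\<tau> \<gamma>) / real (card D) + B \<gamma> \<one>\<^bsub>G\<^esub>)"
      unfolding circ_diff[symmetric] circ_add[symmetric] circ_eq_iff by simp
  qed
qed

text \<open>Real coefficients have no second cohomology over a finite group: the average of a
  normalised cocycle over its last argument is a cochain having that cocycle as
  differential.\<close>

lemma cc_surj:
  assumes c: "c \<in> carrier (cocycles2 Q (J G H) act)"
  obtains B where "integral B" "c = cc B"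
proof -
  have cM: "c (\<gamma>, \<delta>) \<in> carrier (J G H)" if "\<gamma> \<in> carrier Q" "\<delta> \<in> carrier Q" for \<gamma> \<delta>
    using c that by (auto simp: M.cocycles2_iff)
  have "\<exists>\<phi>. hinv \<phi> \<and> c (\<gamma>, \<delta>) = proj \<phi> \<and> \<phi> \<one>\<^bsub>G\<^esub> = 0" if "\<gamma> \<in> carrier Q" "\<delta> \<in> carrier Q" for \<gamma> \<delta>
    using J_cases[OF cM[OF that]] by metis
  then obtain \<phi> where \<phi>: "\<And>\<gamma> \<delta>. \<lbrakk>\<gamma> \<in> carrier Q; \<delta> \<in> carrier Q\<rbrakk> \<Longrightarrow> hinv (\<phi> \<gamma> \<delta>)"
    "\<And>\<gamma> \<delta>. \<lbrakk>\<gamma> \<in> carrier Q; \<delta> \<in> carrier Q\<rbrakk> \<Longrightarrow> c (\<gamma>, \<delta>) = proj (\<phi> \<gamma> \<delta>)"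
    "\<And>\<gamma> \<delta>. \<lbrakk>\<gamma> \<in> carrier Q; \<delta> \<in> carrier Q\<rbrakk> \<Longrightarrow> \<phi> \<gamma> \<delta> \<one>\<^bsub>G\<^esub> = 0" by metis
  define N where "N = real (card (carrier Q))"
  have "carrier Q \<noteq> {}" by blast
  then have N: "N > 0" using finite_Q by (simp add: N_def card_gt_0_iff)
  \<comment> \<open>The usual contraction: summing the cocycle identity over \<open>\<kappa>\<close>
    and substituting in the third term recovers \<open>\<phi> \<gamma> \<delta>\<close> as the
    differential of this average.\<close>
  define B where "B \<gamma> x = (\<Sum>\<kappa>\<in>carrier Q. real_of_int (\<phi> \<gamma> \<kappa> x)) / N" for \<gamma> x
  have hB: "hinv (B \<gamma>)" if "\<gamma> \<in> carrier Q" for \<gamma>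
    unfolding hinv_def B_def using \<phi>(1)[OF that]
    by (intro ballI arg_cong[where f = "\<lambda>z. z / N"] sum.cong) (auto simp: hinv_def)
  have ph: "\<phi> \<delta> \<kappa> (x \<otimes>\<^bsub>G\<^esub> \<tau> \<gamma>) - \<phi> (\<gamma> \<otimes>\<^bsub>Q\<^esub> \<delta>) \<kappa> x + \<phi> \<gamma> (\<delta> \<otimes>\<^bsub>Q\<^esub> \<kappa>) x - \<phi> \<gamma> \<delta> x = \<phi> \<delta> \<kappa> (\<tau> \<gamma>)"
    if g: "\<gamma> \<in> carrier Q" "\<delta> \<in> carrier Q" "\<kappa> \<in> carrier Q" and x: "x \<in> carrier G" for \<gamma> \<delta> \<kappa> x
  proof -
    have "proj (\<lambda>x. \<phi> \<delta> \<kappa> (x \<otimes>\<^bsub>G\<^esub> \<tau> \<gamma>) - \<phi> (\<gamma> \<otimes>\<^bsub>Q\<^esub> \<delta>) \<kappa> x + \<phi> \<gamma> (\<delta> \<otimes>\<^bsub>Q\<^esub> \<kappa>) x - \<phi> \<gamma> \<delta> x)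
      = act \<gamma> (c (\<delta>, \<kappa>)) \<otimes>\<^bsub>J G H\<^esub> inv\<^bsub>J G H\<^esub> c (\<gamma> \<otimes>\<^bsub>Q\<^esub> \<delta>, \<kappa>)
          \<otimes>\<^bsub>J G H\<^esub> c (\<gamma>, \<delta> \<otimes>\<^bsub>Q\<^esub> \<kappa>) \<otimes>\<^bsub>J G H\<^esub> inv\<^bsub>J G H\<^esub> c (\<gamma>, \<delta>)"
      using g \<phi>(1) hinv_translate[OF \<phi>(1)[OF g(2,3)] tau_closed[OF g(1)]]
      by (simp add: \<phi>(2) act_proj proj_combination(1))
    also have "\<dots> = \<one>\<^bsub>J G H\<^esub>" using c g by (simp add: M.cocycles2_iff)
    finally show ?thesis unfolding proj_eq_one_iff using x g \<phi>(3) by simp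
  qed
  have dd: "dd B \<gamma> \<delta> x = real_of_int (\<phi> \<gamma> \<delta> x)"
    if g: "\<gamma> \<in> carrier Q" "\<delta> \<in> carrier Q" and x: "x \<in> carrier G" for \<gamma> \<delta> x
  proof -
    have "(\<Sum>\<kappa>\<in>carrier Q. real_of_int (\<phi> \<gamma> (\<delta> \<otimes>\<^bsub>Q\<^esub> \<kappa>) x)) = (\<Sum>\<kappa>\<in>carrier Q. real_of_int (\<phi> \<gamma> \<kappa> x))"
      by (rule sum.reindex_bij_betw[OF bij_betw_translate[OF Q.subgroup_self g(2)]])
    then have s: "(\<Sum>\<kappa>\<in>carrier Q. real_of_int (\<phi> \<gamma> (\<delta> \<otimes>\<^bsub>Q\<^esub> \<kappa>) x)) = N * B \<gamma> x"
      using N by (simp add: B_def)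
    have "(\<Sum>\<kappa>\<in>carrier Q. real_of_int (\<phi> \<delta> \<kappa> (x \<otimes>\<^bsub>G\<^esub> \<tau> \<gamma>)) - real_of_int (\<phi> (\<gamma> \<otimes>\<^bsub>Q\<^esub> \<delta>) \<kappa> x)
        + real_of_int (\<phi> \<gamma> (\<delta> \<otimes>\<^bsub>Q\<^esub> \<kappa>) x) - real_of_int (\<phi> \<gamma> \<delta> x)) = (\<Sum>\<kappa>\<in>carrier Q. real_of_int (\<phi> \<delta> \<kappa> (\<tau> \<gamma>)))"
      by (rule sum.cong) (use ph[OF g _ x] in \<open>auto simp flip: of_int_diff of_int_add\<close>)
    then have "N * B \<delta> (x \<otimes>\<^bsub>G\<^esub> \<tau> \<gamma>) - N * B (\<gamma> \<otimes>\<^bsub>Q\<^esub> \<delta>) x + N * B \<gamma> x - N * real_of_int (\<phi> \<gamma> \<delta> x)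
        = N * B \<delta> (\<tau> \<gamma>)"
      using N unfolding sum.distrib sum_subtractf s by (simp add: B_def flip: N_def)
    then have "N * (B \<delta> (x \<otimes>\<^bsub>G\<^esub> \<tau> \<gamma>) - B (\<gamma> \<otimes>\<^bsub>Q\<^esub> \<delta>) x + B \<gamma> x - B \<delta> (\<tau> \<gamma>)) = N * real_of_int (\<phi> \<gamma> \<delta> x)"
      by (simp add: algebra_simps)
    then have "B \<delta> (x \<otimes>\<^bsub>G\<^esub> \<tau> \<gamma>) - B (\<gamma> \<otimes>\<^bsub>Q\<^esub> \<delta>) x + B \<gamma> x - B \<delta> (\<tau> \<gamma>) = real_of_int (\<phi> \<gamma> \<delta> x)"
      using N by simp
    moreover have "B \<gamma> \<one>\<^bsub>G\<^esub> = 0" "B (\<gamma> \<otimes>\<^bsub>Q\<^esub> \<delta>) \<one>\<^bsub>G\<^esub> = 0"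
      using g by (simp_all add: B_def \<phi>(3))
    ultimately show ?thesis by (simp add: dd_def)
  qed
  show ?thesis
  proof
    show "integral B" unfolding integral_def using hB dd by simp
    have "c (\<gamma>, \<delta>) = cc B (\<gamma>, \<delta>)" if "\<gamma> \<in> carrier Q" "\<delta> \<in> carrier Q" for \<gamma> \<delta>
      using that \<phi>(3)[OF that] by (auto simp: cc_def \<phi>(2) proj_eq_iff dd)
    then show "c = cc B"
      using c by (intro extensionalityI[of _ "carrier Q \<times> carrier Q"]) (auto simp: M.cocycles2_iff PiE_iff cc_def)
  qed
qed

section \<open>Circle classes as second cohomology classes\<close>

definition \<Phi> :: "('c \<Rightarrow> 'a \<Rightarrow> circle) \<Rightarrow> ('c \<times> 'c \<Rightarrow> ('a \<Rightarrow> int) set) set" where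
  "\<Phi> b = M.cls (cc (\<lambda>\<gamma> x. rep_circle (b \<gamma> x)))"

lemma integral_circ_iff:
  assumes "\<And>\<gamma>. \<gamma> \<in> carrier Q \<Longrightarrow> hinv (B \<gamma>)"
  shows "integral B \<longleftrightarrow> cocyc (carrier Q) (\<lambda>\<gamma> x. circ (B \<gamma> x))"
proof -
  have "dd B \<gamma> \<delta> x \<in> \<int> \<longleftrightarrow> circ (B \<gamma> x) + circ (B \<delta> (x \<otimes>\<^bsub>G\<^esub> \<tau> \<gamma>)) - circ (B (\<gamma> \<otimes>\<^bsub>Q\<^esub> \<delta>) x) =
       circ (B \<gamma> \<one>\<^bsub>G\<^esub>) + circ (B \<delta> (\<tau> \<gamma>)) - circ (B (\<gamma> \<otimes>\<^bsub>Q\<^esub> \<delta>) \<one>\<^bsub>G\<^esub>)" for \<gamma> \<delta> x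
    unfolding circ_diff[symmetric] circ_add[symmetric] circ_eq_iff
    by (rule arg_cong[where f = "\<lambda>z. z \<in> \<int>"]) (simp add: dd_def)
  then show ?thesis
    using assms by (auto simp: integral_def cocyc_def hinv_def)
qed

text \<open>The lift \<open>rep_circle\<close> is applied value by value, so a function on cosets
  lifts to a function on cosets.\<close>

lemma integral_rep:
  assumes "cocyc (carrier Q) b"
  shows "integral (\<lambda>\<gamma> x. rep_circle (b \<gamma> x))"
  using assms by (subst integral_circ_iff) (auto simp: cocyc_def hinv_def)

lemma cls_cc_one_iff:
  assumes "integral B"
  shows "M.cls (cc B) = \<one>\<^bsub>H2 Q (J G H) act\<^esub> \<longleftrightarrow> triv (carrier Q) (\<lambda>\<gamma> x. circ (B \<gamma> x))"
proof -
  have "restrict (cc B) (carrier Q \<times> carrier Q) = cc B" by (auto simp: cc_def fun_eq_iff)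
  then show ?thesis
    using coboundary_if_triv[OF assms Q.subgroup_self] triv_if_coboundary[OF assms Q.subgroup_self]
    by (auto simp: M.cls_eq_one_iff[OF cc_cocycle[OF assms]])
qed

text \<open>The class does not depend on the real lift: the difference of two lifts reduces to zero
  in the circle, which is trivial, so its class is the identity.\<close>

lemma cls_cc_cong:
  assumes B: "integral B" and C: "integral C"
    and eq: "\<And>\<gamma> x. \<lbrakk>\<gamma> \<in> carrier Q; x \<in> carrier G\<rbrakk> \<Longrightarrow> circ (B \<gamma> x) = circ (C \<gamma> x)"
  shows "M.cls (cc B) = M.cls (cc C)"
proof -
  interpret H2: comm_group "H2 Q (J G H) act" by (rule M.comm_group_H2)
  have D: "integral (\<lambda>\<gamma> x. B \<gamma> x - C \<gamma> x)" by (rule integral_diff[OF B C])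
  have "triv (carrier Q) (\<lambda>\<gamma> x. circ (B \<gamma> x - C \<gamma> x))"
    using triv_zero eq by (subst triv_cong[where b' = "\<lambda>_ _. 0"]) (auto simp: circ_diff)
  then have one: "M.cls (cc (\<lambda>\<gamma> x. B \<gamma> x - C \<gamma> x)) = \<one>\<^bsub>H2 Q (J G H) act\<^esub>"
    using cls_cc_one_iff[OF D] by simp
  have "cc B = cc (\<lambda>\<gamma> x. (B \<gamma> x - C \<gamma> x) + C \<gamma> x)" by simp
  also have "\<dots> = cc (\<lambda>\<gamma> x. B \<gamma> x - C \<gamma> x) \<otimes>\<^bsub>cocycles2 Q (J G H) act\<^esub> cc C"
    by (rule integral_add(2)[OF D C])
  finally show ?thesis
    using one M.cls_mult[OF cc_cocycle[OF D] cc_cocycle[OF C]] cc_cocycle[OF C]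
    by (simp add: M.carrier_H2)
qed

lemma Phi_closed: "cocyc (carrier Q) b \<Longrightarrow> \<Phi> b \<in> carrier (H2 Q (J G H) act)"
  using cc_cocycle[OF integral_rep] by (auto simp: \<Phi>_def M.carrier_H2)

lemma Phi_add:
  assumes "cocyc (carrier Q) b" "cocyc (carrier Q) b'"
  shows "\<Phi> (\<lambda>\<gamma> x. b \<gamma> x + b' \<gamma> x) = \<Phi> b \<otimes>\<^bsub>H2 Q (J G H) act\<^esub> \<Phi> b'"
proof -
  note i = integral_rep[OF assms(1)] integral_rep[OF assms(2)]
  have "\<Phi> (\<lambda>\<gamma> x. b \<gamma> x + b' \<gamma> x) = M.cls (cc (\<lambda>\<gamma> x. rep_circle (b \<gamma> x) + rep_circle (b' \<gamma> x)))"
    unfolding \<Phi>_def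
    by (rule cls_cc_cong[OF integral_rep[OF cocyc_add[OF assms]] integral_add(1)[OF i]])
      (simp add: circ_add)
  also have "\<dots> = \<Phi> b \<otimes>\<^bsub>H2 Q (J G H) act\<^esub> \<Phi> b'"
    unfolding \<Phi>_def integral_add(2)[OF i] by (rule M.cls_mult[OF i[THEN cc_cocycle]])
  finally show ?thesis .
qed

lemma Phi_one_iff: "cocyc (carrier Q) b \<Longrightarrow> \<Phi> b = \<one>\<^bsub>H2 Q (J G H) act\<^esub> \<longleftrightarrow> triv (carrier Q) b"
  using cls_cc_one_iff[OF integral_rep] by (simp add: \<Phi>_def)

lemma Phi_surj:
  assumes "y \<in> carrier (H2 Q (J G H) act)"
  obtains b where "cocyc (carrier Q) b" "y = \<Phi> b"
proof -
  obtain c where c: "c \<in> carrier (cocycles2 Q (J G H) act)" "y = M.cls c"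
    using assms by (auto simp: M.carrier_H2)
  obtain B where B: "integral B" "c = cc B" using cc_surj[OF c(1)] .
  have co: "cocyc (carrier Q) (\<lambda>\<gamma> x. circ (B \<gamma> x))"
    using B(1) integral_circ_iff integral_hinv by blast
  have "y = \<Phi> (\<lambda>\<gamma> x. circ (B \<gamma> x))"
    unfolding c(2) B(2) \<Phi>_def by (rule cls_cc_cong[OF B(1) integral_rep[OF co]]) simp
  then show ?thesis using that co by blast
qed

lemma Phi_Sha2_iff:
  assumes "finite \<D>" "\<And>D. D \<in> \<D> \<Longrightarrow> subgroup D Q" "cocyc (carrier Q) b"
  shows "\<Phi> b \<in> carrier (Sha2 Q \<D> (J G H) act) \<longleftrightarrow> (\<forall>D\<in>\<D>. triv D b)"
proof -
  note i = integral_rep[OF assms(3)]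
  show ?thesis
    using coboundary_if_triv[OF i assms(2)] triv_if_coboundary[OF i assms(2)]
    by (auto simp: \<Phi>_def M.cls_in_Sha2_iff[OF assms(1,2) cc_cocycle[OF i]])
qed

lemma Phi_pow:
  assumes "cocyc (carrier Q) b"
  shows "\<Phi> (\<lambda>\<gamma> x. n \<cdot> b \<gamma> x) = \<Phi> b [^]\<^bsub>H2 Q (J G H) act\<^esub> n"
proof (induction n)
  case 0
  then show ?case using Phi_one_iff[OF cocyc_zero] triv_zero by simp
next
  case (Suc n)
  interpret H2: comm_group "H2 Q (J G H) act" by (rule M.comm_group_H2)
  show ?case
    using Suc Phi_add[OF assms cocyc_ntimes[OF assms]] Phi_closed[OF assms]
    by (simp add: H2.m_comm)
qed

end

section \<open>Corestriction\<close>

context group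
begin

definition transv :: "'a set \<Rightarrow> 'a set \<Rightarrow> 'a set" where
  "transv D K = (\<lambda>C. SOME x. x \<in> C) ` ((\<lambda>k. D #> k) ` K)"

context
  fixes D K
  assumes D: "subgroup D G" and K: "subgroup K G" and DK: "D \<subseteq> K"
begin

lemma carrier_sub: "k \<in> K \<Longrightarrow> k \<in> carrier G"
  using subgroup.subset[OF K] by blast

lemma rep_coset:
  assumes "k \<in> K"
  obtains d where "d \<in> D" "(SOME x. x \<in> D #> k) = d \<otimes> k"
proof -
  have "(SOME x. x \<in> D #> k) \<in> D #> k"
    using rcos_self[OF carrier_sub[OF assms] D] by (rule someI)
  then show ?thesis using that by (auto simp: r_coset_def)
qed

lemma coset_of_rep:
  assumes "k \<in> K"
  shows "D #> (SOME x. x \<in> D #> k) = D #> k"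
proof -
  have "(SOME x. x \<in> D #> k) \<in> D #> k"
    using rcos_self[OF carrier_sub[OF assms] D] by (rule someI)
  from repr_independence[OF this carrier_sub[OF assms] D] show ?thesis by simp
qed

lemma inj_rep: "inj_on (\<lambda>C. SOME x. x \<in> C) ((\<lambda>k. D #> k) ` K)"
  by (rule inj_on_inverseI[where g = "\<lambda>x. D #> x"]) (use coset_of_rep in auto)

lemma transv_subset: "transv D K \<subseteq> K"
proof -
  have "(SOME x. x \<in> D #> k) \<in> K" if "k \<in> K" for k
    using rep_coset[OF that] subgroup.m_closed[OF K _ that] DK by (metis subsetD)
  then show ?thesis by (auto simp: transv_def)
qed

lemma card_transv:
  assumes "finite K"
  shows "card (transv D K) * card D = card K"
proof -
  interpret K: group "G\<lparr>carrier := K\<rparr>" by (rule subgroup_imp_group[OF K])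
  have "subgroup D (G\<lparr>carrier := K\<rparr>)" using subgroup_incl[OF D K DK] .
  from K.lagrange[OF this] have "card ((\<lambda>k. D #> k) ` K) * card D = card K"
    by (simp add: order_def RCOSETS_def UNION_singleton_eq_range)
  then show ?thesis by (simp add: transv_def card_image[OF inj_rep])
qed

text \<open>Right multiplication by \<open>g\<close> permutes the cosets of \<open>D\<close> in
  \<open>K\<close>. As \<open>f\<close> is constant on them, replacing \<open>r \<otimes> g\<close>
  by the chosen representative of its coset changes nothing.\<close>

lemma sum_transv:
  assumes f: "\<And>d k. \<lbrakk>d \<in> D; k \<in> K\<rbrakk> \<Longrightarrow> f (d \<otimes> k) = f k" and g: "g \<in> K"
  shows "(\<Sum>r\<in>transv D K. f (r \<otimes> g)) = (\<Sum>r\<in>transv D K. f r)"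
proof -
  let ?R = "(\<lambda>k. D #> k) ` K" and ?s = "\<lambda>C. SOME x. x \<in> C"
  have tr: "D #> k #> h = D #> (k \<otimes> h)" if "k \<in> K" "h \<in> K" for k h
    using coset_mult_assoc[OF subgroup.subset[OF D]] that carrier_sub by simp
  have fs: "f (?s (D #> k)) = f k" if "k \<in> K" for k
    using rep_coset[OF that] f that by metis
  have fsg: "f (?s (D #> k) \<otimes> g) = f (k \<otimes> g)" if k: "k \<in> K" for k
  proof -
    obtain d where d: "d \<in> D" "?s (D #> k) = d \<otimes> k" using rep_coset[OF k] by blast
    then have "?s (D #> k) \<otimes> g = d \<otimes> (k \<otimes> g)"
      using DK carrier_sub k g by (metis m_assoc subsetD)
    then show ?thesis using f d subgroup.m_closed[OF K k g] by simp
  qed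
  have bij: "bij_betw (\<lambda>C. C #> g) ?R ?R"
  proof (rule bij_betw_byWitness[where f' = "\<lambda>C. C #> inv g"])
    have ig: "inv g \<in> K" using subgroup.m_inv_closed[OF K g] .
    show "\<forall>C\<in>?R. C #> g #> inv g = C" "\<forall>C\<in>?R. C #> inv g #> g = C"
      using g ig carrier_sub subgroup.m_closed[OF K] by (auto simp: tr m_assoc)
    show "(\<lambda>C. C #> g) ` ?R \<subseteq> ?R" "(\<lambda>C. C #> inv g) ` ?R \<subseteq> ?R"
      using g ig subgroup.m_closed[OF K] by (auto simp: tr)
  qed
  have "(\<Sum>r\<in>transv D K. f (r \<otimes> g)) = (\<Sum>C\<in>?R. f (?s C \<otimes> g))"
    unfolding transv_def by (simp add: sum.reindex[OF inj_rep])
  also have "\<dots> = (\<Sum>C\<in>?R. f (?s (C #> g)))"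
    by (rule sum.cong) (use g subgroup.m_closed[OF K] in \<open>auto simp: tr fs fsg\<close>)
  also have "\<dots> = (\<Sum>C\<in>?R. f (?s C))"
    by (rule sum.reindex_bij_betw[OF bij])
  also have "\<dots> = (\<Sum>r\<in>transv D K. f r)"
    unfolding transv_def by (simp add: sum.reindex[OF inj_rep])
  finally show ?thesis .
qed

text \<open>Since \<open>f\<close> vanishes on \<open>D\<close>, the value \<open>f (inv r)\<close>
  depends only on the coset of \<open>r\<close>. Hence summing
  \<open>f (g \<otimes> inv r) = f g + act g (f (inv r))\<close> over representatives reproduces
  \<open>w\<close> on the left and yields the index times \<open>f g\<close> on the right.\<close>

lemma crossed_hom_average:
  fixes f :: "'a \<Rightarrow> 'w::ab_group_add"
  assumes add: "\<And>g u v. g \<in> K \<Longrightarrow> act g (u + v) = act g u + act g v"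
    and f: "\<And>g h. \<lbrakk>g \<in> K; h \<in> K\<rbrakk> \<Longrightarrow> f (g \<otimes> h) = f g + act g (f h)"
    and zero: "\<And>d. d \<in> D \<Longrightarrow> f d = 0" and g: "g \<in> K"
  defines "w \<equiv> (\<Sum>r\<in>transv D K. f (inv r))"
  shows "card (transv D K) \<cdot> f g = w - act g w"
proof -
  have act0: "act g 0 = 0" if "g \<in> K" for g
    using add[OF that, of 0 0] by simp
  have act_sum: "act g (\<Sum>r\<in>R. u r) = (\<Sum>r\<in>R. act g (u r))" for R and u :: "'a \<Rightarrow> 'w"
    by (induction R rule: infinite_finite_induct) (auto simp: act0[OF g] add[OF g])
  note Kinv = subgroup.m_inv_closed[OF K]
  have "(\<Sum>r\<in>transv D K. f (inv (r \<otimes> inv g))) = w"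
    unfolding w_def
  proof (rule sum_transv[where f = "\<lambda>k. f (inv k)"])
    fix d k assume dk: "d \<in> D" "k \<in> K"
    then have "f (inv (d \<otimes> k)) = f (inv k) + act (inv k) (f (inv d))"
      using f DK Kinv carrier_sub by (simp add: inv_mult_group subset_iff)
    then show "f (inv (d \<otimes> k)) = f (inv k)"
      using dk zero[OF subgroup.m_inv_closed[OF D dk(1)]] act0[OF Kinv] by simp
  qed (rule Kinv[OF g])
  moreover have "f (inv (r \<otimes> inv g)) = f g + act g (f (inv r))" if "r \<in> transv D K" for r
    using f[OF g Kinv] that transv_subset carrier_sub g by (auto simp: inv_mult_group subset_iff)
  ultimately have "(\<Sum>r\<in>transv D K. f g + act g (f (inv r))) = w" by simp
  then show ?thesis
    by (simp add: sum.distrib sum_constant_ntimes act_sum w_def algebra_simps)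
qed

end

end

context coset_cocycles
begin

text \<open>The representative of the identity need not be the identity of \<open>G\<close>.
  Evaluating the product rule for \<open>\<one> \<otimes> \<one>\<close> at \<open>x\<close> times
  its inverse shows that it acts trivially on invariant functions all the same.\<close>

lemma tau_one:
  assumes "hinv m" "x \<in> carrier G"
  shows "m (x \<otimes>\<^bsub>G\<^esub> \<tau> \<one>\<^bsub>Q\<^esub>) = m x"
proof -
  let ?y = "x \<otimes>\<^bsub>G\<^esub> inv\<^bsub>G\<^esub> \<tau> \<one>\<^bsub>Q\<^esub>"
  have y: "?y \<in> carrier G" "?y \<otimes>\<^bsub>G\<^esub> \<tau> \<one>\<^bsub>Q\<^esub> = x" using assms by (auto simp: G.m_assoc)
  have "m (?y \<otimes>\<^bsub>G\<^esub> \<tau> (\<one>\<^bsub>Q\<^esub> \<otimes>\<^bsub>Q\<^esub> \<one>\<^bsub>Q\<^esub>)) = m (?y \<otimes>\<^bsub>G\<^esub> \<tau> \<one>\<^bsub>Q\<^esub> \<otimes>\<^bsub>G\<^esub> \<tau> \<one>\<^bsub>Q\<^esub>)"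
    by (rule hinv_tau_mult[OF assms(1) _ _ y(1)]) auto
  then show ?thesis using y by simp
qed

lemma cocyc_one:
  assumes "cocyc K b" "\<one>\<^bsub>Q\<^esub> \<in> K" "x \<in> carrier G"
  shows "b \<one>\<^bsub>Q\<^esub> x = b \<one>\<^bsub>Q\<^esub> \<one>\<^bsub>G\<^esub>"
  using cocyc_eq[OF assms(1,2,2,3)] tau_one[OF cocyc_hinv[OF assms(1,2)] assms(3)]
    tau_one[OF cocyc_hinv[OF assms(1,2)], of "\<one>\<^bsub>G\<^esub>"] by simp

text \<open>This is \<open>crossed_hom_average\<close> in the group of functions on \<open>G\<close>
  vanishing at the identity, which serves as a model for functions modulo constants.\<close>

lemma cocyc_average:
  fixes b :: "'c \<Rightarrow> 'a \<Rightarrow> 'b::ab_group_add"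
  assumes D: "subgroup D Q" and K: "subgroup K Q" and DK: "D \<subseteq> K"
    and b: "cocyc K b" and zero: "\<And>\<gamma> x. \<lbrakk>\<gamma> \<in> D; x \<in> carrier G\<rbrakk> \<Longrightarrow> b \<gamma> x = b \<gamma> \<one>\<^bsub>G\<^esub>"
  defines "\<mu> \<equiv> \<lambda>x. \<Sum>r\<in>Q.transv D K. b (inv\<^bsub>Q\<^esub> r) x - b (inv\<^bsub>Q\<^esub> r) \<one>\<^bsub>G\<^esub>"
  shows "hinv \<mu>"
    and "\<lbrakk>\<gamma> \<in> K; x \<in> carrier G\<rbrakk> \<Longrightarrow>
      card (Q.transv D K) \<cdot> (b \<gamma> x - b \<gamma> \<one>\<^bsub>G\<^esub>) = \<mu> x - \<mu> (x \<otimes>\<^bsub>G\<^esub> \<tau> \<gamma>) + \<mu> (\<tau> \<gamma>)"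
proof -
  have KQ: "\<gamma> \<in> carrier Q" if "\<gamma> \<in> K" for \<gamma> using that subgroup.subset[OF K] by blast
  have iK: "inv\<^bsub>Q\<^esub> r \<in> K" if "r \<in> Q.transv D K" for r
    using that Q.transv_subset[OF D K DK] subgroup.m_inv_closed[OF K] by blast
  show "hinv \<mu>"
    unfolding hinv_def \<mu>_def
    by (intro ballI sum.cong) (use cocyc_hinv[OF b iK] in \<open>auto simp: hinv_def\<close>)
  \<comment> \<open>Values outside the carrier are set to 0, so that the hypotheses of the averaging
    lemma hold as equations between total functions.\<close>
  define f where "f \<gamma> = (\<lambda>x. if x \<in> carrier G then b \<gamma> x - b \<gamma> \<one>\<^bsub>G\<^esub> else 0)" for \<gamma>
  define a where "a \<gamma> u = (\<lambda>x. if x \<in> carrier G then u (x \<otimes>\<^bsub>G\<^esub> \<tau> \<gamma>) - u (\<tau> \<gamma>) else 0)"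
    for \<gamma> and u :: "'a \<Rightarrow> 'b"
  assume gx: "\<gamma> \<in> K" "x \<in> carrier G"
  have "card (Q.transv D K) \<cdot> f \<gamma> = (\<Sum>r\<in>Q.transv D K. f (inv\<^bsub>Q\<^esub> r)) - a \<gamma> (\<Sum>r\<in>Q.transv D K. f (inv\<^bsub>Q\<^esub> r))"
  proof (rule Q.crossed_hom_average[OF D K DK])
    show "a \<gamma> (u + v) = a \<gamma> u + a \<gamma> v" for \<gamma> u v by (auto simp: a_def fun_eq_iff)
    show "f d = 0" if d: "d \<in> D" for d
    proof (rule ext)
      fix x show "f d x = 0 x" by (cases "x \<in> carrier G") (simp_all add: f_def zero[OF d, of x])
    qed
    show "f (\<gamma> \<otimes>\<^bsub>Q\<^esub> \<delta>) = f \<gamma> + a \<gamma> (f \<delta>)" if gd: "\<gamma> \<in> K" "\<delta> \<in> K" for \<gamma> \<delta>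
    proof (rule ext)
      fix x
      show "f (\<gamma> \<otimes>\<^bsub>Q\<^esub> \<delta>) x = (f \<gamma> + a \<gamma> (f \<delta>)) x"
      proof (cases "x \<in> carrier G")
        case True
        have "f (\<gamma> \<otimes>\<^bsub>Q\<^esub> \<delta>) x = b (\<gamma> \<otimes>\<^bsub>Q\<^esub> \<delta>) x - b (\<gamma> \<otimes>\<^bsub>Q\<^esub> \<delta>) \<one>\<^bsub>G\<^esub>"
          using True by (simp add: f_def)
        also have "\<dots> = b \<gamma> x - b \<gamma> \<one>\<^bsub>G\<^esub> + (b \<delta> (x \<otimes>\<^bsub>G\<^esub> \<tau> \<gamma>) - b \<delta> (\<tau> \<gamma>))"
          by (subst cocycD[OF b gd True]) (simp add: algebra_simps)
        also have "\<dots> = (f \<gamma> + a \<gamma> (f \<delta>)) x"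
          using True gd KQ by (simp add: f_def a_def)
        finally show ?thesis .
      qed (simp add: f_def a_def)
    qed
  qed (rule gx(1))
  then have "(card (Q.transv D K) \<cdot> f \<gamma>) x
      = (\<Sum>r\<in>Q.transv D K. f (inv\<^bsub>Q\<^esub> r)) x - a \<gamma> (\<Sum>r\<in>Q.transv D K. f (inv\<^bsub>Q\<^esub> r)) x"
    by simp
  moreover have "(n \<cdot> u) x = n \<cdot> u x" for n and u :: "'a \<Rightarrow> 'b" by (induction n) auto
  moreover have "(\<Sum>r\<in>R. u r) y = (\<Sum>r\<in>R. u r y)" for R and u :: "'c \<Rightarrow> 'a \<Rightarrow> 'b" and y
    by (induction R rule: infinite_finite_induct) auto
  moreover have "(\<Sum>r\<in>Q.transv D K. f (inv\<^bsub>Q\<^esub> r) y) = \<mu> y" if "y \<in> carrier G" for y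
    using that by (simp add: \<mu>_def f_def)
  ultimately show "card (Q.transv D K) \<cdot> (b \<gamma> x - b \<gamma> \<one>\<^bsub>G\<^esub>) = \<mu> x - \<mu> (x \<otimes>\<^bsub>G\<^esub> \<tau> \<gamma>) + \<mu> (\<tau> \<gamma>)"
    using gx KQ by (simp add: a_def f_def)
qed

text \<open>Restriction to \<open>D\<close> followed by corestriction is multiplication by the
  index. After subtraction of a coboundary the cocycle is constant in \<open>x\<close> on
  \<open>D\<close>, and the averaging formula applies.\<close>

lemma triv_average:
  fixes b :: "'c \<Rightarrow> 'a \<Rightarrow> 'b::ab_group_add"
  assumes D: "subgroup D Q" and K: "subgroup K Q" and DK: "D \<subseteq> K"
    and b: "cocyc K b" and t: "triv D b"
  shows "triv K (\<lambda>\<gamma> x. card (Q.transv D K) \<cdot> b \<gamma> x)"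
proof -
  obtain m e where m: "hinv m"
    and me: "\<And>\<gamma> x. \<lbrakk>\<gamma> \<in> D; x \<in> carrier G\<rbrakk> \<Longrightarrow> b \<gamma> x = m (x \<otimes>\<^bsub>G\<^esub> \<tau> \<gamma>) - m x + e \<gamma>"
    using t unfolding triv_def by blast
  have DK': "K \<subseteq> carrier Q" using subgroup.subset[OF K] .
  \<comment> \<open>The coboundary of \<open>m\<close> is formed over all of \<open>K\<close>; its
    constant term is zero because \<open>e\<close> is controlled on \<open>D\<close> only.\<close>
  define d where "d \<gamma> x = m (x \<otimes>\<^bsub>G\<^esub> \<tau> \<gamma>) - m x + 0" for \<gamma> x
  have cd: "cocyc K d" unfolding d_def by (rule cocyc_coboundary[OF m DK', of "\<lambda>_. 0"])
  define b' where "b' \<gamma> x = b \<gamma> x - d \<gamma> x" for \<gamma> x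
  have cb': "cocyc K b'" unfolding b'_def by (rule cocyc_diff[OF b cd])
  have b'D: "b' \<gamma> x = b' \<gamma> \<one>\<^bsub>G\<^esub>" if "\<gamma> \<in> D" "x \<in> carrier G" for \<gamma> x
    using that by (simp add: b'_def d_def me)
  note av = cocyc_average[OF D K DK cb' b'D]
  have "triv K (\<lambda>\<gamma> x. card (Q.transv D K) \<cdot> b' \<gamma> x)"
  proof (rule trivI)
    let ?\<mu> = "\<lambda>x. \<Sum>r\<in>Q.transv D K. b' (inv\<^bsub>Q\<^esub> r) x - b' (inv\<^bsub>Q\<^esub> r) \<one>\<^bsub>G\<^esub>"
    show "hinv (\<lambda>x. - ?\<mu> x)" using av(1) by (simp add: hinv_def)
    fix \<gamma> x assume gx: "\<gamma> \<in> K" "x \<in> carrier G"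
    show "card (Q.transv D K) \<cdot> b' \<gamma> x = - ?\<mu> (x \<otimes>\<^bsub>G\<^esub> \<tau> \<gamma>) - - ?\<mu> x
        + (?\<mu> (\<tau> \<gamma>) + card (Q.transv D K) \<cdot> b' \<gamma> \<one>\<^bsub>G\<^esub>)"
    proof -
      have "card (Q.transv D K) \<cdot> (b' \<gamma> x - b' \<gamma> \<one>\<^bsub>G\<^esub>) = ?\<mu> x - ?\<mu> (x \<otimes>\<^bsub>G\<^esub> \<tau> \<gamma>) + ?\<mu> (\<tau> \<gamma>)"
        by (rule av(2)[OF _ _ gx])
      then show ?thesis by (simp add: ntimes_diff_right algebra_simps)
    qed
  qed
  moreover have "triv K d" unfolding d_def by (rule trivI[OF m refl])
  then have "triv K (\<lambda>\<gamma> x. card (Q.transv D K) \<cdot> d \<gamma> x)" by (rule triv_ntimes)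
  ultimately have "triv K (\<lambda>\<gamma> x. card (Q.transv D K) \<cdot> b' \<gamma> x + card (Q.transv D K) \<cdot> d \<gamma> x)"
    by (rule triv_add)
  then show ?thesis by (simp add: b'_def flip: ntimes_add_right)
qed

text \<open>Every cocycle is trivial on the identity subgroup, whose index in \<open>K\<close> is
  the order of \<open>K\<close>.\<close>

lemma triv_card:
  assumes K: "subgroup K Q" and b: "cocyc K b"
  shows "triv K (\<lambda>\<gamma> x. card K \<cdot> b \<gamma> x)"
proof -
  have one: "subgroup {\<one>\<^bsub>Q\<^esub>} Q" by (rule Q.triv_subgroup)
  have oneK: "{\<one>\<^bsub>Q\<^esub>} \<subseteq> K" using subgroup.one_closed[OF K] by blast
  have "triv {\<one>\<^bsub>Q\<^esub>} b"
  proof (rule trivI[of "\<lambda>_. 0" _ _ "\<lambda>\<gamma>. b \<gamma> \<one>\<^bsub>G\<^esub>"])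
    show "b \<gamma> x = 0 - 0 + b \<gamma> \<one>\<^bsub>G\<^esub>" if "\<gamma> \<in> {\<one>\<^bsub>Q\<^esub>}" "x \<in> carrier G" for \<gamma> x
      using cocyc_one[OF b subgroup.one_closed[OF K] that(2)] that(1) by simp
  qed (simp add: hinv_def)
  from triv_average[OF one K oneK b this] Q.card_transv[OF one K oneK]
  show ?thesis using finite_Q subgroup.subset[OF K] finite_subset by fastforce
qed

end

section \<open>Inflation from the quotient by a normal Sylow subgroup\<close>

lemma (in group) subgroup_set_mult_normal:
  assumes H: "subgroup H G" and S: "S \<lhd> G"
  shows "subgroup (H <#> S) G"
proof -
  interpret S: normal S G by (rule S)
  have Hc: "h \<in> carrier G" if "h \<in> H" for h using subgroup.subset[OF H] that by blast
  have Sc: "s \<in> carrier G" if "s \<in> S" for s using S.subset that by blast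
  show ?thesis
  proof (rule subgroupI)
    show "H <#> S \<subseteq> carrier G" using Hc Sc by (auto simp: set_mult_def)
    have "\<one> \<otimes> \<one> \<in> H <#> S"
      using subgroup.one_closed[OF H] subgroup.one_closed[OF S.subgroup_axioms]
      unfolding set_mult_def by blast
    then show "H <#> S \<noteq> {}" by blast
    fix a assume "a \<in> H <#> S"
    then obtain h s where a: "h \<in> H" "s \<in> S" "a = h \<otimes> s" by (auto simp: set_mult_def)
    have "inv a = inv h \<otimes> (h \<otimes> inv s \<otimes> inv h)"
      using a Hc Sc by (simp add: inv_mult_group m_assoc[symmetric])
    moreover have "h \<otimes> inv s \<otimes> inv h \<in> S" using S.inv_op_closed2 a Hc by simp
    ultimately show "inv a \<in> H <#> S"
      using a subgroup.m_inv_closed[OF H] by (auto simp: set_mult_def)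
    fix b assume "b \<in> H <#> S"
    then obtain k t where b: "k \<in> H" "t \<in> S" "b = k \<otimes> t" by (auto simp: set_mult_def)
    have "a \<otimes> b = (h \<otimes> k) \<otimes> ((inv k \<otimes> s \<otimes> k) \<otimes> t)"
    proof -
      have "k \<otimes> (inv k \<otimes> (s \<otimes> (k \<otimes> t))) = s \<otimes> (k \<otimes> t)"
        using a b Hc Sc by (simp add: m_assoc[symmetric])
      then show ?thesis using a b Hc Sc by (simp add: m_assoc)
    qed
    moreover have "(inv k \<otimes> s \<otimes> k) \<otimes> t \<in> S" using S.inv_op_closed1 a b Hc by simp
    ultimately show "a \<otimes> b \<in> H <#> S"
      using a b subgroup.m_closed[OF H] by (auto simp: set_mult_def)
  qed
qed

lemma (in group) pow_card_subgroup:
  assumes "subgroup K G" "finite K" "k \<in> K"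
  shows "k [^] card K = \<one>"
proof -
  interpret K: group "G\<lparr>carrier := K\<rparr>" by (rule subgroup_imp_group[OF assms(1)])
  show ?thesis using K.pow_order_eq_1[of k] assms by (simp add: order_def flip: nat_pow_consistent)
qed

locale normal_sylow = coset_module G H + S?: normal S G
  for G :: "('a, 'x) monoid_scheme" (structure) and H and S +
  fixes p :: nat
  assumes finG: "finite (carrier G)" and prime_p: "prime p"
    and card_S: "\<exists>a. card S = p ^ a" and coprime_index: "coprime p (card (rcosets S))"
begin

lemma S_carrier: "s \<in> S \<Longrightarrow> s \<in> carrier G"
  using S.subset by blast

definition rep :: "'a set \<Rightarrow> 'a" where
  "rep C = (SOME g. g \<in> C)"

lemma rep_coset_eq:
  assumes "g \<in> carrier G"
  obtains s where "s \<in> S" "rep (S #> g) = s \<otimes> g"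
proof -
  have "rep (S #> g) \<in> S #> g"
    unfolding rep_def using G.rcos_self[OF assms S.subgroup_axioms] by (rule someI)
  then show ?thesis using that by (auto simp: r_coset_def)
qed

lemma subgroup_HS: "subgroup (H <#> S) G"
  using G.subgroup_set_mult_normal[OF subgroup_H S.normal_axioms] .

sublocale GC: coset_cohomology G H G "\<lambda>x. x" "J_act G"
proof unfold_locales
  show "finite (carrier G)" by (rule finG)
  fix \<gamma> \<delta> x assume "\<gamma> \<in> carrier G" "\<delta> \<in> carrier G" "x \<in> carrier G"
  then show "\<exists>h\<in>H. x \<otimes> (\<gamma> \<otimes> \<delta>) = h \<otimes> (x \<otimes> \<gamma> \<otimes> \<delta>)"
    using subgroup.one_closed[OF subgroup_H] by (intro bexI[of _ \<one>]) (auto simp: G.m_assoc)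
qed auto

lemma carrier_Mod: "carrier (G Mod S) = (\<lambda>g. S #> g) ` carrier G"
  by (auto simp: FactGroup_def RCOSETS_def)

lemma mult_Mod: "\<lbrakk>g \<in> carrier G; h \<in> carrier G\<rbrakk> \<Longrightarrow> (S #> g) \<otimes>\<^bsub>G Mod S\<^esub> (S #> h) = S #> (g \<otimes> h)"
  by (simp add: FactGroup_def S.rcos_sum)

lemma finite_Mod: "finite (carrier (G Mod S))"
  unfolding carrier_Mod using finG by blast

interpretation HS: coset_module G "H <#> S"
  by (rule coset_module.intro[OF G.is_group coset_module_axioms.intro[OF subgroup_HS]])

text \<open>Normality moves a factor from \<open>S\<close> across \<open>x\<close>, so invariance
  under \<open>S\<close> on the left is invariance under \<open>S\<close> on the right.\<close>

lemma HS_hinv_iff: "HS.hinv m \<longleftrightarrow> hinv m \<and> (\<forall>x\<in>carrier G. \<forall>s\<in>S. m (x \<otimes> s) = m x)"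
proof
  assume m: "HS.hinv m"
  have "m (h \<otimes> x) = m x" if "h \<in> H" "x \<in> carrier G" for h x
    using HS.hinvD[OF m that(2), of h] that H_carrier S.one_closed
    by (metis (no_types, lifting) G.r_one UN_I set_mult_def singletonI)
  moreover have "m (x \<otimes> s) = m x" if "s \<in> S" "x \<in> carrier G" for s x
  proof -
    have "x \<otimes> s \<otimes> inv x \<in> S" using S.inv_op_closed2 that by blast
    then have "\<one> \<otimes> (x \<otimes> s \<otimes> inv x) \<in> H <#> S"
      using subgroup.one_closed[OF subgroup_H] unfolding set_mult_def by blast
    then have "m ((x \<otimes> s \<otimes> inv x) \<otimes> x) = m x"
      using HS.hinvD[OF m that(2)] that S_carrier by simp
    then show ?thesis using that S_carrier by (simp add: G.m_assoc)
  qed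
  ultimately show "hinv m \<and> (\<forall>x\<in>carrier G. \<forall>s\<in>S. m (x \<otimes> s) = m x)"
    by (auto simp: hinv_def)
next
  assume m: "hinv m \<and> (\<forall>x\<in>carrier G. \<forall>s\<in>S. m (x \<otimes> s) = m x)"
  show "HS.hinv m"
    unfolding HS.hinv_def
  proof (intro ballI)
    fix x a assume x: "x \<in> carrier G" and "a \<in> H <#> S"
    then obtain h s where a: "h \<in> H" "s \<in> S" "a = h \<otimes> s" by (auto simp: set_mult_def)
    have "a \<otimes> x = h \<otimes> (x \<otimes> (inv x \<otimes> s \<otimes> x))"
      using a x H_carrier S_carrier by (simp add: G.m_assoc[symmetric])
    moreover have "inv x \<otimes> s \<otimes> x \<in> S" using S.inv_op_closed1 x a by blast
    ultimately show "m (a \<otimes> x) = m x"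
      using m x a(1) S_carrier by (simp add: hinv_def)
  qed
qed

text \<open>The choice made by \<open>rep\<close> is invisible: the extra factor from
  \<open>S\<close> can be moved to the far right, where these functions ignore it.\<close>

lemma HS_hinv_rep:
  assumes "HS.hinv m" "x \<in> carrier G" "g \<in> carrier G"
  shows "m (x \<otimes> rep (S #> g)) = m (x \<otimes> g)"
proof -
  obtain s where s: "s \<in> S" "rep (S #> g) = s \<otimes> g" using rep_coset_eq[OF assms(3)] .
  have "x \<otimes> (s \<otimes> g) = (x \<otimes> g) \<otimes> (inv g \<otimes> s \<otimes> g)"
    using assms s S_carrier by (simp add: G.m_assoc) (simp add: G.m_assoc[symmetric])
  moreover have "inv g \<otimes> s \<otimes> g \<in> S" using S.inv_op_closed1 assms s by blast
  ultimately show ?thesis using assms s by (simp add: HS_hinv_iff)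
qed

lemma rep_closed: "C \<in> carrier (G Mod S) \<Longrightarrow> rep C \<in> carrier G"
  unfolding carrier_Mod using rep_coset_eq S_carrier by (metis G.m_closed imageE)

lemma coset_cohomology_Mod: "coset_cohomology G (H <#> S) (G Mod S) rep (quotient_act (J_act G))"
proof -
  interpret Q: group "G Mod S" by (rule S.factorgroup_is_group)
  show ?thesis
  proof (intro coset_cohomology.intro coset_cocycles.intro coset_cohomology_axioms.intro
      coset_cocycles_axioms.intro HS.coset_module_axioms Q.is_group)
    show "finite (carrier G)" "finite (carrier (G Mod S))" by (rule finG finite_Mod)+
    show "rep \<gamma> \<in> carrier G" if "\<gamma> \<in> carrier (G Mod S)" for \<gamma> using rep_closed[OF that] .
  next
    fix C D x assume C: "C \<in> carrier (G Mod S)" "D \<in> carrier (G Mod S)" and x: "x \<in> carrier G"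
    then obtain g h where gh: "g \<in> carrier G" "C = S #> g" "h \<in> carrier G" "D = S #> h"
      by (auto simp: carrier_Mod)
    obtain s where s: "s \<in> S" "rep C = s \<otimes> g" using rep_coset_eq[OF gh(1)] gh by blast
    obtain t where t: "t \<in> S" "rep D = t \<otimes> h" using rep_coset_eq[OF gh(3)] gh by blast
    obtain u where u: "u \<in> S" "rep (C \<otimes>\<^bsub>G Mod S\<^esub> D) = u \<otimes> (g \<otimes> h)"
      using rep_coset_eq[of "g \<otimes> h"] gh mult_Mod by (metis G.m_closed)
    note c = S_carrier[OF s(1)] S_carrier[OF t(1)] S_carrier[OF u(1)] x gh(1,3)
    \<comment> \<open>The error in multiplicativity: \<open>rep\<close> of the product equals
      \<open>?v\<close> times the product of the representatives. Conjugation by \<open>x\<close>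
      carries it to the left, where it lies in \<open>S\<close> and thus in
      \<open>H <#> S\<close>.\<close>
    let ?v = "u \<otimes> (g \<otimes> inv t \<otimes> inv g) \<otimes> inv s"
    let ?w = "x \<otimes> ?v \<otimes> inv x"
    have "g \<otimes> inv t \<otimes> inv g \<in> S" using S.inv_op_closed2 gh t by simp
    then have "?v \<in> S" using u s by simp
    then have "?w \<in> S" using S.inv_op_closed2 x by blast
    then have "\<one> \<otimes> ?w \<in> H <#> S"
      using subgroup.one_closed[OF subgroup_H] unfolding set_mult_def by blast
    then have "?w \<in> H <#> S" using c by simp
    moreover have "x \<otimes> rep (C \<otimes>\<^bsub>G Mod S\<^esub> D) = ?w \<otimes> (x \<otimes> rep C \<otimes> rep D)"
    proof -
      have canc: "inv a \<otimes> (a \<otimes> b) = b" if "a \<in> carrier G" "b \<in> carrier G" for a b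
        using that by (simp flip: G.m_assoc)
      show ?thesis unfolding s t u using c by (simp add: G.m_assoc canc)
    qed
    ultimately show "\<exists>h\<in>H <#> S. x \<otimes> rep (C \<otimes>\<^bsub>G Mod S\<^esub> D) = h \<otimes> (x \<otimes> rep C \<otimes> rep D)"
      by blast
  next
    fix C m assume C: "C \<in> carrier (G Mod S)" and m: "m \<in> carrier (J G (H <#> S))"
    then obtain g where g: "g \<in> carrier G" "C = S #> g" by (auto simp: carrier_Mod)
    obtain \<phi> where \<phi>: "HS.hinv \<phi>" "m = HS.proj \<phi>" using HS.J_cases[OF m] by blast
    have "J_act G a m = J_act G (rep C) m" if a: "a \<in> C" for a
    proof -
      have aG: "a \<in> carrier G" using a C by (metis g G.r_coset_subset_G S.subset subsetD)
      have Ca: "C = S #> a" using G.repr_independence[OF _ g(1) S.subgroup_axioms] a g(2) by blast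
      have "\<phi> (x \<otimes> rep C) = \<phi> (x \<otimes> a)" if "x \<in> carrier G" for x
        unfolding Ca by (rule HS_hinv_rep[OF \<phi>(1) that aG])
      then have "HS.proj (\<lambda>x. \<phi> (x \<otimes> a)) = HS.proj (\<lambda>x. \<phi> (x \<otimes> rep C))"
        unfolding HS.proj_eq_iff using G.one_closed by simp
      then show ?thesis unfolding \<phi>(2) by (simp add: HS.J_act_proj aG rep_closed[OF C])
    qed
    moreover have "g \<in> C" using G.rcos_self[OF g(1) S.subgroup_axioms] g(2) by simp
    ultimately have "(\<lambda>g. J_act G g m) ` C = {J_act G (rep C) m}" by blast
    then show "quotient_act (J_act G) C m = J_act G (rep C) m" by (simp add: quotient_act_def)
  qed
qed

sublocale QC: coset_cohomology G "H <#> S" "G Mod S" rep "quotient_act (J_act G)"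
  by (rule coset_cohomology_Mod)

end

section \<open>Comparison of cocycles on the group and on the quotient\<close>

context normal_sylow
begin

lemma QC_hinv_iff: "QC.hinv m \<longleftrightarrow> hinv m \<and> (\<forall>x\<in>carrier G. \<forall>s\<in>S. m (x \<otimes> s) = m x)"
  by (rule HS_hinv_iff)

definition inflate :: "('a set \<Rightarrow> 'a \<Rightarrow> circle) \<Rightarrow> 'a \<Rightarrow> 'a \<Rightarrow> circle" where
  "inflate b g x = b (S #> g) x"

lemma cocyc_inflate:
  assumes b: "QC.cocyc (carrier (G Mod S)) b"
  shows "GC.cocyc (carrier G) (inflate b)"
proof (rule GC.cocycI)
  have C: "S #> g \<in> carrier (G Mod S)" if "g \<in> carrier G" for g
    using that by (simp add: carrier_Mod)
  note hv = QC.cocyc_hinv[OF b C]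
  show "hinv (inflate b g)" if "g \<in> carrier G" for g
    using hv[OF that] by (simp add: QC_hinv_iff inflate_def[abs_def])
  fix g h x assume g: "g \<in> carrier G" "h \<in> carrier G" "x \<in> carrier G"
  have e: "b (S #> h) (rep (S #> g)) = b (S #> h) g"
    using HS_hinv_rep[OF hv[OF g(2)] G.one_closed g(1)] g rep_closed[OF C[OF g(1)]] by simp
  show "inflate b g x + inflate b h (x \<otimes> g) - inflate b (g \<otimes> h) x =
       inflate b g \<one> + inflate b h g - inflate b (g \<otimes> h) \<one>"
    using QC.cocyc_eq[OF b C[OF g(1)] C[OF g(2)] g(3)]
    by (simp add: inflate_def S.rcos_sum g HS_hinv_rep[OF hv[OF g(2)] g(3,1)] e)
qed

lemma card_Mod_dvd:
  assumes "subgroup E (G Mod S)"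
  shows "coprime (card E) p"
proof -
  have "card E dvd card (rcosets S)"
    using group.lagrange[OF S.factorgroup_is_group assms]
    by (metis FactGroup_def dvd_triv_right order_def partial_object.select_convs(1))
  then show ?thesis using coprime_index by (metis coprime_commute coprime_divisors dvd_refl)
qed

lemma subgroup_image_Mod:
  assumes D: "subgroup D G"
  shows "subgroup ((\<lambda>g. S #> g) ` D) (G Mod S)"
proof -
  interpret h: group_hom G "G Mod S" "\<lambda>g. S #> g"
    using S.r_coset_hom_Mod G.is_group S.factorgroup_is_group
    by (simp add: group_hom_def group_hom_axioms_def)
  show ?thesis using h.subgroup_img_is_subgroup[OF D] .
qed

lemma coprime_card_S:
  assumes "coprime k p"
  shows "coprime k (card S)"
  using card_S assms by auto

text \<open>From right to left the same \<open>m\<close> works. Conversely, \<open>m\<close> need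
  not be invariant under \<open>S\<close>; its sum over \<open>S\<close>-translates is, at the cost
  of the factor \<open>card S\<close>. This factor is harmless, because the image of
  \<open>D\<close> in the quotient has order prime to \<open>p\<close> and annihilates the class
  too.\<close>

lemma triv_inflate_iff:
  assumes b: "QC.cocyc (carrier (G Mod S)) b" and D: "subgroup D G"
  shows "GC.triv D (inflate b) \<longleftrightarrow> QC.triv ((\<lambda>g. S #> g) ` D) b"
proof
  have DG: "g \<in> carrier G" if "g \<in> D" for g using that subgroup.subset[OF D] by blast
  have C: "S #> g \<in> carrier (G Mod S)" if "g \<in> carrier G" for g
    using that by (simp add: carrier_Mod)
  note hv = QC.cocyc_hinv[OF b C]
  {
    assume "QC.triv ((\<lambda>g. S #> g) ` D) b"
    then obtain m e where m: "QC.hinv m"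
      and me: "\<And>\<gamma> x. \<lbrakk>\<gamma> \<in> (\<lambda>g. S #> g) ` D; x \<in> carrier G\<rbrakk> \<Longrightarrow> b \<gamma> x = m (x \<otimes> rep \<gamma>) - m x + e \<gamma>"
      unfolding QC.triv_def by blast
    show "GC.triv D (inflate b)"
    proof (rule GC.trivI[of m _ _ "\<lambda>g. e (S #> g)"])
      show "hinv m" using m QC_hinv_iff by blast
      show "inflate b g x = m (x \<otimes> g) - m x + e (S #> g)" if "g \<in> D" "x \<in> carrier G" for g x
        using that by (simp add: inflate_def me HS_hinv_rep[OF m] DG)
    qed
  next
    assume "GC.triv D (inflate b)"
    then obtain m e where m: "hinv m"
      and me: "\<And>g x. \<lbrakk>g \<in> D; x \<in> carrier G\<rbrakk> \<Longrightarrow> inflate b g x = m (x \<otimes> g) - m x + e g"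
      unfolding GC.triv_def by blast
    define M where "M x = (\<Sum>s\<in>S. m (x \<otimes> s))" for x
    have M: "QC.hinv M"
      unfolding QC_hinv_iff
    proof (intro conjI ballI)
      show "hinv M" unfolding hinv_def M_def
        by (intro ballI sum.cong) (use m H_carrier S_carrier in \<open>auto simp: hinv_def G.m_assoc\<close>)
      fix x s assume xs: "x \<in> carrier G" "s \<in> S"
      have "M (x \<otimes> s) = (\<Sum>t\<in>S. m (x \<otimes> (s \<otimes> t)))"
        unfolding M_def by (rule sum.cong) (use xs S_carrier in \<open>auto simp: G.m_assoc\<close>)
      also have "\<dots> = M x"
        unfolding M_def by (rule sum.reindex_bij_betw[OF GC.bij_betw_translate[OF S.subgroup_axioms xs(2)]])
      finally show "M (x \<otimes> s) = M x" .
    qed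
    \<comment> \<open>Conjugation by \<open>g\<close> permutes \<open>S\<close>, which allows
      \<open>g\<close> to be moved past the summation variable.\<close>
    have M_translate: "(\<Sum>s\<in>S. m (x \<otimes> s \<otimes> g)) = M (x \<otimes> g)" if "x \<in> carrier G" "g \<in> carrier G" for x g
    proof -
      have "bij_betw (\<lambda>s. inv g \<otimes> s \<otimes> g) S S"
      proof (rule bij_betw_byWitness[where f' = "\<lambda>s. g \<otimes> s \<otimes> inv g"])
        have canc: "g \<otimes> (inv g \<otimes> b) = b" "inv g \<otimes> (g \<otimes> b) = b" if "b \<in> carrier G" for b
          using that \<open>g \<in> carrier G\<close> by (simp_all flip: G.m_assoc)
        show "\<forall>a\<in>S. g \<otimes> (inv g \<otimes> a \<otimes> g) \<otimes> inv g = a" "\<forall>a\<in>S. inv g \<otimes> (g \<otimes> a \<otimes> inv g) \<otimes> g = a"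
          using that S_carrier by (auto simp: G.m_assoc canc)
      qed (use that S.inv_op_closed1 S.inv_op_closed2 in auto)
      then have "(\<Sum>s\<in>S. m (x \<otimes> g \<otimes> (inv g \<otimes> s \<otimes> g))) = (\<Sum>s\<in>S. m (x \<otimes> g \<otimes> s))"
        by (rule sum.reindex_bij_betw)
      moreover have "x \<otimes> g \<otimes> (inv g \<otimes> s \<otimes> g) = x \<otimes> s \<otimes> g" if "s \<in> S" for s
      proof -
        have "g \<otimes> (inv g \<otimes> (s \<otimes> g)) = s \<otimes> g"
          using \<open>g \<in> carrier G\<close> S_carrier[OF that] by (simp flip: G.m_assoc)
        then show ?thesis using \<open>g \<in> carrier G\<close> \<open>x \<in> carrier G\<close> S_carrier[OF that] by (simp add: G.m_assoc)
      qed
      ultimately show ?thesis by (simp add: M_def cong: sum.cong)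
    qed
    have key: "card S \<cdot> b (S #> g) x = M (x \<otimes> g) - M x + card S \<cdot> e g" if gx: "g \<in> D" "x \<in> carrier G" for g x
    proof -
      have "(\<Sum>s\<in>S. b (S #> g) (x \<otimes> s)) = (\<Sum>s\<in>S. m (x \<otimes> s \<otimes> g) - m (x \<otimes> s) + e g)"
        by (rule sum.cong) (use me[OF gx(1)] gx S_carrier in \<open>auto simp: inflate_def\<close>)
      moreover have "(\<Sum>s\<in>S. b (S #> g) (x \<otimes> s)) = card S \<cdot> b (S #> g) x"
        using hv[OF DG[OF gx(1)]] gx by (simp add: QC_hinv_iff sum_constant_ntimes)
      ultimately show ?thesis
        using M_translate[OF gx(2) DG[OF gx(1)]]
        by (simp add: sum.distrib sum_subtractf sum_constant_ntimes M_def)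
    qed
    have "QC.triv ((\<lambda>g. S #> g) ` D) (\<lambda>\<gamma> x. card S \<cdot> b \<gamma> x)"
    proof (rule QC.trivI[OF M])
      fix \<gamma> x assume g: "\<gamma> \<in> (\<lambda>g. S #> g) ` D" and x: "x \<in> carrier G"
      then obtain g where g: "g \<in> D" "\<gamma> = S #> g" by blast
      have "card S \<cdot> b \<gamma> \<one> = M g - M \<one> + card S \<cdot> e g"
        using key[OF g(1) G.one_closed] DG[OF g(1)] g by simp
      moreover have "M (rep \<gamma>) = M g"
        using HS_hinv_rep[OF M G.one_closed DG[OF g(1)]] DG[OF g(1)] rep_closed[OF C] g by simp
      ultimately show "card S \<cdot> b \<gamma> x = M (x \<otimes> rep \<gamma>) - M x + (card S \<cdot> b \<gamma> \<one> - M (rep \<gamma>) + M \<one>)"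
        using key[OF g(1) x] HS_hinv_rep[OF M x DG[OF g(1)]] g by simp
    qed
    moreover have "QC.triv ((\<lambda>g. S #> g) ` D) (\<lambda>\<gamma> x. card ((\<lambda>g. S #> g) ` D) \<cdot> b \<gamma> x)"
      by (rule QC.triv_card[OF subgroup_image_Mod[OF D] QC.cocyc_subset[OF b]]) (use C DG in blast)
    moreover have "coprime (card ((\<lambda>g. S #> g) ` D)) (card S)"
      by (rule coprime_card_S[OF card_Mod_dvd[OF subgroup_image_Mod[OF D]]])
    moreover have "0 < card ((\<lambda>g. S #> g) ` D)"
      using subgroup.one_closed[OF D] finite_subset[OF subgroup.subset[OF D] finG] by (auto simp: card_gt_0_iff)
    ultimately show "QC.triv ((\<lambda>g. S #> g) ` D) b"
      using QC.triv_coprime by blast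
  }
qed

text \<open>A cocycle with values in torsion prime to \<open>p\<close> is trivial on
  \<open>S\<close>. Once it vanishes there identically, its values depend only on cosets of
  \<open>S\<close> in both arguments, so it is inflated from the quotient.\<close>

lemma inflate_surj:
  assumes b: "GC.cocyc (carrier G) b" and k: "0 < k" "coprime k p"
    and t: "GC.triv (carrier G) (\<lambda>g x. k \<cdot> b g x :: circle)"
  obtains c where "QC.cocyc (carrier (G Mod S)) c" "GC.triv (carrier G) (\<lambda>g x. b g x - inflate c g x)"
proof -
  obtain m e where m: "hinv m"
    and me: "\<And>g x. \<lbrakk>g \<in> carrier G; x \<in> carrier G\<rbrakk> \<Longrightarrow> k \<cdot> b g x = m (x \<otimes> g) - m x + e g"
    using t unfolding GC.triv_def by blast
  \<comment> \<open>A fixed choice of division by \<open>k\<close>. Applied to the values of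
    \<open>m\<close> and \<open>e\<close> it gives a coboundary whose removal leaves
    \<open>b1\<close> with values killed by \<open>k\<close>.\<close>
  define d where "d a = (SOME a'. k \<cdot> a' = a)" for a :: circle
  have d: "k \<cdot> d a = a" for a
    unfolding d_def using circle_divisible[OF k(1), of a] by (metis (mono_tags, lifting) someI_ex)
  define b1 where "b1 g x = b g x - (d (m (x \<otimes> g)) - d (m x) + d (e g))" for g x
  have hd: "hinv (\<lambda>x. d (m x))" using m by (simp add: hinv_def)
  have t1: "GC.cocyc (carrier G) (\<lambda>g x. d (m (x \<otimes> g)) - d (m x) + d (e g))"
    by (rule GC.cocyc_coboundary[OF hd order_refl])
  have b1: "GC.cocyc (carrier G) b1"
    unfolding b1_def by (rule GC.cocyc_diff[OF b t1])
  have k1: "k \<cdot> b1 g x = 0" if "g \<in> carrier G" "x \<in> carrier G" for g x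
    using me[OF that] by (simp add: b1_def ntimes_diff_right ntimes_add_right d)
  have one: "subgroup {\<one>} G" by (rule G.triv_subgroup)
  have oneS: "{\<one>} \<subseteq> S" using subgroup.one_closed[OF S.subgroup_axioms] by blast
  have b1_one: "b1 \<gamma> x = b1 \<gamma> \<one>" if "\<gamma> \<in> {\<one>}" "x \<in> carrier G" for \<gamma> x
    using GC.cocyc_one[OF b1 G.one_closed that(2)] that(1) by simp
  define \<mu> where "\<mu> x = (\<Sum>r\<in>G.transv {\<one>} S. b1 (inv r) x - b1 (inv r) \<one>)" for x
  have b1S: "GC.cocyc S b1" using GC.cocyc_subset[OF b1 S.subset] .
  note av = GC.cocyc_average[OF one S.subgroup_axioms oneS b1S b1_one, folded \<mu>_def]
  have h\<mu>: "hinv \<mu>" using av(1) by (simp add: \<mu>_def[abs_def])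
  have finS: "finite S" using finite_subset[OF S.subset finG] .
  have "card (G.transv {\<one>} S) = card S"
    using G.card_transv[OF one S.subgroup_axioms oneS finS] by simp
  then have \<mu>: "card S \<cdot> (b1 s x - b1 s \<one>) = \<mu> x - \<mu> (x \<otimes> s) + \<mu> s" if "s \<in> S" "x \<in> carrier G" for s x
    using av(2)[OF _ _ that] by simp
  have k\<mu>: "k \<cdot> \<mu> x = 0" if "x \<in> carrier G" for x
    unfolding \<mu>_def ntimes_sum
  proof (intro sum.neutral ballI)
    fix r assume "r \<in> G.transv {\<one>} S"
    then have "inv r \<in> carrier G"
      using G.transv_subset[OF one S.subgroup_axioms oneS] S_carrier by blast
    then show "k \<cdot> (b1 (inv r) x - b1 (inv r) \<one>) = 0"
      using that by (simp add: ntimes_diff_right k1)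
  qed
  have cS: "coprime k (card S)" using coprime_card_S[OF k(2)] .
  have "S \<noteq> {}" using oneS by blast
  then have "0 < card S" using finS by (simp add: card_gt_0_iff)
  moreover have "coprime (card S) k" using cS by (simp add: coprime_commute)
  \<comment> \<open>On elements killed by \<open>k\<close>, multiplication by \<open>u\<close>
    inverts multiplication by \<open>card S\<close>, so the averaging identity on \<open>S\<close>
    can be divided.\<close>
  ultimately obtain u v where uv: "u * card S = v * k + 1" using coprime_bezout_nat by metis
  have kz: "(u * card S) \<cdot> a = a" if "k \<cdot> a = 0" for a :: circle
    using that by (simp add: uv ntimes_add_left ntimes_mult)
  define \<nu> where "\<nu> x = u \<cdot> \<mu> x" for x
  have h\<nu>: "hinv \<nu>" using h\<mu> by (simp add: hinv_def \<nu>_def)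
  have k\<nu>: "k \<cdot> \<nu> x = 0" if "x \<in> carrier G" for x
    using k\<mu>[OF that] by (simp add: \<nu>_def ntimes_commute[of k])
  have \<nu>1: "\<nu> \<one> = 0" by (simp add: \<nu>_def \<mu>_def)
  have \<nu>S: "b1 s x - b1 s \<one> = \<nu> x - \<nu> (x \<otimes> s) + \<nu> s" if "s \<in> S" "x \<in> carrier G" for s x
  proof -
    have "k \<cdot> (b1 s x - b1 s \<one>) = 0"
      using k1 that S_carrier by (simp add: ntimes_diff_right)
    then have "b1 s x - b1 s \<one> = u \<cdot> card S \<cdot> (b1 s x - b1 s \<one>)"
      using kz by (metis ntimes_mult)
    then show ?thesis
      unfolding \<mu>[OF that] by (simp add: \<nu>_def ntimes_diff_right ntimes_add_right)
  qed
  \<comment> \<open>The coboundary of \<open>\<nu>\<close> removes the dependence on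
    \<open>x\<close> for elements of \<open>S\<close>; the constant term makes every
    \<open>b2 g\<close> vanish at the identity, so that \<open>b2\<close> is zero on
    \<open>S\<close>.\<close>
  define b2 where "b2 g x = b1 g x + (\<nu> (x \<otimes> g) - \<nu> x + - (b1 g \<one> + \<nu> g))" for g x
  have t2: "GC.cocyc (carrier G) (\<lambda>g x. \<nu> (x \<otimes> g) - \<nu> x + - (b1 g \<one> + \<nu> g))"
    by (rule GC.cocyc_coboundary[OF h\<nu> order_refl, where e = "\<lambda>g. - (b1 g \<one> + \<nu> g)"])
  have b2: "GC.cocyc (carrier G) b2" unfolding b2_def by (rule GC.cocyc_add[OF b1 t2])
  have b2_one: "b2 g \<one> = 0" if "g \<in> carrier G" for g
    using that by (simp add: b2_def \<nu>1)
  have b2_S: "b2 s x = 0" if "s \<in> S" "x \<in> carrier G" for s x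
    using \<nu>S[OF that] by (simp add: b2_def algebra_simps)
  have k2: "k \<cdot> b2 g x = 0" if "g \<in> carrier G" "x \<in> carrier G" for g x
    using that k1[OF that(1)] k\<nu>
    by (simp add: b2_def ntimes_add_right ntimes_diff_right ntimes_minus_right)
  have b2D: "b2 (g \<otimes> h) x = b2 g x + b2 h (x \<otimes> g) - b2 h g"
    if "g \<in> carrier G" "h \<in> carrier G" "x \<in> carrier G" for g h x
    using GC.cocyc_eq[OF b2 that] that by (simp add: b2_one algebra_simps)
  have right: "b2 (g \<otimes> s) x = b2 g x" if "g \<in> carrier G" "s \<in> S" "x \<in> carrier G" for g s x
    using b2D[OF that(1) S_carrier[OF that(2)] that(3)] that by (simp add: b2_S)
  have left: "b2 (s \<otimes> g) x = b2 g x" if "g \<in> carrier G" "s \<in> S" "x \<in> carrier G" for g s x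
  proof -
    have "g \<otimes> (inv g \<otimes> s \<otimes> g) = s \<otimes> g"
      using that S_carrier by (simp add: G.m_assoc[symmetric])
    then show ?thesis using right[OF that(1) S.inv_op_closed1[OF that(1,2)] that(3)] by simp
  qed
  have add: "b2 g (x \<otimes> s) = b2 g x + b2 g s" if "g \<in> carrier G" "s \<in> S" "x \<in> carrier G" for g s x
    using b2D[OF S_carrier[OF that(2)] that(1,3)] left[OF that] that by (simp add: b2_S algebra_simps)
  \<comment> \<open>For fixed \<open>g\<close> the map sending \<open>s\<close> to
    \<open>b2 g s\<close> is additive on \<open>S\<close>; its values are killed both by
    \<open>card S\<close> and by \<open>k\<close>, which are coprime.\<close>
  have b2s: "b2 g s = 0" if g: "g \<in> carrier G" and s: "s \<in> S" for g s
  proof -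
    have "b2 g (s [^] (n::nat)) = n \<cdot> b2 g s" for n
    proof (induction n)
      case 0 show ?case by (simp add: b2_one g)
    next
      case (Suc n)
      then show ?case using add[OF g s, of "s [^] n"] S_carrier[OF s] by (simp add: add.commute)
    qed
    from this[of "card S"] have "card S \<cdot> b2 g s = 0"
      using G.pow_card_subgroup[OF S.subgroup_axioms finS s] by (simp add: b2_one g)
    then show ?thesis using ntimes_coprime_zero[OF cS] k2 g S_carrier[OF s] by blast
  qed
  define c where "c C x = b2 (rep C) x" for C x
  have c_eq: "c (S #> g) x = b2 g x" if "g \<in> carrier G" "x \<in> carrier G" for g x
    using rep_coset_eq[OF that(1)] left that by (metis c_def)
  have "QC.cocyc (carrier (G Mod S)) c"
  proof (rule QC.cocycI)
    fix C assume C: "C \<in> carrier (G Mod S)"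
    show "QC.hinv (c C)"
      unfolding QC_hinv_iff c_def
      using GC.cocyc_hinv[OF b2 rep_closed[OF C]] add[OF rep_closed[OF C]] b2s[OF rep_closed[OF C]] by simp
    fix D x assume D: "D \<in> carrier (G Mod S)" and x: "x \<in> carrier G"
    obtain g h where g: "g \<in> carrier G" "C = S #> g" and h: "h \<in> carrier G" "D = S #> h"
      using C D by (auto simp: carrier_Mod)
    have cD: "QC.hinv (c D)"
      unfolding QC_hinv_iff c_def
      using GC.cocyc_hinv[OF b2 rep_closed[OF D]] add[OF rep_closed[OF D]] b2s[OF rep_closed[OF D]] by simp
    have "c D (x \<otimes> rep C) = b2 h (x \<otimes> g)"
      using HS_hinv_rep[OF cD x g(1)] g h x by (simp add: c_eq)
    moreover have "c D (rep C) = b2 h g"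
      using HS_hinv_rep[OF cD G.one_closed g(1)] g h rep_closed[OF C] by (simp add: c_eq)
    moreover have "c (C \<otimes>\<^bsub>G Mod S\<^esub> D) y = b2 (g \<otimes> h) y" "c C y = b2 g y" if "y \<in> carrier G" for y
      using g h that by (simp_all add: S.rcos_sum c_eq)
    ultimately show "c C x + c D (x \<otimes> rep C) - c (C \<otimes>\<^bsub>G Mod S\<^esub> D) x =
        c C \<one> + c D (rep C) - c (C \<otimes>\<^bsub>G Mod S\<^esub> D) \<one>"
      using GC.cocyc_eq[OF b2 g(1) h(1) x] x by simp
  qed
  moreover have "GC.triv (carrier G) (\<lambda>g x. b g x - inflate c g x)"
  proof (rule GC.trivI)
    show "hinv (\<lambda>x. d (m x) - \<nu> x)" using hd h\<nu> by (simp add: hinv_def)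
    fix g x assume gx: "g \<in> carrier G" "x \<in> carrier G"
    show "b g x - inflate c g x = (d (m (x \<otimes> g)) - \<nu> (x \<otimes> g)) - (d (m x) - \<nu> x) + (d (e g) + (b1 g \<one> + \<nu> g))"
      using gx by (simp add: inflate_def c_eq b2_def b1_def algebra_simps)
  qed
  ultimately show ?thesis using that by blast
qed

end

section \<open>Isomorphisms and torsion parts of abelian groups\<close>

lemma iso_of_equal_kernels:
  assumes P: "group P" and A: "group A" and B: "group B"
    and f: "f \<in> hom P A" "f ` carrier P = carrier A"
    and g: "g \<in> hom P B" "g ` carrier P = carrier B"
    and eq: "\<And>x. x \<in> carrier P \<Longrightarrow> f x = \<one>\<^bsub>A\<^esub> \<longleftrightarrow> g x = \<one>\<^bsub>B\<^esub>"
  shows "A \<cong> B"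
proof -
  interpret f: group_hom P A f using P A f by (simp add: group_hom_def group_hom_axioms_def)
  interpret g: group_hom P B g using P B g by (simp add: group_hom_def group_hom_axioms_def)
  \<comment> \<open>Both targets are the quotient of \<open>P\<close> by this kernel, so no map
    between them has to be constructed.\<close>
  have "kernel P A f = kernel P B g" using eq by (auto simp: kernel_def)
  then have "P Mod kernel P A f \<cong> B" using g.FactGroup_iso[OF g(2)] by simp
  moreover have "A \<cong> P Mod kernel P A f"
    using f.FactGroup_iso[OF f(2)] group.iso_sym[OF normal.factorgroup_is_group[OF f.normal_kernel]] by blast
  ultimately show ?thesis using iso_trans by blast
qed

lemma comm_group_subset:
  assumes "comm_group A" "subgroup K A"
  shows "comm_group (A\<lparr>carrier := K\<rparr>)"
proof -
  interpret A: comm_group A by fact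
  show ?thesis
    by (rule group.group_comm_groupI[OF A.subgroup_imp_group[OF assms(2)]])
      (use subgroup.subset[OF assms(2)] in \<open>auto simp: A.m_comm subset_iff\<close>)
qed

lemma comm_group_primary_part:
  assumes "comm_group A"
  shows "comm_group (primary_part p A)"
proof -
  interpret A: comm_group A by fact
  show ?thesis
    unfolding primary_part_def
  proof (rule comm_group_subset[OF assms A.subgroupI])
    show "{x \<in> carrier A. \<exists>k. x [^]\<^bsub>A\<^esub> (p ^ k) = \<one>\<^bsub>A\<^esub>} \<noteq> {}" using A.one_closed A.nat_pow_one by blast
    fix a assume "a \<in> {x \<in> carrier A. \<exists>k. x [^]\<^bsub>A\<^esub> (p ^ k) = \<one>\<^bsub>A\<^esub>}"
    then obtain k where a: "a \<in> carrier A" "a [^]\<^bsub>A\<^esub> (p ^ k) = \<one>\<^bsub>A\<^esub>" by blast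
    show "inv\<^bsub>A\<^esub> a \<in> {x \<in> carrier A. \<exists>k. x [^]\<^bsub>A\<^esub> (p ^ k) = \<one>\<^bsub>A\<^esub>}"
      using a A.nat_pow_inv by fastforce
    fix b assume "b \<in> {x \<in> carrier A. \<exists>k. x [^]\<^bsub>A\<^esub> (p ^ k) = \<one>\<^bsub>A\<^esub>}"
    then obtain l where b: "b \<in> carrier A" "b [^]\<^bsub>A\<^esub> (p ^ l) = \<one>\<^bsub>A\<^esub>" by blast
    have "a [^]\<^bsub>A\<^esub> (p ^ (k + l)) = \<one>\<^bsub>A\<^esub>"
      using a by (simp add: power_add flip: A.nat_pow_pow)
    moreover have "b [^]\<^bsub>A\<^esub> (p ^ (k + l)) = \<one>\<^bsub>A\<^esub>"
      using b by (simp add: power_add mult.commute[of "p ^ k"] flip: A.nat_pow_pow)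
    ultimately have "(a \<otimes>\<^bsub>A\<^esub> b) [^]\<^bsub>A\<^esub> (p ^ (k + l)) = \<one>\<^bsub>A\<^esub>"
      using a b by (simp add: A.nat_pow_distrib)
    then show "a \<otimes>\<^bsub>A\<^esub> b \<in> {x \<in> carrier A. \<exists>k. x [^]\<^bsub>A\<^esub> (p ^ k) = \<one>\<^bsub>A\<^esub>}" using a b by blast
  qed auto
qed

lemma comm_group_prime_to_part:
  assumes "comm_group A"
  shows "comm_group (prime_to_part p A)"
proof -
  interpret A: comm_group A by fact
  let ?K = "{x \<in> carrier A. \<exists>m::nat. m > 0 \<and> coprime m p \<and> x [^]\<^bsub>A\<^esub> m = \<one>\<^bsub>A\<^esub>}"
  show ?thesis
    unfolding prime_to_part_def
  proof (rule comm_group_subset[OF assms A.subgroupI])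
    show "?K \<noteq> {}" using A.one_closed by (auto intro!: exI[of _ "\<one>\<^bsub>A\<^esub>"] exI[of _ 1])
    fix a assume "a \<in> ?K"
    then obtain k where a: "a \<in> carrier A" "k > 0" "coprime k p" "a [^]\<^bsub>A\<^esub> k = \<one>\<^bsub>A\<^esub>" by blast
    have "inv\<^bsub>A\<^esub> a [^]\<^bsub>A\<^esub> k = \<one>\<^bsub>A\<^esub>" using a by (simp add: A.nat_pow_inv)
    then show "inv\<^bsub>A\<^esub> a \<in> ?K" using a by blast
    fix b assume "b \<in> ?K"
    then obtain l where b: "b \<in> carrier A" "l > 0" "coprime l p" "b [^]\<^bsub>A\<^esub> l = \<one>\<^bsub>A\<^esub>" by blast
    have "a [^]\<^bsub>A\<^esub> (k * l) = \<one>\<^bsub>A\<^esub>" using a by (simp flip: A.nat_pow_pow)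
    moreover have "b [^]\<^bsub>A\<^esub> (k * l) = \<one>\<^bsub>A\<^esub>"
      using b by (simp add: mult.commute[of k] flip: A.nat_pow_pow)
    ultimately have "(a \<otimes>\<^bsub>A\<^esub> b) [^]\<^bsub>A\<^esub> (k * l) = \<one>\<^bsub>A\<^esub>"
      using a b by (simp add: A.nat_pow_distrib)
    moreover have "0 < k * l" "coprime (k * l) p" using a b by auto
    ultimately show "a \<otimes>\<^bsub>A\<^esub> b \<in> ?K" using a b by blast
  qed auto
qed

section \<open>Locally trivial classes as images of groups of cocycles\<close>

context coset_cohomology
begin

lemma Phi_eqI:
  assumes b: "cocyc (carrier Q) b" and c: "cocyc (carrier Q) c"
    and t: "triv (carrier Q) (\<lambda>\<gamma> x. b \<gamma> x - c \<gamma> x)"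
  shows "\<Phi> b = \<Phi> c"
proof -
  interpret H2: comm_group "H2 Q (J G H) act" by (rule M.comm_group_H2)
  have "\<Phi> (\<lambda>\<gamma> x. b \<gamma> x - c \<gamma> x) = \<one>\<^bsub>H2 Q (J G H) act\<^esub>"
    using Phi_one_iff[OF cocyc_diff[OF b c]] t by simp
  moreover have "\<Phi> b = \<Phi> (\<lambda>\<gamma> x. (b \<gamma> x - c \<gamma> x) + c \<gamma> x)" by simp
  ultimately show ?thesis
    using Phi_add[OF cocyc_diff[OF b c] c] Phi_closed[OF c] by simp
qed

text \<open>Locally trivial cocycles before passage to classes. Over the quotient this is the common
  source that maps onto both sides of the isomorphism for the prime-to-\<open>p\<close>
  part.\<close>

definition cocyc_group :: "'c set set \<Rightarrow> ('c \<Rightarrow> 'a \<Rightarrow> circle) monoid" where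
  "cocyc_group \<D> = \<lparr>carrier = {b. cocyc (carrier Q) b \<and> (\<forall>D\<in>\<D>. triv D b)},
     monoid.mult = (\<lambda>b c \<gamma> x. b \<gamma> x + c \<gamma> x), one = (\<lambda>_ _. 0)\<rparr>"

lemma group_cocyc_group: "group (cocyc_group \<D>)"
proof (rule groupI)
  fix b assume b: "b \<in> carrier (cocyc_group \<D>)"
  show "\<exists>c\<in>carrier (cocyc_group \<D>). c \<otimes>\<^bsub>cocyc_group \<D>\<^esub> b = \<one>\<^bsub>cocyc_group \<D>\<^esub>"
  proof (rule bexI[of _ "\<lambda>\<gamma> x. 0 - b \<gamma> x"])
    show "(\<lambda>\<gamma> x. 0 - b \<gamma> x) \<in> carrier (cocyc_group \<D>)"
    proof -
      have "cocyc (carrier Q) (\<lambda>\<gamma> x. 0 - b \<gamma> x)"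
        by (rule cocyc_diff[OF cocyc_zero]) (use b in \<open>simp add: cocyc_group_def\<close>)
      moreover have "triv D (\<lambda>\<gamma> x. 0 - b \<gamma> x)" if "D \<in> \<D>" for D
        by (rule triv_diff[OF triv_zero]) (use b that in \<open>simp add: cocyc_group_def\<close>)
      ultimately show ?thesis by (simp add: cocyc_group_def)
    qed
  qed (simp add: cocyc_group_def)
qed (auto simp: cocyc_group_def cocyc_zero triv_zero add_ac intro: cocyc_add triv_add)

text \<open>The subgroup property is read off from the image of the homomorphism
  \<open>\<Phi>\<close>; the restriction maps themselves need not be shown to be
  homomorphisms.\<close>

lemma subgroup_Sha2:
  assumes "finite \<D>" "\<And>D. D \<in> \<D> \<Longrightarrow> subgroup D Q"
  shows "subgroup (carrier (Sha2 Q \<D> (J G H) act)) (H2 Q (J G H) act)"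
    and "\<Phi> ` carrier (cocyc_group \<D>) = carrier (Sha2 Q \<D> (J G H) act)"
proof -
  interpret H2: comm_group "H2 Q (J G H) act" by (rule M.comm_group_H2)
  have sub: "carrier (Sha2 Q \<D> (J G H) act) \<subseteq> carrier (H2 Q (J G H) act)"
    by (auto simp: Sha2_def kernel_def)
  show im: "\<Phi> ` carrier (cocyc_group \<D>) = carrier (Sha2 Q \<D> (J G H) act)"
  proof
    show "\<Phi> ` carrier (cocyc_group \<D>) \<subseteq> carrier (Sha2 Q \<D> (J G H) act)"
      using Phi_Sha2_iff[OF assms] by (auto simp: cocyc_group_def)
    show "carrier (Sha2 Q \<D> (J G H) act) \<subseteq> \<Phi> ` carrier (cocyc_group \<D>)"
    proof
      fix y assume y: "y \<in> carrier (Sha2 Q \<D> (J G H) act)"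
      then obtain b where "cocyc (carrier Q) b" "y = \<Phi> b" using sub Phi_surj by blast
      then show "y \<in> \<Phi> ` carrier (cocyc_group \<D>)"
        using Phi_Sha2_iff[OF assms] y by (auto simp: cocyc_group_def)
    qed
  qed
  interpret h: group_hom "cocyc_group \<D>" "H2 Q (J G H) act" \<Phi>
    using group_cocyc_group Phi_closed Phi_add
    by (auto simp: group_hom_def group_hom_axioms_def H2.is_group hom_def cocyc_group_def)
  show "subgroup (carrier (Sha2 Q \<D> (J G H) act)) (H2 Q (J G H) act)"
    using h.img_is_subgroup by (simp add: im)
qed

lemma Sha2_eq: "Sha2 Q \<D> (J G H) act = (H2 Q (J G H) act)\<lparr>carrier := carrier (Sha2 Q \<D> (J G H) act)\<rparr>"
  by (simp add: Sha2_def)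

lemma comm_group_Sha2:
  assumes "finite \<D>" "\<And>D. D \<in> \<D> \<Longrightarrow> subgroup D Q"
  shows "comm_group (Sha2 Q \<D> (J G H) act)"
  using comm_group_subset[OF M.comm_group_H2 subgroup_Sha2(1)[OF assms]] Sha2_eq by metis

lemma Sha2_simps:
  "\<one>\<^bsub>Sha2 Q \<D> (J G H) act\<^esub> = \<one>\<^bsub>H2 Q (J G H) act\<^esub>"
  "x \<otimes>\<^bsub>Sha2 Q \<D> (J G H) act\<^esub> y = x \<otimes>\<^bsub>H2 Q (J G H) act\<^esub> y"
  "x [^]\<^bsub>Sha2 Q \<D> (J G H) act\<^esub> (n::nat) = x [^]\<^bsub>H2 Q (J G H) act\<^esub> n"
  by (simp_all add: Sha2_def nat_pow_def)

end

section \<open>The part prime to p\<close>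

context normal_sylow
begin

lemma quotient_subgroups_eq:
  assumes "\<And>D. D \<in> \<D> \<Longrightarrow> subgroup D G"
  shows "quotient_subgroups G S \<D> = (\<lambda>D. (\<lambda>g. S #> g) ` D) ` \<D>"
  unfolding quotient_subgroups_def
proof (rule image_cong[OF refl])
  fix D assume "D \<in> \<D>"
  then have D: "subgroup D G" using assms by blast
  have DG: "g \<in> carrier G" if "g \<in> D" for g using that subgroup.subset[OF D] by blast
  have "S #> (d \<otimes> s) = S #> d" if d: "d \<in> D" and s: "s \<in> S" for d s
  proof -
    have "d \<otimes> s = (d \<otimes> s \<otimes> inv d) \<otimes> d" using DG[OF d] S_carrier[OF s] by (simp add: G.m_assoc)
    moreover have "d \<otimes> s \<otimes> inv d \<in> S" using S.inv_op_closed2 DG[OF d] s by blast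
    ultimately have "d \<otimes> s \<in> S #> d" by (auto simp: r_coset_def)
    then show ?thesis using G.repr_independence[OF _ DG[OF d] S.subgroup_axioms] by simp
  qed
  then have "(\<lambda>g. S #> g) ` (D <#> S) \<subseteq> (\<lambda>g. S #> g) ` D"
    by (auto simp: set_mult_def)
  moreover have "D \<subseteq> D <#> S"
  proof
    fix d assume d: "d \<in> D"
    then have "d \<otimes> \<one> \<in> D <#> S"
      using subgroup.one_closed[OF S.subgroup_axioms] unfolding set_mult_def by blast
    then show "d \<in> D <#> S" using DG[OF d] by simp
  qed
  ultimately have "(\<lambda>g. S #> g) ` (D <#> S) = (\<lambda>g. S #> g) ` D" by blast
  then show "carrier (G\<lparr>carrier := D <#> S\<rparr> Mod S) = (\<lambda>g. S #> g) ` D"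
    unfolding FactGroup_def RCOSETS_def by (simp add: UNION_singleton_eq_range)
qed

text \<open>Locally trivial cocycles of the quotient map onto its locally trivial classes, and by
  inflation onto the prime-to-\<open>p\<close> classes of \<open>G\<close>. Inflation preserves and
  reflects triviality on every subgroup, so both maps have the same kernel.\<close>

theorem prime_to_part_Sha2:
  assumes "admissible G \<D>"
  shows "prime_to_part p (Sha2 G \<D> (J G H) (J_act G))
     \<cong> Sha2 (G Mod S) (quotient_subgroups G S \<D>) (J G (H <#> S)) (quotient_act (J_act G))"
proof -
  have fin: "finite \<D>" and D: "\<And>D. D \<in> \<D> \<Longrightarrow> subgroup D G" using assms by (auto simp: admissible_def)
  note qs = quotient_subgroups_eq[OF D]
  have fin': "finite (quotient_subgroups G S \<D>)" using fin by (simp add: quotient_subgroups_def)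
  have D': "subgroup E (G Mod S)" if "E \<in> quotient_subgroups G S \<D>" for E
    using that D subgroup_image_Mod by (auto simp: qs)
  let ?A = "prime_to_part p (Sha2 G \<D> (J G H) (J_act G))"
  let ?B = "Sha2 (G Mod S) (quotient_subgroups G S \<D>) (J G (H <#> S)) (quotient_act (J_act G))"
  let ?P = "QC.cocyc_group (quotient_subgroups G S \<D>)"
  have P: "b \<in> carrier ?P \<longleftrightarrow> QC.cocyc (carrier (G Mod S)) b \<and> (\<forall>D\<in>\<D>. GC.triv D (inflate b))" for b
    using triv_inflate_iff D by (auto simp: QC.cocyc_group_def qs)
  have imG: "(\<lambda>g. S #> g) ` carrier G = carrier (G Mod S)" by (simp add: carrier_Mod)
  have triv_G: "GC.triv (carrier G) (inflate b) \<longleftrightarrow> QC.triv (carrier (G Mod S)) b"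
    if "QC.cocyc (carrier (G Mod S)) b" for b
    using triv_inflate_iff[OF that G.subgroup_self] by (simp add: imG)
  interpret H2: comm_group "H2 G (J G H) (J_act G)" by (rule GC.M.comm_group_H2)
  have gB: "group ?B" using QC.comm_group_Sha2[OF fin' D'] by (simp add: comm_group_def)
  have gA: "group ?A"
    using comm_group_prime_to_part[OF GC.comm_group_Sha2[OF fin D]] by (simp add: comm_group_def)
  have inA: "GC.\<Phi> (inflate b) \<in> carrier ?A" if b: "b \<in> carrier ?P" for b
  proof -
    have c: "QC.cocyc (carrier (G Mod S)) b" using b P by blast
    note ci = cocyc_inflate[OF c]
    have "GC.\<Phi> (inflate b) \<in> carrier (Sha2 G \<D> (J G H) (J_act G))"
      using GC.Phi_Sha2_iff[OF fin D ci] b P by blast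
    \<comment> \<open>The order of the quotient annihilates its classes and is prime to
      \<open>p\<close>; this places inflated classes in the prime-to-\<open>p\<close> part.\<close>
    moreover have "GC.\<Phi> (inflate b) [^]\<^bsub>H2 G (J G H) (J_act G)\<^esub> card (carrier (G Mod S)) = \<one>\<^bsub>H2 G (J G H) (J_act G)\<^esub>"
    proof -
      let ?n = "card (carrier (G Mod S))"
      have "QC.triv (carrier (G Mod S)) (\<lambda>\<gamma> x. ?n \<cdot> b \<gamma> x)"
        by (rule QC.triv_card[OF QC.Q.subgroup_self c])
      then have "GC.triv (carrier G) (inflate (\<lambda>\<gamma> x. ?n \<cdot> b \<gamma> x))"
        using triv_G[OF QC.cocyc_ntimes[OF c]] by simp
      moreover have "inflate (\<lambda>\<gamma> x. ?n \<cdot> b \<gamma> x) = (\<lambda>g x. ?n \<cdot> inflate b g x)"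
        by (intro ext) (simp add: inflate_def)
      ultimately show ?thesis
        using GC.Phi_one_iff[OF GC.cocyc_ntimes[OF ci]] GC.Phi_pow[OF ci] by simp
    qed
    moreover have "coprime (card (carrier (G Mod S))) p"
      by (rule card_Mod_dvd[OF QC.Q.subgroup_self])
    moreover have "0 < card (carrier (G Mod S))"
      using finite_Mod QC.Q.one_closed card_gt_0_iff by blast
    ultimately show ?thesis
      unfolding prime_to_part_def by (auto simp: GC.Sha2_simps)
  qed
  have hom: "(\<lambda>b. GC.\<Phi> (inflate b)) \<in> hom ?P ?A"
  proof (rule homI[OF inA])
    fix b c assume "b \<in> carrier ?P" "c \<in> carrier ?P"
    then have "GC.cocyc (carrier G) (inflate b)" "GC.cocyc (carrier G) (inflate c)"
      using P cocyc_inflate by blast+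
    from GC.Phi_add[OF this]
    show "GC.\<Phi> (inflate (b \<otimes>\<^bsub>?P\<^esub> c)) = GC.\<Phi> (inflate b) \<otimes>\<^bsub>?A\<^esub> GC.\<Phi> (inflate c)"
      by (simp add: QC.cocyc_group_def inflate_def[abs_def] prime_to_part_def GC.Sha2_simps)
  qed
  have surj: "(\<lambda>b. GC.\<Phi> (inflate b)) ` carrier ?P = carrier ?A"
  proof
    show "(\<lambda>b. GC.\<Phi> (inflate b)) ` carrier ?P \<subseteq> carrier ?A" using inA by blast
    show "carrier ?A \<subseteq> (\<lambda>b. GC.\<Phi> (inflate b)) ` carrier ?P"
    proof
      fix y assume "y \<in> carrier ?A"
      then obtain k :: nat where y: "y \<in> carrier (Sha2 G \<D> (J G H) (J_act G))"
        and k: "0 < k" "coprime k p" "y [^]\<^bsub>H2 G (J G H) (J_act G)\<^esub> k = \<one>\<^bsub>H2 G (J G H) (J_act G)\<^esub>"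
        by (auto simp: prime_to_part_def GC.Sha2_simps)
      obtain b where b: "GC.cocyc (carrier G) b" "y = GC.\<Phi> b"
        using y subgroup.subset[OF GC.subgroup_Sha2(1)[OF fin D]] GC.Phi_surj by blast
      have "GC.triv (carrier G) (\<lambda>g x. k \<cdot> b g x)"
        using k(3) GC.Phi_one_iff[OF GC.cocyc_ntimes[OF b(1)]] GC.Phi_pow[OF b(1)] b(2) by simp
      then obtain c where c: "QC.cocyc (carrier (G Mod S)) c" "GC.triv (carrier G) (\<lambda>g x. b g x - inflate c g x)"
        using inflate_surj[OF b(1) k(1,2)] by blast
      have "y = GC.\<Phi> (inflate c)" using GC.Phi_eqI[OF b(1) cocyc_inflate[OF c(1)] c(2)] b(2) by simp
      moreover have "c \<in> carrier ?P"
        using P c(1) GC.Phi_Sha2_iff[OF fin D cocyc_inflate[OF c(1)]] y calculation by simp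
      ultimately show "y \<in> (\<lambda>b. GC.\<Phi> (inflate b)) ` carrier ?P" by blast
    qed
  qed
  have "QC.\<Phi> \<in> hom ?P ?B"
    using QC.subgroup_Sha2(2)[OF fin' D'] QC.Phi_add
    by (auto simp: hom_def QC.cocyc_group_def QC.Sha2_simps)
  from iso_of_equal_kernels[OF QC.group_cocyc_group gA gB hom surj this QC.subgroup_Sha2(2)[OF fin' D']]
  show ?thesis
    using GC.Phi_one_iff[OF cocyc_inflate] QC.Phi_one_iff triv_G P
    by (auto simp: prime_to_part_def GC.Sha2_simps QC.Sha2_simps)
qed

end

section \<open>Subgroups of index p in a p-group\<close>

lemma card_image_eq:
  assumes "\<And>x y. \<lbrakk>x \<in> A; y \<in> A\<rbrakk> \<Longrightarrow> f x = f y \<longleftrightarrow> g x = g y"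
  shows "card (f ` A) = card (g ` A)"
proof -
  have "bij_betw (\<lambda>z. g (inv_into A f z)) (f ` A) (g ` A)"
    unfolding bij_betw_def
  proof
    have *: "g (inv_into A f (f x)) = g x" if "x \<in> A" for x
      using assms that by (metis f_inv_into_f imageI inv_into_into)
    show "inj_on (\<lambda>z. g (inv_into A f z)) (f ` A)"
      using assms by (auto simp: inj_on_def *)
    show "(\<lambda>z. g (inv_into A f z)) ` f ` A = g ` A" using * by (auto simp: image_iff)
  qed
  then show ?thesis by (rule bij_betw_same_card)
qed

context group
begin

lemma pow_in_subgroup: "\<lbrakk>subgroup K G; k \<in> K\<rbrakk> \<Longrightarrow> k [^] (n::nat) \<in> K"
  by (induction n) (auto simp: subgroup.one_closed subgroup.m_closed)

text \<open>The order of \<open>t\<close> divides \<open>card S\<close>, so an exponent prime to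
  \<open>card S\<close> can be inverted and \<open>t\<close> is a power of
  \<open>t [^] j\<close>.\<close>

lemma root_in_subgroup:
  assumes S: "subgroup S G" "finite S" and K: "subgroup K G" and t: "t \<in> S"
    and j: "t [^] (j::nat) \<in> K" "0 < j" "coprime j (card S)"
  shows "t \<in> K"
proof -
  have tG: "t \<in> carrier G" using subgroup.subset[OF S(1)] t by blast
  obtain u v where uv: "u * j = v * card S + 1" using coprime_bezout_nat[OF j(3,2)] .
  have "t [^] (u * j) \<in> K"
    using pow_in_subgroup[OF K j(1), of u] tG by (simp add: nat_pow_pow mult.commute)
  moreover have "t [^] (u * j) = t"
  proof -
    have "t [^] (v * card S) = \<one>"
      using pow_card_subgroup[OF S t] tG by (simp add: mult.commute[of v] flip: nat_pow_pow)
    then show ?thesis unfolding uv using tG by (simp flip: nat_pow_mult)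
  qed
  ultimately show ?thesis by simp
qed

context
  fixes S p e
  assumes S: "subgroup S G" "finite S" and p: "prime (p::nat)" and pS: "card S = p ^ e"
begin

lemma S_in_G: "s \<in> S \<Longrightarrow> s \<in> carrier G"
  using subgroup.subset[OF S(1)] by blast

lemma p_root_in_subgroup:
  assumes "subgroup K G" "t \<in> S" "t [^] (j::nat) \<in> K" "\<not> p dvd j"
  shows "t \<in> K"
proof -
  have "coprime j p" using prime_imp_coprime[OF p assms(4)] by (simp add: coprime_commute)
  then have "coprime j (card S)" by (simp add: pS)
  moreover have "0 < j" using assms(4) by (cases j) auto
  ultimately show ?thesis using root_in_subgroup[OF S assms(1-3)] by blast
qed

text \<open>The cosets of \<open>K\<close> represented by the first \<open>p\<close> powers of
  \<open>t\<close> are distinct, since a coincidence would put a power of \<open>t\<close> with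
  exponent prime to \<open>p\<close>, hence \<open>t\<close> itself, into \<open>K\<close>. There
  are only \<open>p\<close> cosets, so the one of \<open>inv u\<close> is among them.\<close>

lemma index_p_power_meets:
  assumes K: "subgroup K G" "K \<subseteq> S" "card S = p * card K" and t: "t \<in> S" "t \<notin> K" and u: "u \<in> S"
  obtains i where "i < p" "t [^] (i::nat) \<otimes> u \<in> K"
proof -
  let ?c = "\<lambda>k. K #> k"
  have finK: "finite K" using finite_subset[OF K(2) S(2)] .
  have "card K > 0" using finK subgroup.one_closed[OF K(1)] by (auto simp: card_gt_0_iff)
  moreover have "card (?c ` S) * card K = card S"
    using card_transv[OF K(1) S(1) K(2) S(2)] by (simp add: transv_def card_image[OF inj_rep[OF K(1) S(1) K(2)]])
  ultimately have card: "card (?c ` S) = p" using K(3) by (metis mult_cancel2 less_nat_zero_code)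
  have tp: "t [^] (i::nat) \<in> S" for i using pow_in_subgroup[OF S(1) t(1)] .
  have tG: "t \<in> carrier G" using S_in_G t by blast
  have inj: "inj_on (\<lambda>i. ?c (t [^] (i::nat))) {..<p}"
  proof (rule linorder_inj_onI)
    fix i j :: nat assume ij: "i < j" "i \<in> {..<p}" "j \<in> {..<p}"
    show "?c (t [^] i) \<noteq> ?c (t [^] j)"
    proof
      assume "?c (t [^] i) = ?c (t [^] j)"
      then have "t [^] j \<in> ?c (t [^] i)"
        using rcos_self[OF S_in_G[OF tp] K(1)] by simp
      then obtain k where k: "k \<in> K" "t [^] j = k \<otimes> t [^] i" by (auto simp: r_coset_def)
      have kG: "k \<in> carrier G" using k K S_in_G by blast
      have "t [^] (j - i) \<otimes> t [^] i = k \<otimes> t [^] i"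
        using k ij tG by (simp add: nat_pow_mult)
      then have "t [^] (j - i) = k" using tG kG by simp
      then have "t [^] (j - i) \<in> K" using k by simp
      moreover have "\<not> p dvd (j - i)" using ij by (auto dest: dvd_imp_le)
      ultimately show False using p_root_in_subgroup[OF K(1) t(1)] t(2) by blast
    qed
  qed auto
  have "(\<lambda>i. ?c (t [^] (i::nat))) ` {..<p} = ?c ` S"
  proof (rule card_subset_eq)
    show "finite (?c ` S)" using S(2) by blast
    show "(\<lambda>i. ?c (t [^] (i::nat))) ` {..<p} \<subseteq> ?c ` S" using tp by blast
    show "card ((\<lambda>i. ?c (t [^] (i::nat))) ` {..<p}) = card (?c ` S)"
      using card_image[OF inj] card by simp
  qed
  moreover have "inv u \<in> S" using subgroup.m_inv_closed[OF S(1) u] .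
  ultimately have "?c (inv u) \<in> (\<lambda>i. ?c (t [^] (i::nat))) ` {..<p}" by blast
  then obtain i where i: "i < p" "?c (inv u) = ?c (t [^] i)" by auto
  then have "t [^] i \<in> ?c (inv u)" using rcos_self[OF S_in_G[OF tp] K(1)] by simp
  then obtain k where k: "k \<in> K" "t [^] i = k \<otimes> inv u" by (auto simp: r_coset_def)
  have "k \<in> carrier G" using k(1) K(2) S_in_G by blast
  then have "t [^] i \<otimes> u = k" using S_in_G[OF u] by (simp add: k(2) m_assoc)
  then show ?thesis using that i(1) k(1) by blast
qed

text \<open>Let \<open>L\<close> be the conjugate of \<open>K\<close> by \<open>s\<close>, again of
  index \<open>p\<close>. If \<open>k\<close> were outside \<open>L\<close>, some
  \<open>k [^] i \<otimes> s\<close> would lie in \<open>L\<close>; this says that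
  \<open>s \<otimes> k [^] i\<close> lies in \<open>K\<close>, and then so does
  \<open>s\<close>.\<close>

lemma index_p_normal:
  assumes K: "subgroup K G" "K \<subseteq> S" "card S = p * card K" and k: "k \<in> K" and s: "s \<in> S"
  shows "s \<otimes> k \<otimes> inv s \<in> K"
proof (cases "s \<in> K")
  case True
  then show ?thesis using k subgroup.m_closed[OF K(1)] subgroup.m_inv_closed[OF K(1)] by simp
next
  case False
  have sG: "s \<in> carrier G" using S_in_G s by blast
  have KG: "k \<in> carrier G" if "k \<in> K" for k using K S_in_G that by blast
  let ?L = "(\<lambda>k. inv s \<otimes> k \<otimes> s) ` K"
  have mem: "x \<in> ?L \<longleftrightarrow> x \<in> carrier G \<and> s \<otimes> x \<otimes> inv s \<in> K" for x
  proof
    assume "x \<in> ?L"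
    then obtain k where "k \<in> K" "x = inv s \<otimes> k \<otimes> s" by blast
    moreover have "s \<otimes> (inv s \<otimes> k \<otimes> s) \<otimes> inv s = k"
      using sG KG[OF \<open>k \<in> K\<close>] by (simp add: m_assoc) (simp add: m_assoc[symmetric])
    ultimately show "x \<in> carrier G \<and> s \<otimes> x \<otimes> inv s \<in> K" using sG KG by simp
  next
    assume x: "x \<in> carrier G \<and> s \<otimes> x \<otimes> inv s \<in> K"
    have "x = inv s \<otimes> (s \<otimes> x \<otimes> inv s) \<otimes> s"
      using sG x by (simp add: m_assoc) (simp add: m_assoc[symmetric])
    then show "x \<in> ?L" using x by blast
  qed
  have conj_mult: "s \<otimes> (x \<otimes> y) \<otimes> inv s = (s \<otimes> x \<otimes> inv s) \<otimes> (s \<otimes> y \<otimes> inv s)"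
    if "x \<in> carrier G" "y \<in> carrier G" for x y
  proof -
    have "inv s \<otimes> (s \<otimes> (y \<otimes> inv s)) = y \<otimes> inv s" using that sG by (simp add: m_assoc[symmetric])
    then show ?thesis using that sG by (simp add: m_assoc)
  qed
  have L: "subgroup ?L G"
  proof (rule subgroupI)
    show "?L \<subseteq> carrier G" using KG sG by auto
    show "?L \<noteq> {}" using subgroup.one_closed[OF K(1)] by blast
    show "x \<otimes> y \<in> ?L" if "x \<in> ?L" "y \<in> ?L" for x y
      using that subgroup.m_closed[OF K(1)] unfolding mem by (simp add: conj_mult)
    show "inv x \<in> ?L" if "x \<in> ?L" for x
    proof -
      have "s \<otimes> inv x \<otimes> inv s = inv (s \<otimes> x \<otimes> inv s)"
        using that sG unfolding mem by (simp add: inv_mult_group m_assoc)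
      then show ?thesis using that subgroup.m_inv_closed[OF K(1)] unfolding mem by simp
    qed
  qed
  have LS: "?L \<subseteq> S"
    using s subgroup.m_closed[OF S(1)] subgroup.m_inv_closed[OF S(1)] K(2) by auto
  have "inj_on (\<lambda>k. inv s \<otimes> k \<otimes> s) K"
    using KG sG by (auto simp: inj_on_def)
  then have "card ?L = card K" by (rule card_image)
  then have cL: "card S = p * card ?L" using K(3) by simp
  show ?thesis
  proof (rule ccontr)
    assume "s \<otimes> k \<otimes> inv s \<notin> K"
    then have "k \<notin> ?L" unfolding mem by blast
    then obtain i where "k [^] (i::nat) \<otimes> s \<in> ?L"
      using index_p_power_meets[OF L LS cL _ _ s] k K(2) by blast
    then have "s \<otimes> (k [^] i \<otimes> s) \<otimes> inv s \<in> K" unfolding mem by blast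
    then have "s \<otimes> k [^] i \<in> K" using sG KG[OF k] by (simp add: m_assoc)
    then have "s \<otimes> k [^] i \<otimes> inv (k [^] i) \<in> K"
      using pow_in_subgroup[OF K(1) k] subgroup.m_inv_closed[OF K(1)] subgroup.m_closed[OF K(1)] by blast
    then show False using False sG KG[OF k] by (simp add: m_assoc)
  qed
qed

text \<open>The coset argument with \<open>u = s [^] p\<close> gives \<open>s [^] (i + p)\<close> in
  \<open>K\<close> with \<open>i < p\<close>. For \<open>s\<close> outside \<open>K\<close> the
  exponent is divisible by \<open>p\<close>, which leaves \<open>i = 0\<close>.\<close>

lemma index_p_pow:
  assumes K: "subgroup K G" "K \<subseteq> S" "card S = p * card K" and s: "s \<in> S"
  shows "s [^] p \<in> K"
proof (cases "s \<in> K")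
  case True
  then show ?thesis using pow_in_subgroup[OF K(1)] by blast
next
  case False
  have sG: "s \<in> carrier G" using S_in_G s by blast
  obtain i where i: "i < p" "s [^] i \<otimes> s [^] p \<in> K"
    using index_p_power_meets[OF K s False pow_in_subgroup[OF S(1) s]] by blast
  then have "s [^] (i + p) \<in> K" using sG by (simp add: nat_pow_mult)
  then have "p dvd i + p" using p_root_in_subgroup[OF K(1) s] False by blast
  then have "i = 0" using i(1) by (auto simp: dvd_add_left_iff dest: dvd_imp_le)
  then show ?thesis using i(2) sG by simp
qed

text \<open>For \<open>a\<close> outside \<open>K\<close>, a power of \<open>a\<close> carries
  \<open>b\<close> into \<open>K\<close>. Powers of \<open>a\<close> commute with \<open>a\<close>,
  so the commutator of \<open>a\<close> and \<open>b\<close> is a conjugate of that of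
  \<open>a\<close> and an element of the normal subgroup \<open>K\<close>.\<close>

lemma index_p_commutator:
  assumes K: "subgroup K G" "K \<subseteq> S" "card S = p * card K" and a: "a \<in> S" and b: "b \<in> S"
  shows "a \<otimes> b \<otimes> inv a \<otimes> inv b \<in> K"
proof (cases "a \<in> K")
  case True
  have "b \<otimes> inv a \<otimes> inv b \<in> K"
    using index_p_normal[OF K subgroup.m_inv_closed[OF K(1) True] b] .
  then have "a \<otimes> (b \<otimes> inv a \<otimes> inv b) \<in> K" using subgroup.m_closed[OF K(1) True] by blast
  then show ?thesis using S_in_G[OF a] S_in_G[OF b] by (simp add: m_assoc)
next
  case False
  have aG: "a \<in> carrier G" and bG: "b \<in> carrier G" using a b S_in_G by auto
  obtain i where i: "a [^] (i::nat) \<otimes> b \<in> K"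
    using index_p_power_meets[OF K a False b] by blast
  let ?k = "a [^] i \<otimes> b" and ?c = "a [^] i"
  have kG: "?k \<in> carrier G" using aG bG by simp
  have bk: "b = inv ?c \<otimes> ?k" using aG bG by (simp add: m_assoc[symmetric])
  have "a \<otimes> ?k \<otimes> inv a \<in> K" using index_p_normal[OF K i a] .
  then have "a \<otimes> ?k \<otimes> inv a \<otimes> inv ?k \<in> K"
    using subgroup.m_closed[OF K(1)] subgroup.m_inv_closed[OF K(1) i] by blast
  moreover have "inv ?c \<in> S" using subgroup.m_inv_closed[OF S(1) pow_in_subgroup[OF S(1) a]] .
  ultimately have "inv ?c \<otimes> (a \<otimes> ?k \<otimes> inv a \<otimes> inv ?k) \<otimes> inv (inv ?c) \<in> K"
    using index_p_normal[OF K] by blast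
  moreover have "inv ?c \<otimes> (a \<otimes> ?k \<otimes> inv a \<otimes> inv ?k) \<otimes> inv (inv ?c) = a \<otimes> b \<otimes> inv a \<otimes> inv b"
  proof -
    have com: "inv ?c \<otimes> a = a \<otimes> inv ?c"
    proof -
      have "a \<otimes> ?c = ?c \<otimes> a" using aG by (metis nat_pow_Suc nat_pow_Suc2)
      moreover have "inv ?c \<otimes> (a \<otimes> ?c) \<otimes> inv ?c = inv ?c \<otimes> a" using aG by (simp add: m_assoc)
      moreover have "inv ?c \<otimes> (?c \<otimes> a) \<otimes> inv ?c = a \<otimes> inv ?c" using aG by (simp add: m_assoc[symmetric])
      ultimately show ?thesis by simp
    qed
    have invk: "inv ?k = inv b \<otimes> inv ?c" using aG bG by (simp add: inv_mult_group)
    have "inv ?c \<otimes> (a \<otimes> ?k \<otimes> inv a \<otimes> inv ?k) \<otimes> ?c = (inv ?c \<otimes> a) \<otimes> ?k \<otimes> inv a \<otimes> inv b \<otimes> inv ?c \<otimes> ?c"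
      unfolding invk using aG bG by (simp add: m_assoc)
    also have "\<dots> = a \<otimes> (inv ?c \<otimes> ?k) \<otimes> inv a \<otimes> inv b \<otimes> (inv ?c \<otimes> ?c)"
      unfolding com using aG bG by (simp add: m_assoc)
    also have "\<dots> = a \<otimes> b \<otimes> inv a \<otimes> inv b" using aG bG by (simp add: bk[symmetric])
    finally show ?thesis using aG by simp
  qed
  ultimately show ?thesis by simp
qed

end

end

lemma (in group) conj_eq_iff:
  assumes "x \<in> carrier G" "a \<in> carrier G" "b \<in> carrier G"
  shows "x \<otimes> a \<otimes> inv x = b \<longleftrightarrow> x \<otimes> a = b \<otimes> x" "inv x \<otimes> a \<otimes> x = b \<longleftrightarrow> a \<otimes> x = x \<otimes> b"
proof -
  show "x \<otimes> a \<otimes> inv x = b \<longleftrightarrow> x \<otimes> a = b \<otimes> x"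
    using assms by (metis inv_solve_right m_closed)
  show "inv x \<otimes> a \<otimes> x = b \<longleftrightarrow> a \<otimes> x = x \<otimes> b"
    using assms by (metis inv_solve_left m_assoc m_closed inv_closed)
qed

section \<open>Stabilisers of cosets inside the Sylow subgroup\<close>

context normal_sylow
begin

text \<open>The stabiliser in \<open>S\<close> of the right coset of \<open>x\<close> modulo
  \<open>H\<close>, under multiplication from the right.\<close>

definition stab :: "'a \<Rightarrow> 'a set" where
  "stab x = {s \<in> S. x \<otimes> s \<otimes> inv x \<in> H}"

lemma stab_subset: "stab x \<subseteq> S"
  by (auto simp: stab_def)

lemma stab_one: "stab \<one> = S \<inter> H"
proof -
  have "\<one> \<otimes> s \<otimes> inv \<one> = s" if "s \<in> S" for s using S_carrier[OF that] by simp
  then show ?thesis unfolding stab_def by fastforce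
qed

lemma conj_mult:
  assumes "x \<in> carrier G" "a \<in> carrier G" "b \<in> carrier G"
  shows "x \<otimes> (a \<otimes> b) \<otimes> inv x = (x \<otimes> a \<otimes> inv x) \<otimes> (x \<otimes> b \<otimes> inv x)"
proof -
  have "inv x \<otimes> (x \<otimes> (b \<otimes> inv x)) = b \<otimes> inv x" using assms by (simp add: G.m_assoc[symmetric])
  then show ?thesis using assms by (simp add: G.m_assoc)
qed

lemma conj_inv:
  assumes "x \<in> carrier G" "a \<in> carrier G"
  shows "x \<otimes> inv a \<otimes> inv x = inv (x \<otimes> a \<otimes> inv x)"
  using assms by (simp add: G.inv_mult_group G.m_assoc)

lemma subgroup_stab:
  assumes x: "x \<in> carrier G"
  shows "subgroup (stab x) G"
proof (rule G.subgroupI)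
  show "stab x \<subseteq> carrier G" using stab_subset S_carrier by blast
  have "\<one> \<in> stab x"
    using x subgroup.one_closed[OF S.subgroup_axioms] subgroup.one_closed[OF subgroup_H] by (simp add: stab_def)
  then show "stab x \<noteq> {}" by blast
  show "inv s \<in> stab x" if "s \<in> stab x" for s
    using that x S_carrier conj_inv[OF x, of s] subgroup.m_inv_closed[OF subgroup_H] by (auto simp: stab_def)
  show "s \<otimes> t \<in> stab x" if "s \<in> stab x" "t \<in> stab x" for s t
    using that x S_carrier conj_mult[OF x, of s t] subgroup.m_closed[OF subgroup_H] by (auto simp: stab_def)
qed

lemma stab_conj_iff:
  assumes "x \<in> carrier G" "g \<in> carrier G" "s \<in> S"
  shows "inv g \<otimes> s \<otimes> g \<in> stab (x \<otimes> g) \<longleftrightarrow> s \<in> stab x"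
proof -
  have "x \<otimes> g \<otimes> (inv g \<otimes> s \<otimes> g) \<otimes> inv (x \<otimes> g) = x \<otimes> s \<otimes> inv x"
  proof -
    have "g \<otimes> (inv g \<otimes> b) = b" if "b \<in> carrier G" for b
      using that assms by (simp flip: G.m_assoc)
    then show ?thesis using assms S_carrier by (simp add: G.m_assoc G.inv_mult_group)
  qed
  then show ?thesis using assms S.inv_op_closed1[OF assms(2,3)] by (simp add: stab_def)
qed

lemma stab_hinv:
  assumes "hinv m" "x \<in> carrier G" "k \<in> stab x"
  shows "m (x \<otimes> k) = m x"
proof -
  have k: "k \<in> carrier G" "x \<otimes> k \<otimes> inv x \<in> H" using assms S_carrier by (auto simp: stab_def)
  then have "m ((x \<otimes> k \<otimes> inv x) \<otimes> x) = m x" using hinvD[OF assms(1,2)] by blast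
  then show ?thesis using k(1) assms(2) by (simp add: G.m_assoc)
qed

lemma card_stab:
  assumes x: "x \<in> carrier G"
  shows "card (stab x) = card (S \<inter> H)"
proof -
  have "bij_betw (\<lambda>s. x \<otimes> s \<otimes> inv x) (stab x) (S \<inter> H)"
  proof (rule bij_betw_byWitness[where f' = "\<lambda>s. inv x \<otimes> s \<otimes> x"])
    have canc: "x \<otimes> (inv x \<otimes> b) = b" "inv x \<otimes> (x \<otimes> b) = b" if "b \<in> carrier G" for b
      using that x by (simp_all flip: G.m_assoc)
    show "\<forall>a\<in>stab x. inv x \<otimes> (x \<otimes> a \<otimes> inv x) \<otimes> x = a" "\<forall>a\<in>S \<inter> H. x \<otimes> (inv x \<otimes> a \<otimes> x) \<otimes> inv x = a"
      using x S_carrier by (auto simp: G.m_assoc canc stab_def)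
    show "(\<lambda>s. x \<otimes> s \<otimes> inv x) ` stab x \<subseteq> S \<inter> H"
      using x S.inv_op_closed2 by (auto simp: stab_def)
    show "(\<lambda>s. inv x \<otimes> s \<otimes> x) ` (S \<inter> H) \<subseteq> stab x"
      using stab_conj_iff[OF G.one_closed x] x stab_one by auto
  qed
  then show ?thesis by (rule bij_betw_same_card)
qed

text \<open>On the double coset of \<open>r\<close>, integrate \<open>b\<close> to \<open>m (h \<otimes> r \<otimes> d) = b d r\<close>; vanishing on stabilisers makes
  this well defined.\<close>

lemma triv_if_zero_on_stabilisers:
  fixes b :: "'a \<Rightarrow> 'a \<Rightarrow> 'b::ab_group_add"
  assumes D: "subgroup D G" and hv: "\<And>g. g \<in> D \<Longrightarrow> hinv (b g)"
    and mult: "\<And>g h x. \<lbrakk>g \<in> D; h \<in> D; x \<in> carrier G\<rbrakk> \<Longrightarrow> b (g \<otimes> h) x = b g x + b h (x \<otimes> g)"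
    and zero: "\<And>k x. \<lbrakk>k \<in> D; x \<in> carrier G; x \<otimes> k \<otimes> inv x \<in> H\<rbrakk> \<Longrightarrow> b k x = 0"
  shows "GC.triv D b"
proof -
  have DG: "d \<in> carrier G" if "d \<in> D" for d using that subgroup.subset[OF D] by blast
  note Hm = subgroup.m_closed[OF subgroup_H] and Hi = subgroup.m_inv_closed[OF subgroup_H]
  note Dm = subgroup.m_closed[OF D] and Di = subgroup.m_inv_closed[OF D]
  define dc where "dc y = {h \<otimes> y \<otimes> d | h d. h \<in> H \<and> d \<in> D}" for y
  have dc_sub: "dc (h \<otimes> y \<otimes> d) \<subseteq> dc y" if "y \<in> carrier G" "h \<in> H" "d \<in> D" for h y d
  proof
    fix z assume "z \<in> dc (h \<otimes> y \<otimes> d)"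
    then obtain h' d' where "h' \<in> H" "d' \<in> D" "z = h' \<otimes> (h \<otimes> y \<otimes> d) \<otimes> d'" by (auto simp: dc_def)
    moreover have "h' \<otimes> (h \<otimes> y \<otimes> d) \<otimes> d' = (h' \<otimes> h) \<otimes> y \<otimes> (d \<otimes> d')"
      using that calculation H_carrier DG by (simp add: G.m_assoc)
    ultimately show "z \<in> dc y" unfolding dc_def using Hm Dm that by blast
  qed
  have dc_eq: "dc (h \<otimes> y \<otimes> d) = dc y" if "y \<in> carrier G" "h \<in> H" "d \<in> D" for h y d
  proof
    show "dc (h \<otimes> y \<otimes> d) \<subseteq> dc y" using dc_sub[OF that] .
    have y: "inv h \<otimes> (h \<otimes> y \<otimes> d) \<otimes> inv d = y"
    proof -
      have "inv h \<otimes> (h \<otimes> y \<otimes> d) = y \<otimes> d" using that H_carrier DG by (simp add: G.m_assoc[symmetric])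
      then show ?thesis using that DG by (simp add: G.m_assoc)
    qed
    have "h \<otimes> y \<otimes> d \<in> carrier G" using that H_carrier DG by simp
    from dc_sub[OF this Hi[OF that(2)] Di[OF that(3)]]
    show "dc y \<subseteq> dc (h \<otimes> y \<otimes> d)" unfolding y .
  qed
  define r where "r y = (SOME z. z \<in> dc y)" for y
  have r_eq: "r (h \<otimes> y \<otimes> d) = r y" if "y \<in> carrier G" "h \<in> H" "d \<in> D" for h y d
    using dc_eq[OF that] by (simp add: r_def)
  have r: "\<exists>h d. h \<in> H \<and> d \<in> D \<and> y = h \<otimes> r y \<otimes> d \<and> r y \<in> carrier G" if y: "y \<in> carrier G" for y
  proof -
    have "\<one> \<otimes> y \<otimes> \<one> \<in> dc y"
      unfolding dc_def using subgroup.one_closed[OF subgroup_H] subgroup.one_closed[OF D] by blast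
    then have "r y \<in> dc y" unfolding r_def by (rule someI)
    then obtain h d where hd: "h \<in> H" "d \<in> D" "r y = h \<otimes> y \<otimes> d" by (auto simp: dc_def)
    have "y = inv h \<otimes> r y \<otimes> inv d"
    proof -
      have "inv h \<otimes> (h \<otimes> y \<otimes> d) = y \<otimes> d" using hd y H_carrier DG by (simp add: G.m_assoc[symmetric])
      then show ?thesis using hd y DG by (simp add: G.m_assoc)
    qed
    moreover have "r y \<in> carrier G" using hd y H_carrier DG by simp
    ultimately show ?thesis using Hi[OF hd(1)] Di[OF hd(2)] by blast
  qed
  define m where "m y = b (SOME d. d \<in> D \<and> (\<exists>h\<in>H. y = h \<otimes> r y \<otimes> d)) (r y)" for y
  have m: "m y = b d (r y)" if y: "y \<in> carrier G" and d: "d \<in> D" "h \<in> H" "y = h \<otimes> r y \<otimes> d" for y d h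
  proof -
    define d' where "d' = (SOME d. d \<in> D \<and> (\<exists>h\<in>H. y = h \<otimes> r y \<otimes> d))"
    have "d' \<in> D \<and> (\<exists>h\<in>H. y = h \<otimes> r y \<otimes> d')" unfolding d'_def by (rule someI[of _ d]) (use d in blast)
    then obtain h' where d': "d' \<in> D" "h' \<in> H" "y = h' \<otimes> r y \<otimes> d'" by blast
    have ry: "r y \<in> carrier G" using r[OF y] by blast
    \<comment> \<open>Two decompositions of \<open>y\<close> differ by this element of
      \<open>D\<close>, which fixes the coset of \<open>r y\<close>; \<open>zero\<close> therefore
      applies to it.\<close>
    let ?k = "d' \<otimes> inv d"
    have k: "?k \<in> D" using Dm[OF d'(1) Di[OF d(1)]] .
    have "r y \<otimes> ?k = (inv h' \<otimes> h) \<otimes> r y"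
    proof -
      have "h \<otimes> r y \<otimes> d = h' \<otimes> r y \<otimes> d'" using d(3) d'(3) by metis
      then have "inv h' \<otimes> (h \<otimes> r y \<otimes> d) \<otimes> inv d = inv h' \<otimes> (h' \<otimes> r y \<otimes> d') \<otimes> inv d" by simp
      moreover have "inv h' \<otimes> (h \<otimes> r y \<otimes> d) \<otimes> inv d = (inv h' \<otimes> h) \<otimes> r y"
        using d(1,2) d'(1,2) ry H_carrier DG by (simp add: G.m_assoc)
      moreover have "inv h' \<otimes> (h' \<otimes> r y \<otimes> d') \<otimes> inv d = r y \<otimes> ?k"
        using d(1,2) d'(1,2) ry H_carrier DG by (simp add: G.m_assoc) (simp add: G.m_assoc[symmetric])
      ultimately show ?thesis by simp
    qed
    moreover have hh: "inv h' \<otimes> h \<in> H" using Hm[OF Hi[OF d'(2)] d(2)] .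
    ultimately have bk: "b d (r y \<otimes> ?k) = b d (r y)"
      using hinvD[OF hv[OF d(1)] ry hh] by simp
    have "r y \<otimes> ?k \<otimes> inv (r y) = inv h' \<otimes> h"
      using \<open>r y \<otimes> ?k = (inv h' \<otimes> h) \<otimes> r y\<close> G.conj_eq_iff(1)[OF ry DG[OF k] H_carrier[OF hh]] by simp
    then have rk: "r y \<otimes> ?k \<otimes> inv (r y) \<in> H" using hh by simp
    have "?k \<otimes> d = d'" using DG[OF d(1)] DG[OF d'(1)] by (simp add: G.m_assoc)
    then have "b d' (r y) = b ?k (r y) + b d (r y \<otimes> ?k)" using mult[OF k d(1) ry] by simp
    then show ?thesis using zero[OF k ry rk] bk by (simp add: m_def d'_def)
  qed
  show ?thesis
  proof (rule GC.trivI[of m _ _ "\<lambda>_. 0"])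
    show "hinv m"
      unfolding hinv_def
    proof (intro ballI)
      fix x h assume x: "x \<in> carrier G" and h: "h \<in> H"
      obtain h' d where hd: "h' \<in> H" "d \<in> D" "x = h' \<otimes> r x \<otimes> d" "r x \<in> carrier G" using r[OF x] by blast
      have rx: "r (h \<otimes> x) = r x"
        using r_eq[OF x h subgroup.one_closed[OF D]] x H_carrier[OF h] by simp
      have hx: "h \<otimes> x = (h \<otimes> h') \<otimes> r (h \<otimes> x) \<otimes> d"
        unfolding rx using hd(1,2,4) h H_carrier DG by (subst hd(3)) (simp add: G.m_assoc)
      have "m (h \<otimes> x) = b d (r (h \<otimes> x))"
        by (rule m[OF G.m_closed[OF H_carrier[OF h] x] hd(2) Hm[OF h hd(1)] hx])
      then show "m (h \<otimes> x) = m x" using m[OF x hd(2,1,3)] rx by simp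
    qed
    fix g x assume g: "g \<in> D" and x: "x \<in> carrier G"
    obtain h d where hd: "h \<in> H" "d \<in> D" "x = h \<otimes> r x \<otimes> d" "r x \<in> carrier G" using r[OF x] by blast
    have rx: "r (x \<otimes> g) = r x"
      using r_eq[OF x subgroup.one_closed[OF subgroup_H] g] x by simp
    have xg: "x \<otimes> g = h \<otimes> r (x \<otimes> g) \<otimes> (d \<otimes> g)"
      unfolding rx using hd(1,2,4) g H_carrier DG by (subst hd(3)) (simp add: G.m_assoc)
    have "m (x \<otimes> g) = b (d \<otimes> g) (r x)"
      using m[OF G.m_closed[OF x DG[OF g]] Dm[OF hd(2) g] hd(1) xg] unfolding rx .
    also have "\<dots> = b d (r x) + b g (r x \<otimes> d)" using mult[OF hd(2) g hd(4)] .
    also have "b g (r x \<otimes> d) = b g (h \<otimes> (r x \<otimes> d))"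
      using hinvD[OF hv[OF g] _ hd(1), of "r x \<otimes> d"] hd DG by simp
    also have "h \<otimes> (r x \<otimes> d) = x" using hd DG H_carrier by (metis G.m_assoc)
    finally show "b g x = m (x \<otimes> g) - m x + 0" using m[OF x hd(2,1,3)] by simp
  qed
qed

end

text \<open>The first assumption is faithfulness of a permutation action, in terms of the point
  stabiliser \<open>H\<close>. The second says that all orbits of \<open>S\<close> have
  \<open>p\<close> points; this is the form in which exact divisibility of the degree by
  \<open>p\<close> is used.\<close>

locale core_free_sylow = normal_sylow G H S p
  for G :: "('a, 'x) monoid_scheme" (structure) and H S p +
  assumes core: "\<lbrakk>g \<in> carrier G; \<And>x. x \<in> carrier G \<Longrightarrow> x \<otimes> g \<otimes> inv x \<in> H\<rbrakk> \<Longrightarrow> g = \<one>"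
    and card_SH: "card S = p * card (S \<inter> H)"
begin

lemma finS: "finite S" using finite_subset[OF S.subset finG] .

lemma stab_index: "x \<in> carrier G \<Longrightarrow> card S = p * card (stab x)"
  using card_SH card_stab by simp

lemma in_all_stab: "\<lbrakk>s \<in> S; \<And>x. x \<in> carrier G \<Longrightarrow> s \<in> stab x\<rbrakk> \<Longrightarrow> s = \<one>"
  using core S_carrier by (auto simp: stab_def)

lemma S_commute:
  assumes "s \<in> S" "t \<in> S"
  shows "s \<otimes> t = t \<otimes> s"
proof -
  obtain a where a: "card S = p ^ a" using card_S by blast
  have "s \<otimes> t \<otimes> inv s \<otimes> inv t \<in> stab x" if "x \<in> carrier G" for x
    by (rule G.index_p_commutator[OF S.subgroup_axioms finS prime_p a subgroup_stab[OF that]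
          stab_subset stab_index[OF that] assms])
  moreover have "s \<otimes> t \<otimes> inv s \<otimes> inv t \<in> S" using assms by simp
  ultimately have "s \<otimes> t \<otimes> inv s \<otimes> inv t = \<one>" using in_all_stab by blast
  then show ?thesis
    using assms S_carrier by (metis G.inv_closed G.inv_equality G.inv_inv G.inv_solve_right G.m_closed G.l_one)
qed

lemma S_exponent: "s \<in> S \<Longrightarrow> s [^] p = \<one>"
proof -
  assume s: "s \<in> S"
  obtain a where a: "card S = p ^ a" using card_S by blast
  have "s [^] p \<in> stab x" if "x \<in> carrier G" for x
    by (rule G.index_p_pow[OF S.subgroup_axioms finS prime_p a subgroup_stab[OF that]
          stab_subset stab_index[OF that] s])
  then show ?thesis using in_all_stab G.pow_in_subgroup[OF S.subgroup_axioms s] by blast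
qed

text \<open>A subgroup of index \<open>p\<close> is maximal, so \<open>t\<close> generates
  \<open>S\<close> over the stabiliser. Commutativity of \<open>S\<close> allows the power to be
  written on the right.\<close>

lemma stab_maximal:
  assumes x: "x \<in> carrier G" and t: "t \<in> S" "t \<notin> stab x" and u: "u \<in> S"
  obtains i where "u \<otimes> t [^] (i::nat) \<in> stab x"
proof -
  obtain a where a: "card S = p ^ a" using card_S by blast
  obtain i where "t [^] (i::nat) \<otimes> u \<in> stab x"
    using G.index_p_power_meets[OF S.subgroup_axioms finS prime_p a subgroup_stab[OF x] stab_subset stab_index[OF x] t u]
    by blast
  then show ?thesis
    using that S_commute[OF u G.pow_in_subgroup[OF S.subgroup_axioms t(1)]] by metis
qed

text \<open>In the abelian group \<open>S\<close> all points of one orbit have the same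
  stabiliser.\<close>

lemma stab_mult_S:
  assumes x: "x \<in> carrier G" and s: "s \<in> S"
  shows "stab (x \<otimes> s) = stab x"
proof -
  have "inv s \<otimes> t \<otimes> s = t" if "t \<in> S" for t
    using S_commute[OF that s] S_carrier[OF that] S_carrier[OF s] by (metis G.conj_eq_iff(2))
  then have "t \<in> stab (x \<otimes> s) \<longleftrightarrow> t \<in> stab x" if "t \<in> S" for t
    using stab_conj_iff[OF x S_carrier[OF s] that] that by simp
  then show ?thesis using stab_subset by blast
qed

lemma stab_not_subset:
  assumes x: "x \<in> carrier G" and y: "y \<in> carrier G" and ne: "stab x \<noteq> stab y"
  obtains t where "t \<in> stab x" "t \<notin> stab y"
proof -
  have "\<not> stab x \<subseteq> stab y"
    using card_subset_eq[of "stab y" "stab x"] ne card_stab[OF x] card_stab[OF y]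
      finite_subset[OF stab_subset finS] by auto
  then show ?thesis using that by blast
qed

end

section \<open>Locally trivial classes on the Sylow subgroup\<close>

context core_free_sylow
begin

text \<open>Here the defect is zero and not merely constant in \<open>x\<close>: these are crossed
  homomorphisms from \<open>S\<close> into the invariant functions themselves.\<close>

definition exact :: "('a \<Rightarrow> 'a \<Rightarrow> 'b::ab_group_add) \<Rightarrow> bool" where
  "exact b \<longleftrightarrow> (\<forall>g\<in>S. hinv (b g)) \<and> (\<forall>g\<in>S. \<forall>h\<in>S. \<forall>x\<in>carrier G. b (g \<otimes> h) x = b g x + b h (x \<otimes> g))"

definition loc_const :: "('a \<Rightarrow> 'a \<Rightarrow> 'b) \<Rightarrow> bool" where
  "loc_const b \<longleftrightarrow> (\<forall>x\<in>carrier G. \<forall>y\<in>carrier G. \<forall>k\<in>stab x \<inter> stab y. b k x = b k y)"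

lemma loc_constD: "\<lbrakk>loc_const b; x \<in> carrier G; y \<in> carrier G; k \<in> stab x; k \<in> stab y\<rbrakk> \<Longrightarrow> b k x = b k y"
  unfolding loc_const_def by blast

lemma loc_const_diff:
  assumes "loc_const b"
  shows "loc_const (\<lambda>g z. b g z - e g)"
  unfolding loc_const_def
proof (intro ballI)
  fix x y k assume "x \<in> carrier G" "y \<in> carrier G" "k \<in> stab x \<inter> stab y"
  then have "b k x = b k y" by (intro loc_constD[OF assms]) auto
  then show "b k x - e k = b k y - e k" by simp
qed

lemma exactD: "\<lbrakk>exact b; g \<in> S; h \<in> S; x \<in> carrier G\<rbrakk> \<Longrightarrow> b (g \<otimes> h) x = b g x + b h (x \<otimes> g)"
  by (simp add: exact_def)

lemma exact_hinv: "\<lbrakk>exact b; g \<in> S\<rbrakk> \<Longrightarrow> hinv (b g)"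
  by (simp add: exact_def)

lemma S_m: "\<lbrakk>s \<in> S; t \<in> S\<rbrakk> \<Longrightarrow> s \<otimes> t \<in> S"
  using subgroup.m_closed[OF S.subgroup_axioms] .

lemma S_pow: "s \<in> S \<Longrightarrow> s [^] (n::nat) \<in> S"
  using G.pow_in_subgroup[OF S.subgroup_axioms] .

lemma stab_S: "k \<in> stab x \<Longrightarrow> k \<in> S"
  by (simp add: stab_def)

text \<open>An element \<open>k\<close> fixing the coset of \<open>x\<close> causes no translation.
  In particular \<open>b k x\<close>, as a function of \<open>k\<close>, is a character of
  \<open>stab x\<close>.\<close>

lemma exact_stab:
  assumes b: "exact b" and x: "x \<in> carrier G" and k: "k \<in> stab x" and l: "l \<in> S"
  shows "b (k \<otimes> l) x = b k x + b l x"
  using exactD[OF b stab_S[OF k] l x] stab_hinv[OF exact_hinv[OF b l] x k] by simp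

lemma exact_stab_pow:
  assumes b: "exact b" and x: "x \<in> carrier G" and k: "k \<in> stab x"
  shows "b (k [^] (n::nat)) x = n \<cdot> b k x"
proof (induction n)
  case 0
  have "b (\<one> \<otimes> \<one>) x = b \<one> x + b \<one> x"
    using exact_stab[OF b x subgroup.one_closed[OF subgroup_stab[OF x]] subgroup.one_closed[OF S.subgroup_axioms]] .
  then show ?case by simp
next
  case (Suc n)
  have kG: "k \<in> carrier G" using stab_S[OF k] S_carrier by blast
  have "b (k \<otimes> k [^] n) x = b k x + b (k [^] n) x"
    by (rule exact_stab[OF b x k S_pow[OF stab_S[OF k]]])
  then show ?case using Suc kG G.nat_pow_Suc2[of k n] by simp
qed

lemma exact_stab_cancel:
  assumes b: "exact b" and x: "x \<in> carrier G" and t: "t \<in> stab x" and u: "u \<in> stab x"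
    and z: "b t x = 0" "b (u \<otimes> t [^] (i::nat)) x = 0"
  shows "b u x = 0"
  using exact_stab[OF b x u S_pow[OF stab_S[OF t]], of i] exact_stab_pow[OF b x t, of i] z by simp

lemma triv_exact:
  assumes b: "exact b" and zero: "\<And>x k. \<lbrakk>x \<in> carrier G; k \<in> stab x\<rbrakk> \<Longrightarrow> b k x = 0"
  shows "GC.triv S b"
  by (rule triv_if_zero_on_stabilisers[OF S.subgroup_axioms exact_hinv[OF b] exactD[OF b]])
    (auto intro!: zero simp: stab_def)

text \<open>On the subgroup generated by \<open>k\<close> the cocycle is a coboundary plus
  \<open>e\<close>. At a coset fixed by \<open>k\<close> the coboundary term cancels, and
  \<open>e k\<close> does not depend on the coset.\<close>

lemma loc_const_if_triv:
  assumes "\<And>g. g \<in> S \<Longrightarrow> GC.triv (generate G {g}) b"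
  shows "loc_const b"
  unfolding loc_const_def
proof (intro ballI)
  fix x y k assume x: "x \<in> carrier G" and y: "y \<in> carrier G" and "k \<in> stab x \<inter> stab y"
  then have k: "k \<in> stab x" "k \<in> stab y" by auto
  have gk: "k \<in> generate G {k}" by (rule generate.incl) simp
  obtain m e where m: "hinv m"
    and me: "\<And>g x. \<lbrakk>g \<in> generate G {k}; x \<in> carrier G\<rbrakk> \<Longrightarrow> b g x = m (x \<otimes> g) - m x + e g"
    using assms[OF stab_S[OF k(1)]] unfolding GC.triv_def by blast
  show "b k x = b k y"
    using me[OF gk x] me[OF gk y] stab_hinv[OF m x k(1)] stab_hinv[OF m y k(2)] by simp
qed

text \<open>Two distinct stabilisers \<open>K\<close> and \<open>L\<close> give commuting sections of the central extension
  defined by the obstruction \<open>c\<close>; since \<open>K L = S\<close> they glue to a section over \<open>S\<close>.\<close>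

lemma split:
  fixes b :: "'a \<Rightarrow> 'a \<Rightarrow> 'b::ab_group_add"
  assumes b: "GC.cocyc S b" and lc: "loc_const b" and x: "x \<in> carrier G" and y: "y \<in> carrier G"
    and ne: "stab x \<noteq> stab y"
  obtains e where "exact (\<lambda>g z. b g z - e g)" "\<forall>k\<in>stab x. b k x = e k" "\<forall>k\<in>stab y. b k y = e k"
proof -
  have one: "\<one> \<in> S" using subgroup.one_closed[OF S.subgroup_axioms] .
  have onex: "\<one> \<in> stab x" and oney: "\<one> \<in> stab y"
    using subgroup.one_closed[OF subgroup_stab] x y by auto
  define c where "c g h = b g \<one> + b h g - b (g \<otimes> h) \<one>" for g h
  have bD: "b (g \<otimes> h) z = b g z + b h (z \<otimes> g) - c g h" if "g \<in> S" "h \<in> S" "z \<in> carrier G" for g h z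
    unfolding c_def using GC.cocycD[OF b that] .
  have hv: "hinv (b g)" if "g \<in> S" for g using GC.cocyc_hinv[OF b that] .
  have bx: "b (k \<otimes> h) z = b k z + b h z - c k h" if "z \<in> carrier G" "k \<in> stab z" "h \<in> S" for k h z
    using bD[OF stab_S[OF that(2)] that(3,1)] stab_hinv[OF hv[OF that(3)] that(1,2)] by simp
  have coc: "c g h = c h k + c g (h \<otimes> k) - c (g \<otimes> h) k" if g: "g \<in> S" "h \<in> S" "k \<in> S" for g h k
  proof -
    note gG = g[THEN S_carrier]
    have "b ((g \<otimes> h) \<otimes> k) \<one> = b g \<one> + b h g - c g h + b k (g \<otimes> h) - c (g \<otimes> h) k"
      using bD[OF S_m[OF g(1,2)] g(3) G.one_closed] bD[OF g(1,2) G.one_closed] gG by simp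
    moreover have "b (g \<otimes> (h \<otimes> k)) \<one> = b g \<one> + (b h g + b k (g \<otimes> h) - c h k) - c g (h \<otimes> k)"
      using bD[OF g(1) S_m[OF g(2,3)] G.one_closed] bD[OF g(2,3) gG(1)] gG by simp
    moreover have "(g \<otimes> h) \<otimes> k = g \<otimes> (h \<otimes> k)" using gG by (simp add: G.m_assoc)
    ultimately have "b g \<one> + b h g - c g h + b k (g \<otimes> h) - c (g \<otimes> h) k
        = b g \<one> + (b h g + b k (g \<otimes> h) - c h k) - c g (h \<otimes> k)" by simp
    then have "- c g h - c (g \<otimes> h) k = - c h k - c g (h \<otimes> k)"
      by (simp add: algebra_simps)
    then show ?thesis by (simp add: algebra_simps)
  qed
  \<comment> \<open>Local constancy applies to \<open>x\<close> and \<open>x \<otimes> l\<close>,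
    because they have the same stabiliser. It makes the lift of \<open>k\<close> commute with every
    lift.\<close>
  have sym: "c k l = c l k" if k: "k \<in> stab x" and l: "l \<in> S" for k l
  proof -
    have kl: "k \<otimes> l = l \<otimes> k" using S_commute stab_S k l by blast
    have "b k (x \<otimes> l) = b k x"
      by (rule loc_constD[OF lc]) (use x l k S_carrier in \<open>auto simp: stab_mult_S\<close>)
    then have "b (l \<otimes> k) x = b l x + b k x - c l k"
      using bD[OF l stab_S[OF k] x] by simp
    moreover have "b (k \<otimes> l) x = b k x + b l x - c k l" using bx[OF x k l] .
    ultimately have "b l x + b k x - c l k = b k x + b l x - c k l" using kl by simp
    then show ?thesis by (simp add: algebra_simps)
  qed
  \<comment> \<open>The coordinate, in the extension defined by \<open>c\<close>, of the product of
    the section over \<open>stab x\<close> at \<open>k\<close> and the section over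
    \<open>stab y\<close> at \<open>l\<close>.\<close>
  define P where "P k l = b k x + b l y - c k l" for k l
  \<comment> \<open>Two factorisations of one element differ by a \<open>z\<close> lying in both
    stabilisers, where local constancy identifies the two sections.\<close>
  have W: "P k l = P k' l'" if k: "k \<in> stab x" "k' \<in> stab x" and l: "l \<in> stab y" "l' \<in> stab y"
    and eq: "k \<otimes> l = k' \<otimes> l'" for k k' l l'
  proof -
    note kS = k[THEN stab_S] l[THEN stab_S]
    note kG = kS[THEN S_carrier]
    define z where "z = inv k' \<otimes> k"
    have zx: "z \<in> stab x"
      unfolding z_def using k subgroup.m_closed[OF subgroup_stab[OF x]] subgroup.m_inv_closed[OF subgroup_stab[OF x]] by blast
    have "z = l' \<otimes> inv l"
    proof -
      have "inv k' \<otimes> (k \<otimes> l) \<otimes> inv l = inv k' \<otimes> (k' \<otimes> l') \<otimes> inv l" using eq by simp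
      moreover have "inv k' \<otimes> (k \<otimes> l) \<otimes> inv l = z" unfolding z_def using kG by (simp add: G.m_assoc)
      moreover have "inv k' \<otimes> (k' \<otimes> l') \<otimes> inv l = l' \<otimes> inv l" using kG by (simp add: G.m_assoc[symmetric])
      ultimately show ?thesis by simp
    qed
    then have zy: "z \<in> stab y" and l': "l' = z \<otimes> l"
      using l subgroup.m_closed[OF subgroup_stab[OF y]] subgroup.m_inv_closed[OF subgroup_stab[OF y]] kG
      by (auto simp: G.m_assoc)
    have k': "k = k' \<otimes> z" unfolding z_def using kG by (simp add: G.m_assoc[symmetric])
    have zS: "z \<in> S" using zx stab_S by blast
    have bz: "b z x = b z y" using loc_constD[OF lc x y zx zy] .
    have "P k l = b k' x + b z x - c k' z + b l y - c (k' \<otimes> z) l"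
      unfolding P_def k' using bx[OF x k(2) zS] by simp
    moreover have "P k' l' = b k' x + (b z y + b l y - c z l) - c k' (z \<otimes> l)"
      unfolding P_def l' using bx[OF y zy kS(3)] by simp
    moreover have "b k' x + b z x - c k' z + b l y - c (k' \<otimes> z) l = b k' x + (b z y + b l y - c z l) - c k' (z \<otimes> l)"
      unfolding coc[OF kS(2) zS kS(3)] bz by (simp add: algebra_simps)
    ultimately show ?thesis by simp
  qed
  \<comment> \<open>Moving \<open>l\<close> past \<open>k'\<close> costs nothing by
    \<open>sym\<close>; what remains is associativity of the extension, that is
    \<open>coc\<close>.\<close>
  have A: "P (k \<otimes> k') (l \<otimes> l') = P k l + P k' l' - c (k \<otimes> l) (k' \<otimes> l')"
    if k: "k \<in> stab x" "k' \<in> stab x" and l: "l \<in> stab y" "l' \<in> stab y" for k k' l l'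
  proof -
    note kS = k[THEN stab_S] l[THEN stab_S]
    note kG = kS[THEN S_carrier]
    have P1: "P (k \<otimes> k') (l \<otimes> l') = (b k x + b k' x - c k k') + (b l y + b l' y - c l l') - c (k \<otimes> k') (l \<otimes> l')"
      unfolding P_def using bx[OF x k(1) kS(2)] bx[OF y l(1) kS(4)] by simp
    have lk: "l \<otimes> k' = k' \<otimes> l" using S_commute kS by blast
    have X: "l \<otimes> (k' \<otimes> l') = k' \<otimes> (l \<otimes> l')"
      using lk kG by (metis G.m_assoc)
    have "c k l = c l (k' \<otimes> l') + c k (k' \<otimes> (l \<otimes> l')) - c (k \<otimes> l) (k' \<otimes> l')"
      using coc[OF kS(1,3) S_m[OF kS(2,4)]] X by simp
    then have E1: "c (k \<otimes> l) (k' \<otimes> l') = c l (k' \<otimes> l') + c k (k' \<otimes> (l \<otimes> l')) - c k l"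
      by (simp add: algebra_simps)
    have "c l k' = c k' l' + c l (k' \<otimes> l') - c (k' \<otimes> l) l'"
      using coc[OF kS(3,2,4)] lk by simp
    then have E2: "c l (k' \<otimes> l') = c k' l + c (k' \<otimes> l) l' - c k' l'"
      using sym[OF k(2) kS(3)] by (simp add: algebra_simps)
    have "c k' l = c l l' + c k' (l \<otimes> l') - c (k' \<otimes> l) l'" using coc[OF kS(2,3,4)] .
    then have E3: "c (k' \<otimes> l) l' = c l l' + c k' (l \<otimes> l') - c k' l" by (simp add: algebra_simps)
    have "c k k' = c k' (l \<otimes> l') + c k (k' \<otimes> (l \<otimes> l')) - c (k \<otimes> k') (l \<otimes> l')"
      using coc[OF kS(1,2) S_m[OF kS(3,4)]] .
    then have E4: "c k (k' \<otimes> (l \<otimes> l')) = c k k' + c (k \<otimes> k') (l \<otimes> l') - c k' (l \<otimes> l')"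
      by (simp add: algebra_simps)
    show ?thesis unfolding P1 E1 E2 E3 E4 by (simp add: P_def)
  qed
  have "\<exists>k l. k \<in> stab x \<and> l \<in> stab y \<and> s = k \<otimes> l" if s: "s \<in> S" for s
  proof -
    obtain t where t: "t \<in> stab y" "t \<notin> stab x" using stab_not_subset[OF y x] ne by metis
    obtain i where i: "s \<otimes> t [^] (i::nat) \<in> stab x"
      using stab_maximal[OF x stab_S[OF t(1)] t(2) s] by blast
    have "inv (t [^] i) \<in> stab y"
      using t subgroup.m_inv_closed[OF subgroup_stab[OF y]] G.pow_in_subgroup[OF subgroup_stab[OF y]] by blast
    moreover have "s = (s \<otimes> t [^] i) \<otimes> inv (t [^] i)"
      using S_carrier[OF s] S_carrier[OF stab_S[OF t(1)]] by (simp add: G.m_assoc)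
    ultimately show ?thesis using i by blast
  qed
  then obtain K L where KL: "\<And>s. s \<in> S \<Longrightarrow> K s \<in> stab x \<and> L s \<in> stab y \<and> s = K s \<otimes> L s" by metis
  define e where "e s = P (K s) (L s)" for s
  have eP: "e (k \<otimes> l) = P k l" if "k \<in> stab x" "l \<in> stab y" for k l
    unfolding e_def using W[OF _ that(1) _ that(2)] KL[OF S_m[OF stab_S[OF that(1)] stab_S[OF that(2)]]] by metis
  have eM: "e (s \<otimes> t) = e s + e t - c s t" if st: "s \<in> S" "t \<in> S" for s t
  proof -
    define k l k' l' where "k = K s" and "l = L s" and "k' = K t" and "l' = L t"
    have kl: "k \<in> stab x" "l \<in> stab y" "k' \<in> stab x" "l' \<in> stab y"
      and s: "s = k \<otimes> l" and t: "t = k' \<otimes> l'"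
      using KL[OF st(1)] KL[OF st(2)] by (simp_all add: k_def l_def k'_def l'_def)
    note kG = kl[THEN stab_S, THEN S_carrier]
    have "l \<otimes> k' = k' \<otimes> l" using S_commute kl stab_S by blast
    then have "s \<otimes> t = (k \<otimes> k') \<otimes> (l \<otimes> l')" unfolding s t using kG by (metis G.m_assoc G.m_closed)
    then have "e (s \<otimes> t) = P (k \<otimes> k') (l \<otimes> l')"
      using eP[OF subgroup.m_closed[OF subgroup_stab[OF x] kl(1,3)] subgroup.m_closed[OF subgroup_stab[OF y] kl(2,4)]]
      by simp
    also have "\<dots> = P k l + P k' l' - c (k \<otimes> l) (k' \<otimes> l')" using A[OF kl(1,3,2,4)] .
    finally show ?thesis using eP[OF kl(1,2)] eP[OF kl(3,4)] unfolding s t by simp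
  qed
  have bone: "b \<one> x = b \<one> y" using loc_constD[OF lc x y onex oney] .
  show ?thesis
  proof (rule that[of e])
    show "exact (\<lambda>g z. b g z - e g)"
      unfolding exact_def
    proof (intro conjI ballI)
      show "hinv (\<lambda>z. b g z - e g)" if "g \<in> S" for g using hv[OF that] by (simp add: hinv_def)
      show "b (g \<otimes> h) z - e (g \<otimes> h) = b g z - e g + (b h (z \<otimes> g) - e h)"
        if "g \<in> S" "h \<in> S" "z \<in> carrier G" for g h z
        unfolding bD[OF that] eM[OF that(1,2)] by (simp add: algebra_simps)
    qed
    show "\<forall>k\<in>stab x. b k x = e k"
    proof
      fix k assume k: "k \<in> stab x"
      have kG: "k \<in> carrier G" using S_carrier stab_S k by blast
      have "e k = b k x + b \<one> y - c k \<one>" using eP[OF k oney] kG by (simp add: P_def)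
      moreover have "b k x = b k x + b \<one> x - c k \<one>" using bx[OF x k one] kG by simp
      ultimately show "b k x = e k" using bone by simp
    qed
    show "\<forall>k\<in>stab y. b k y = e k"
    proof
      fix k assume k: "k \<in> stab y"
      have kG: "k \<in> carrier G" using S_carrier stab_S k by blast
      have "e k = b \<one> x + b k y - c \<one> k" using eP[OF onex k] kG by (simp add: P_def)
      moreover have "b k y = b \<one> y + b k y - c \<one> k" using bx[OF y oney stab_S[OF k]] kG by simp
      ultimately show "b k y = e k" using bone by simp
    qed
  qed
qed

text \<open>If \<open>w\<close> does not fix \<open>z\<close>, some \<open>t\<close> in
  \<open>stab z\<close> and \<open>stab x0\<close> lies outside \<open>stab y0\<close>; local
  constancy gives \<open>b t z = 0\<close>, and a power of \<open>t\<close> carries any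
  \<open>u\<close> from \<open>stab z\<close> into \<open>stab y0\<close>, where the value is zero
  again. If \<open>w\<close> fixes \<open>x\<close>, a power of \<open>w\<close> carries
  \<open>k\<close> into the stabiliser of a point not fixed by \<open>w\<close>, which is the case
  already settled.\<close>

lemma zero_on_stabilisers:
  assumes b: "exact b" and lc: "loc_const b" and x0: "x0 \<in> carrier G" and y0: "y0 \<in> carrier G"
    and ne: "stab x0 \<noteq> stab y0"
    and zx: "\<And>k. k \<in> stab x0 \<Longrightarrow> b k x0 = 0" and zy: "\<And>k. k \<in> stab y0 \<Longrightarrow> b k y0 = 0"
    and w: "w \<in> stab x0" "w \<in> stab y0" "w \<noteq> \<one>"
    and x: "x \<in> carrier G" and k: "k \<in> stab x"
  shows "b k x = 0"
proof -
  have wS: "w \<in> S" using stab_S w by blast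
  have step: "b u z = 0" if z: "z \<in> carrier G" and wz: "w \<notin> stab z" and u: "u \<in> stab z" for z u
  proof -
    obtain v where v: "v \<in> stab x0" "v \<notin> stab y0" using stab_not_subset[OF x0 y0 ne] .
    obtain i where i: "v \<otimes> w [^] (i::nat) \<in> stab z" using stab_maximal[OF z wS wz stab_S[OF v(1)]] .
    \<comment> \<open>Multiplying \<open>v\<close> by a power of \<open>w\<close> moves it into
      \<open>stab z\<close>. It stays in \<open>stab x0\<close> and outside \<open>stab y0\<close>,
      because \<open>w\<close> lies in both.\<close>
    define t where "t = v \<otimes> w [^] i"
    have tz: "t \<in> stab z" using i by (simp add: t_def)
    have tx: "t \<in> stab x0"
      unfolding t_def using v(1) w(1) subgroup.m_closed[OF subgroup_stab[OF x0]] G.pow_in_subgroup[OF subgroup_stab[OF x0]] by blast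
    have wi: "w [^] i \<in> stab y0" using w(2) G.pow_in_subgroup[OF subgroup_stab[OF y0]] by blast
    have ty: "t \<notin> stab y0"
    proof
      assume "t \<in> stab y0"
      then have "t \<otimes> inv (w [^] i) \<in> stab y0"
        using wi subgroup.m_closed[OF subgroup_stab[OF y0]] subgroup.m_inv_closed[OF subgroup_stab[OF y0]] by blast
      moreover have "t \<otimes> inv (w [^] i) = v"
        unfolding t_def using S_carrier[OF wS] S_carrier[OF stab_S[OF v(1)]] by (simp add: G.m_assoc)
      ultimately show False using v(2) by simp
    qed
    have bt: "b t z = 0" using loc_constD[OF lc z x0 tz tx] zx[OF tx] by simp
    obtain j where j: "u \<otimes> t [^] (j::nat) \<in> stab y0" using stab_maximal[OF y0 stab_S[OF tz] ty stab_S[OF u]] .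
    have "u \<otimes> t [^] j \<in> stab z"
      using u tz subgroup.m_closed[OF subgroup_stab[OF z]] G.pow_in_subgroup[OF subgroup_stab[OF z]] by blast
    then have "b (u \<otimes> t [^] j) z = 0" using loc_constD[OF lc z y0 _ j] zy[OF j] by simp
    then show ?thesis using exact_stab_cancel[OF b z tz u bt] by blast
  qed
  show ?thesis
  proof (cases "w \<in> stab x")
    case False
    then show ?thesis using step[OF x _ k] by blast
  next
    case True
    \<comment> \<open>Faithfulness supplies a point that the nontrivial element \<open>w\<close>
      moves.\<close>
    obtain y where y: "y \<in> carrier G" "w \<notin> stab y" using in_all_stab[OF wS] w(3) by blast
    have bw: "b w x = 0" using loc_constD[OF lc x x0 True w(1)] zx[OF w(1)] by simp
    obtain j where j: "k \<otimes> w [^] (j::nat) \<in> stab y" using stab_maximal[OF y(1) wS y(2) stab_S[OF k]] .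
    have "k \<otimes> w [^] j \<in> stab x"
      using k True subgroup.m_closed[OF subgroup_stab[OF x]] G.pow_in_subgroup[OF subgroup_stab[OF x]] by blast
    then have "b (k \<otimes> w [^] j) x = 0"
      using loc_constD[OF lc x y(1) _ j] step[OF y j] by simp
    then show ?thesis using exact_stab_cancel[OF b x True k bw] by blast
  qed
qed

section \<open>Subgroups of order p and the order of S\<close>

lemma ord_S:
  assumes t: "t \<in> S" "t \<noteq> \<one>"
  shows "G.ord t = p"
proof -
  have "G.ord t dvd p" using S_exponent[OF t(1)] G.pow_eq_id[of t p] S_carrier[OF t(1)] by simp
  moreover have "G.ord t \<noteq> 1" using G.ord_eq_1[of t] S_carrier[OF t(1)] t(2) by blast
  ultimately show ?thesis using prime_p prime_nat_iff by blast
qed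

lemma card_generate_S:
  assumes t: "t \<in> S" "t \<noteq> \<one>"
  shows "card (generate G {t}) = p"
  using G.generate_pow_card[of t] ord_S[OF t] S_carrier[OF t(1)] by simp

lemma generate_eq_if_card:
  assumes K: "subgroup K G" "K \<subseteq> S" "card K = p" and t: "t \<in> K" "t \<noteq> \<one>"
  shows "K = generate G {t}"
proof -
  have "generate G {t} \<subseteq> K" using G.generate_subgroup_incl[of "{t}" K] K(1) t(1) by blast
  then show ?thesis
    using card_subset_eq[of K "generate G {t}"] card_generate_S[of t] K t finite_subset[OF K(2) finS] by auto
qed

lemma pow_if_card:
  assumes K: "subgroup K G" "K \<subseteq> S" "card K = p" and t: "t \<in> K" "t \<noteq> \<one>" and u: "u \<in> K"
  obtains i where "i < p" "u = t [^] (i::nat)"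
proof -
  have tS: "t \<in> S" using K t by blast
  have fin: "finite (carrier G)" by (rule finG)
  have "u \<in> generate G {t}" using generate_eq_if_card[OF K t] u by blast
  then have "u \<in> {t [^] k | k. k \<in> (UNIV :: nat set)}"
    using G.generate_pow_on_finite_carrier[OF fin S_carrier[OF tS]] by blast
  then obtain k :: nat where k: "u = t [^] k" by blast
  have "t [^] k = t [^] (k mod p)"
  proof -
    have "t [^] k = t [^] (p * (k div p)) \<otimes> t [^] (k mod p)"
      using S_carrier[OF tS] by (simp add: G.nat_pow_mult)
    also have "t [^] (p * (k div p)) = \<one>"
      using S_exponent[OF tS] S_carrier[OF tS] by (simp flip: G.nat_pow_pow)
    finally show ?thesis using S_carrier[OF tS] by simp
  qed
  then show ?thesis using that[of "k mod p"] k prime_p prime_gt_0_nat by simp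
qed

lemma p_gt_1: "1 < p" using prime_p prime_gt_1_nat by blast

text \<open>Pick \<open>t\<close> in \<open>stab x\<close> outside \<open>stab y\<close>. A power of
  \<open>t\<close> carries any \<open>u\<close> from \<open>stab x\<close> into the trivial
  intersection, so \<open>t\<close> generates \<open>stab x\<close>, which therefore has order
  \<open>p\<close>.\<close>

lemma card_S_if_disjoint:
  assumes x: "x \<in> carrier G" and y: "y \<in> carrier G" and ne: "stab x \<noteq> stab y"
    and disj: "stab x \<inter> stab y = {\<one>}"
  shows "card S = p\<^sup>2"
proof -
  obtain t where t: "t \<in> stab x" "t \<notin> stab y" using stab_not_subset[OF x y ne] .
  have t1: "t \<noteq> \<one>" using t(2) subgroup.one_closed[OF subgroup_stab[OF y]] by blast
  have tG: "t \<in> carrier G" using t stab_S S_carrier by blast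
  have sub: "generate G {t} \<subseteq> stab x"
    using G.generate_subgroup_incl[of "{t}" "stab x"] subgroup_stab[OF x] t(1) by blast
  have "stab x \<subseteq> generate G {t}"
  proof
    fix u assume u: "u \<in> stab x"
    obtain i where i: "u \<otimes> t [^] (i::nat) \<in> stab y" using stab_maximal[OF y stab_S[OF t(1)] t(2) stab_S[OF u]] .
    have "u \<otimes> t [^] i \<in> stab x"
      using u t(1) subgroup.m_closed[OF subgroup_stab[OF x]] G.pow_in_subgroup[OF subgroup_stab[OF x]] by blast
    then have "u \<otimes> t [^] i = \<one>" using i disj by blast
    then have "u = inv (t [^] i)" using tG S_carrier[OF stab_S[OF u]] by (metis G.inv_equality G.nat_pow_closed)
    moreover have "t [^] i \<in> generate G {t}"
      using G.pow_in_subgroup[OF G.generate_is_subgroup[of "{t}"]] tG generate.incl[of t "{t}"] by blast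
    ultimately show "u \<in> generate G {t}" using subgroup.m_inv_closed[OF G.generate_is_subgroup[of "{t}"]] tG by blast
  qed
  then have "card (stab x) = p" using sub card_generate_S[OF stab_S[OF t(1)] t1] by (metis subset_antisym)
  then show ?thesis using stab_index[OF x] by (simp add: power2_eq_square)
qed

text \<open>If all stabilisers coincided they would be trivial by faithfulness, and index
  \<open>p\<close> would force \<open>S\<close> to have order \<open>p\<close>.\<close>

lemma exists_other_stab:
  assumes "card S \<noteq> p"
  shows "\<exists>y\<in>carrier G. stab y \<noteq> stab \<one>"
proof (rule ccontr)
  assume "\<not> ?thesis"
  then have all: "stab y = stab \<one>" if "y \<in> carrier G" for y using that by blast
  have "k = \<one>" if "k \<in> stab \<one>" for k using in_all_stab[OF stab_S[OF that]] all that by blast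
  then have "stab \<one> = {\<one>}" using subgroup.one_closed[OF subgroup_stab[OF G.one_closed]] by blast
  then show False using stab_index[OF G.one_closed] assms by simp
qed

text \<open>If \<open>S\<close> has order \<open>p\<close> it is cyclic, and local triviality is
  triviality. In the other orders two distinct stabilisers share a nontrivial element; once the
  obstruction is split off, \<open>zero_on_stabilisers\<close> applies.\<close>

lemma triv_or_card_S:
  assumes b: "GC.cocyc S b" and t: "\<And>g. g \<in> S \<Longrightarrow> GC.triv (generate G {g}) b"
    and nt: "\<not> GC.triv S b"
  shows "card S = p\<^sup>2"
proof (rule ccontr)
  assume ns: "card S \<noteq> p\<^sup>2"
  have "card S \<noteq> p"
  proof
    assume c: "card S = p"
    then have "S \<noteq> {\<one>}" using p_gt_1 by auto
    then obtain g where g: "g \<in> S" "g \<noteq> \<one>" using subgroup.one_closed[OF S.subgroup_axioms] by blast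
    show False using t[OF g(1)] nt generate_eq_if_card[OF S.subgroup_axioms order_refl c g] by simp
  qed
  then obtain y where y: "y \<in> carrier G" "stab y \<noteq> stab \<one>" using exists_other_stab by blast
  then obtain w where w: "w \<in> stab \<one>" "w \<in> stab y" "w \<noteq> \<one>"
    using card_S_if_disjoint[OF G.one_closed y(1)] ns
      subgroup.one_closed[OF subgroup_stab[OF G.one_closed]] subgroup.one_closed[OF subgroup_stab[OF y(1)]] by blast
  have lc: "loc_const b" using loc_const_if_triv[OF t] .
  obtain e where e: "exact (\<lambda>g z. b g z - e g)" "\<forall>k\<in>stab \<one>. b k \<one> = e k" "\<forall>k\<in>stab y. b k y = e k"
    using split[OF b lc G.one_closed y(1) y(2)[symmetric]] .
  have lc': "loc_const (\<lambda>g z. b g z - e g)" using loc_const_diff[OF lc] .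
  have "GC.triv S (\<lambda>g z. b g z - e g)"
    by (rule triv_exact[OF e(1)], rule zero_on_stabilisers[OF e(1) lc' G.one_closed y(1) y(2)[symmetric] _ _ w])
      (auto simp: e)
  moreover have "GC.triv S (\<lambda>g z. e g)"
    by (rule GC.trivI[of "\<lambda>_. 0" _ _ e]) (auto simp: hinv_def)
  ultimately have "GC.triv S (\<lambda>g z. (b g z - e g) + e g)" by (rule GC.triv_add)
  then show False using nt by simp
qed

end

text \<open>The \<open>p\<close>-torsion of the circle is cyclic of prime order, so any nonzero
  element generates it.\<close>

lemma circle_torsion_multiple:
  fixes a a' :: circle
  assumes p: "prime p" and a: "p \<cdot> a = 0" "a \<noteq> 0" and a': "p \<cdot> a' = 0"
  obtains j where "a' = j \<cdot> a"
proof -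
  have p0: "0 < p" using p prime_gt_0_nat by blast
  obtain i where i: "a = i \<cdot> circ (1 / real p)" using circle_torsion[OF p0 a(1)] .
  obtain i' where i': "a' = i' \<cdot> circ (1 / real p)" using circle_torsion[OF p0 a'] .
  have "\<not> p dvd i" using a(2) ntimes_circ_inverse_eq_0_iff[OF p0] i by blast
  then have "coprime i p" using p prime_imp_coprime coprime_commute by blast
  moreover have "0 < i" using \<open>\<not> p dvd i\<close> by (cases i) auto
  ultimately obtain u v where uv: "u * i = v * p + 1" using coprime_bezout_nat by metis
  have "u \<cdot> a = (u * i) \<cdot> circ (1 / real p)" using i by (simp add: ntimes_mult)
  also have "\<dots> = circ (1 / real p)"
    using ntimes_circ_inverse_eq_0_iff[OF p0, of "v * p"] by (simp add: uv ntimes_add_left)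
  finally have "(i' * u) \<cdot> a = a'" using i' by (simp add: ntimes_mult)
  then show ?thesis using that by metis
qed

lemma (in group) normalizer_iff:
  assumes K: "subgroup K G" "finite K"
  shows "g \<in> normalizer G K \<longleftrightarrow> g \<in> carrier G \<and> (\<forall>k\<in>K. g \<otimes> k \<otimes> inv g \<in> K)"
proof -
  have KG: "K \<subseteq> carrier G" using subgroup.subset[OF K(1)] .
  have im: "g <# K #> inv g = (\<lambda>k. g \<otimes> k \<otimes> inv g) ` K" for g
    by (auto simp: l_coset_def r_coset_def)
  have "g <# K #> inv g = K \<longleftrightarrow> (\<forall>k\<in>K. g \<otimes> k \<otimes> inv g \<in> K)" if g: "g \<in> carrier G" for g
  proof
    assume "\<forall>k\<in>K. g \<otimes> k \<otimes> inv g \<in> K"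
    then have "(\<lambda>k. g \<otimes> k \<otimes> inv g) ` K \<subseteq> K" by blast
    moreover have "inj_on (\<lambda>k. g \<otimes> k \<otimes> inv g) K"
      using g KG by (auto simp: inj_on_def subset_iff)
    ultimately show "g <# K #> inv g = K" unfolding im using endo_inj_surj[OF K(2)] by blast
  qed (auto simp: im)
  then show ?thesis using KG by (auto simp: normalizer_def stabilizer_def)
qed

section \<open>The action of the whole group on families of characters\<close>

context core_free_sylow
begin

text \<open>This direction of conjugation matches translation of cosets on the right: it carries
  \<open>stab x\<close> to \<open>stab (x \<otimes> g)\<close>.\<close>

abbreviation conj_by :: "'a \<Rightarrow> 'a \<Rightarrow> 'a" where "conj_by g k \<equiv> inv g \<otimes> k \<otimes> g"

lemma conj_by_S: "\<lbrakk>g \<in> carrier G; k \<in> S\<rbrakk> \<Longrightarrow> conj_by g k \<in> S"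
  using S.inv_op_closed1 by blast

lemma mult_conj_by: "\<lbrakk>g \<in> carrier G; k \<in> carrier G\<rbrakk> \<Longrightarrow> g \<otimes> conj_by g k = k \<otimes> g"
  by (simp add: G.m_assoc[symmetric])

lemma conj_by_mult:
  assumes "g \<in> carrier G" "k \<in> carrier G" "l \<in> carrier G"
  shows "conj_by g (k \<otimes> l) = conj_by g k \<otimes> conj_by g l"
proof -
  have "g \<otimes> (inv g \<otimes> (l \<otimes> g)) = l \<otimes> g" using assms by (simp add: G.m_assoc[symmetric])
  then show ?thesis using assms by (simp add: G.m_assoc)
qed

lemma conj_by_conj_by:
  assumes "g \<in> carrier G" "h \<in> carrier G" "k \<in> carrier G"
  shows "conj_by (g \<otimes> h) k = conj_by h (conj_by g k)"
  using assms by (simp add: G.m_assoc G.inv_mult_group)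

lemma conj_by_commute: "\<lbrakk>s \<in> S; k \<in> S\<rbrakk> \<Longrightarrow> conj_by s k = k"
  using S_commute S_carrier by (metis G.conj_eq_iff(2))

lemma hom_S_pow:
  assumes f: "\<And>k l. \<lbrakk>k \<in> S; l \<in> S\<rbrakk> \<Longrightarrow> f (k \<otimes> l) = f k + (f l :: 'b::ab_group_add)" and k: "k \<in> S"
  shows "f (k [^] (n::nat)) = n \<cdot> f k"
proof (induction n)
  case 0
  have "f (\<one> \<otimes> \<one>) = f \<one> + f \<one>" using f subgroup.one_closed[OF S.subgroup_axioms] by blast
  then show ?case by simp
next
  case (Suc n)
  then show ?case using f[OF k S_pow[OF k, of n]] G.nat_pow_Suc2[OF S_carrier[OF k], of n] by simp
qed

lemma hom_S_torsion:
  assumes f: "\<And>k l. \<lbrakk>k \<in> S; l \<in> S\<rbrakk> \<Longrightarrow> f (k \<otimes> l) = f k + (f l :: 'b::ab_group_add)" and k: "k \<in> S"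
  shows "p \<cdot> f k = 0"
  using hom_S_pow[OF f k, of p] hom_S_pow[OF f k, of 0] S_exponent[OF k] by simp

lemma card_index_S: "coprime (card (G.transv S (carrier G))) p" "0 < card (G.transv S (carrier G))"
proof -
  have "card (G.transv S (carrier G)) = card (rcosets S)"
  proof -
    have "card (G.transv S (carrier G)) = card ((\<lambda>k. S #> k) ` carrier G)"
      unfolding G.transv_def
      by (rule card_image[OF G.inj_rep[OF S.subgroup_axioms G.subgroup_self S.subset]])
    also have "(\<lambda>k. S #> k) ` carrier G = rcosets S" by (auto simp: RCOSETS_def)
    finally show ?thesis .
  qed
  then show "coprime (card (G.transv S (carrier G))) p" using coprime_index by (simp add: coprime_commute)
  then show "0 < card (G.transv S (carrier G))" using p_gt_1 by (cases "card (G.transv S (carrier G))") auto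
qed

text \<open>On stabilisers such a \<open>b\<close> is a family of characters, one for each coset,
  that agree on common elements and are permuted among themselves by \<open>G\<close>.\<close>

definition invariant :: "('a \<Rightarrow> 'a \<Rightarrow> 'b::ab_group_add) \<Rightarrow> bool" where
  "invariant b \<longleftrightarrow> exact b \<and> loc_const b \<and>
     (\<forall>x\<in>carrier G. \<forall>g\<in>carrier G. \<forall>k\<in>stab x. b (conj_by g k) (x \<otimes> g) = b k x)"

lemma invariantD:
  "\<lbrakk>invariant b; x \<in> carrier G; g \<in> carrier G; k \<in> stab x\<rbrakk> \<Longrightarrow> b (conj_by g k) (x \<otimes> g) = b k x"
  unfolding invariant_def by blast

text \<open>After the obstruction on \<open>S\<close> is split, the failure
  \<open>\<delta> g\<close> of invariance under \<open>g\<close> is a character of \<open>S\<close>,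
  and \<open>\<delta>\<close> is a crossed homomorphism that vanishes on \<open>S\<close>. The index
  of \<open>S\<close> is prime to \<open>p\<close> while these characters are killed by
  \<open>p\<close>, so \<open>\<delta>\<close> is the coboundary of a character
  \<open>\<theta>\<close>, which corrects \<open>b\<close>.\<close>

lemma invariant_normal_form:
  fixes b :: "'a \<Rightarrow> 'a \<Rightarrow> 'b::ab_group_add"
  assumes b: "GC.cocyc (carrier G) b" and t: "\<And>g. g \<in> S \<Longrightarrow> GC.triv (generate G {g}) b"
    and c2: "card S = p\<^sup>2"
  obtains e where "invariant (\<lambda>g z. b g z - e g)"
proof -
  have "card S \<noteq> p" using c2 p_gt_1 by (simp add: power2_eq_square)
  then obtain y where y: "y \<in> carrier G" "stab y \<noteq> stab \<one>" using exists_other_stab by blast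
  have lc: "loc_const b" using loc_const_if_triv[OF t] .
  obtain e1 where e1: "exact (\<lambda>g z. b g z - e1 g)"
    and "\<forall>k\<in>stab \<one>. b k \<one> = e1 k" "\<forall>k\<in>stab y. b k y = e1 k"
    using split[OF GC.cocyc_subset[OF b S.subset] lc G.one_closed y(1) y(2)[symmetric]] .
  \<comment> \<open>Extended by 0, since \<open>e1\<close> is controlled on \<open>S\<close> only
    while \<open>b1\<close> has to remain a cocycle on all of \<open>G\<close>.\<close>
  define E where "E g = (if g \<in> S then e1 g else 0)" for g
  define b1 where "b1 g z = b g z - E g" for g z
  have "GC.cocyc (carrier G) (\<lambda>g z. b g z - (0 - 0 + E g))"
    by (rule GC.cocyc_diff[OF b GC.cocyc_coboundary[OF _ order_refl]]) (simp add: hinv_def)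
  then have b1: "GC.cocyc (carrier G) b1" by (simp add: b1_def[abs_def])
  have b1S: "b1 g = (\<lambda>z. b g z - e1 g)" if "g \<in> S" for g
    using that by (intro ext) (simp add: b1_def E_def)
  have ex: "exact b1"
    unfolding exact_def
  proof (intro conjI ballI)
    show "hinv (b1 g)" if "g \<in> S" for g unfolding b1S[OF that] by (rule exact_hinv[OF e1 that])
    show "b1 (g \<otimes> h) x = b1 g x + b1 h (x \<otimes> g)" if "g \<in> S" "h \<in> S" "x \<in> carrier G" for g h x
      unfolding b1S[OF that(1)] b1S[OF that(2)] b1S[OF S_m[OF that(1,2)]] by (rule exactD[OF e1 that])
  qed
  define c where "c g h = b1 g \<one> + b1 h g - b1 (g \<otimes> h) \<one>" for g h
  have b1D: "b1 (g \<otimes> h) z = b1 g z + b1 h (z \<otimes> g) - c g h"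
    if "g \<in> carrier G" "h \<in> carrier G" "z \<in> carrier G" for g h z
    unfolding c_def using GC.cocycD[OF b1 that] .
  have cS: "c g h = 0" if "g \<in> S" "h \<in> S" for g h
    using exactD[OF ex that G.one_closed] S_carrier[OF that(1)] by (simp add: c_def)
  define \<delta> where "\<delta> g k = c g (conj_by g k) - c k g" for g k
  \<comment> \<open>The value of \<open>b1\<close> at
    \<open>k \<otimes> g = g \<otimes> conj_by g k\<close> is expanded in two ways.\<close>
  have D: "b1 (conj_by g k) (x \<otimes> g) = b1 k x + \<delta> g k + b1 g (x \<otimes> k) - b1 g x"
    if g: "g \<in> carrier G" and k: "k \<in> S" and x: "x \<in> carrier G" for g k x
  proof -
    have kG: "k \<in> carrier G" using S_carrier[OF k] .
    have kg: "conj_by g k \<in> carrier G" using g kG by simp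
    have "b1 (k \<otimes> g) x = b1 k x + b1 g (x \<otimes> k) - c k g" using b1D[OF kG g x] .
    moreover have "b1 (k \<otimes> g) x = b1 g x + b1 (conj_by g k) (x \<otimes> g) - c g (conj_by g k)"
      using b1D[OF g kg x] mult_conj_by[OF g kG] by simp
    ultimately have "b1 g x + b1 (conj_by g k) (x \<otimes> g) - c g (conj_by g k) = b1 k x + b1 g (x \<otimes> k) - c k g"
      by simp
    then have "b1 (conj_by g k) (x \<otimes> g) = b1 k x + b1 g (x \<otimes> k) - c k g + c g (conj_by g k) - b1 g x"
      by (simp add: algebra_simps)
    then show ?thesis by (simp add: \<delta>_def algebra_simps)
  qed
  have dh: "\<delta> g (k \<otimes> l) = \<delta> g k + \<delta> g l" if g: "g \<in> carrier G" and k: "k \<in> S" and l: "l \<in> S" for g k l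
  proof -
    note G = g S_carrier[OF k] S_carrier[OF l]
    have "b1 (conj_by g (k \<otimes> l)) g = b1 (conj_by g k) g + b1 (conj_by g l) (g \<otimes> conj_by g k)"
      unfolding conj_by_mult[OF G] using exactD[OF ex conj_by_S[OF g k] conj_by_S[OF g l] g] .
    moreover have "b1 (conj_by g (k \<otimes> l)) g = b1 (k \<otimes> l) \<one> + \<delta> g (k \<otimes> l) + b1 g (k \<otimes> l) - b1 g \<one>"
      using D[OF g S_m[OF k l] G.one_closed] G by simp
    moreover have "b1 (conj_by g k) g = b1 k \<one> + \<delta> g k + b1 g k - b1 g \<one>"
      using D[OF g k G.one_closed] G by simp
    moreover have "b1 (conj_by g l) (g \<otimes> conj_by g k) = b1 l k + \<delta> g l + b1 g (k \<otimes> l) - b1 g k"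
      using D[OF g l G(2)] mult_conj_by[OF G(1,2)] by simp
    moreover have "b1 (k \<otimes> l) \<one> = b1 k \<one> + b1 l k" using exactD[OF ex k l G.one_closed] G by simp
    ultimately have "b1 k \<one> + b1 l k + \<delta> g (k \<otimes> l) + b1 g (k \<otimes> l) - b1 g \<one>
        = (b1 k \<one> + \<delta> g k + b1 g k - b1 g \<one>) + (b1 l k + \<delta> g l + b1 g (k \<otimes> l) - b1 g k)" by simp
    then show ?thesis by (simp add: algebra_simps)
  qed
  have dc: "\<delta> (g \<otimes> h) k = \<delta> g k + \<delta> h (conj_by g k)"
    if g: "g \<in> carrier G" and h: "h \<in> carrier G" and k: "k \<in> S" for g h k
  proof -
    note G = g h S_carrier[OF k]
    have "b1 (conj_by (g \<otimes> h) k) (g \<otimes> h) = b1 k \<one> + \<delta> (g \<otimes> h) k + b1 (g \<otimes> h) k - b1 (g \<otimes> h) \<one>"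
      using D[OF G.m_closed[OF g h] k G.one_closed] G by simp
    moreover have "b1 (conj_by (g \<otimes> h) k) (g \<otimes> h) = b1 (conj_by g k) g + \<delta> h (conj_by g k) + b1 h (k \<otimes> g) - b1 h g"
      using D[OF h conj_by_S[OF g k] g] conj_by_conj_by[OF G] mult_conj_by[OF G(1,3)] by simp
    moreover have "b1 (conj_by g k) g = b1 k \<one> + \<delta> g k + b1 g k - b1 g \<one>"
      using D[OF g k G.one_closed] G by simp
    moreover have "b1 (g \<otimes> h) k = b1 g k + b1 h (k \<otimes> g) - c g h" using b1D[OF G(1,2,3)] .
    moreover have "b1 (g \<otimes> h) \<one> = b1 g \<one> + b1 h g - c g h" using b1D[OF G(1,2) G.one_closed] G by simp
    ultimately have "b1 k \<one> + \<delta> (g \<otimes> h) k + (b1 g k + b1 h (k \<otimes> g) - c g h) - (b1 g \<one> + b1 h g - c g h)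
       = (b1 k \<one> + \<delta> g k + b1 g k - b1 g \<one>) + \<delta> h (conj_by g k) + b1 h (k \<otimes> g) - b1 h g" by simp
    then show ?thesis by (simp add: algebra_simps)
  qed
  have dS: "\<delta> s k = 0" if "s \<in> S" "k \<in> S" for s k
    using that by (simp add: \<delta>_def conj_by_commute cS)
  define f where "f g = (\<lambda>k. if k \<in> S then \<delta> g k else 0)" for g
  define a where "a g u = (\<lambda>k. if k \<in> S then u (conj_by g k) else 0)" for g and u :: "'a \<Rightarrow> 'b"
  define N where "N = card (G.transv S (carrier G))"
  define w where "w k = (\<Sum>r\<in>G.transv S (carrier G). \<delta> (inv r) k)" for k
  have rG: "inv r \<in> carrier G" if "r \<in> G.transv S (carrier G)" for r
    using that G.transv_subset[OF S.subgroup_axioms G.subgroup_self S.subset] by blast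
  have wh: "w (k \<otimes> l) = w k + w l" if "k \<in> S" "l \<in> S" for k l
    unfolding w_def sum.distrib[symmetric] by (rule sum.cong) (use dh[OF rG] that in auto)
  have Nd: "N \<cdot> \<delta> g k = w k - w (conj_by g k)" if g: "g \<in> carrier G" and k: "k \<in> S" for g k
  proof -
    let ?w = "\<Sum>r\<in>G.transv S (carrier G). f (inv r)"
    have "N \<cdot> f g = ?w - a g ?w"
      unfolding N_def
    proof (rule G.crossed_hom_average[OF S.subgroup_axioms G.subgroup_self S.subset])
      show "a g (u + v) = a g u + a g v" for g u v by (auto simp: a_def fun_eq_iff)
      show "f d = 0" if "d \<in> S" for d using dS[OF that] by (auto simp: f_def fun_eq_iff)
      show "f (g \<otimes> h) = f g + a g (f h)" if "g \<in> carrier G" "h \<in> carrier G" for g h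
        using dc[OF that] conj_by_S[OF that(1)] by (auto simp: f_def a_def fun_eq_iff)
    qed (rule g)
    then have "(N \<cdot> f g) k = ?w k - a g ?w k" by simp
    moreover have "(n \<cdot> u) k = n \<cdot> u k" for n and u :: "'a \<Rightarrow> 'b" by (induction n) auto
    moreover have "(\<Sum>r\<in>R. u r) z = (\<Sum>r\<in>R. u r z)" for R and u :: "'a \<Rightarrow> 'a \<Rightarrow> 'b" and z
      by (induction R rule: infinite_finite_induct) auto
    ultimately show ?thesis
      using k conj_by_S[OF g k] by (simp add: f_def a_def w_def)
  qed
  \<comment> \<open>The values of \<open>\<delta> g\<close> on \<open>S\<close> are killed by
    \<open>p\<close>, so there \<open>u\<close> inverts the index \<open>N\<close>.\<close>
  obtain u v where uv: "u * N = v * p + 1"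
    using coprime_bezout_nat[OF card_index_S] unfolding N_def .
  define \<theta> where "\<theta> k = u \<cdot> w k" for k
  have th: "\<theta> (k \<otimes> l) = \<theta> k + \<theta> l" if "k \<in> S" "l \<in> S" for k l
    by (simp add: \<theta>_def wh[OF that] ntimes_add_right)
  have td: "\<delta> g k = \<theta> k - \<theta> (conj_by g k)" if g: "g \<in> carrier G" and k: "k \<in> S" for g k
  proof -
    have "p \<cdot> \<delta> g k = 0" using hom_S_torsion[of "\<delta> g", OF dh[OF g] k] .
    then have "(u * N) \<cdot> \<delta> g k = \<delta> g k" by (simp add: uv ntimes_add_left ntimes_mult)
    then have "\<delta> g k = u \<cdot> N \<cdot> \<delta> g k" by (simp add: ntimes_mult)
    then show ?thesis unfolding Nd[OF g k] by (simp add: \<theta>_def ntimes_diff_right)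
  qed
  let ?e = "\<lambda>k. E k - \<theta> k"
  have be: "b k z - ?e k = b1 k z + \<theta> k" for k z by (simp add: b1_def)
  have "invariant (\<lambda>g z. b g z - ?e g)"
    unfolding invariant_def
  proof (intro conjI ballI)
    show "exact (\<lambda>g z. b g z - ?e g)"
      unfolding be exact_def
    proof (intro conjI ballI)
      show "hinv (\<lambda>z. b1 g z + \<theta> g)" if "g \<in> S" for g using exact_hinv[OF ex that] by (simp add: hinv_def)
      show "b1 (g \<otimes> h) z + \<theta> (g \<otimes> h) = b1 g z + \<theta> g + (b1 h (z \<otimes> g) + \<theta> h)"
        if "g \<in> S" "h \<in> S" "z \<in> carrier G" for g h z
        unfolding exactD[OF ex that] th[OF that(1,2)] by (simp add: algebra_simps)
    qed
    show "loc_const (\<lambda>g z. b g z - ?e g)" using loc_const_diff[OF lc] .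
    fix x g k assume x: "x \<in> carrier G" and g: "g \<in> carrier G" and k: "k \<in> stab x"
    have "b1 g (x \<otimes> k) = b1 g x" using stab_hinv[OF GC.cocyc_hinv[OF b1 g] x k] .
    then have "b1 (conj_by g k) (x \<otimes> g) = b1 k x + (\<theta> k - \<theta> (conj_by g k))"
      using D[OF g stab_S[OF k] x] td[OF g stab_S[OF k]] by simp
    then show "b (conj_by g k) (x \<otimes> g) - ?e (conj_by g k) = b k x - ?e k"
      unfolding be by (simp add: algebra_simps)
  qed
  then show ?thesis using that[of ?e] by blast
qed

lemma triv_add_const:
  assumes "GC.triv D (\<lambda>g z. b g z - e g)"
  shows "GC.triv D b"
proof -
  have "GC.triv D (\<lambda>g z. e g)" by (rule GC.trivI[of "\<lambda>_. 0" _ _ e]) (auto simp: hinv_def)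
  from GC.triv_add[OF assms this] show ?thesis by simp
qed

text \<open>Every stabiliser is conjugate to the one of the base coset, so invariance spreads the
  vanishing to all of them.\<close>

lemma triv_invariant:
  assumes b: "invariant b" and zero: "\<And>k. k \<in> stab \<one> \<Longrightarrow> b k \<one> = 0"
  shows "GC.triv S b"
proof (rule triv_exact)
  show "exact b" using b by (simp add: invariant_def)
  fix x k assume x: "x \<in> carrier G" and k: "k \<in> stab x"
  have kG: "k \<in> carrier G" using S_carrier[OF stab_S[OF k]] .
  let ?k = "x \<otimes> k \<otimes> inv x"
  have kk: "conj_by x ?k = k"
  proof -
    have "inv x \<otimes> (x \<otimes> k \<otimes> inv x) = k \<otimes> inv x" using x kG by (simp add: G.m_assoc[symmetric])
    then show ?thesis using x kG by (simp add: G.m_assoc)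
  qed
  have "?k \<in> stab \<one>"
    unfolding stab_one using k x S.inv_op_closed2[OF x stab_S[OF k]] by (simp add: stab_def)
  then have "b (conj_by x ?k) (\<one> \<otimes> x) = 0"
    using invariantD[OF b G.one_closed x] zero by metis
  then show "b k x = 0" using kk x by simp
qed

lemma card_stab_p: "\<lbrakk>card S = p\<^sup>2; x \<in> carrier G\<rbrakk> \<Longrightarrow> card (stab x) = p"
  using stab_index[of x] p_gt_1 by (simp add: power2_eq_square)

lemma stab_one_gen:
  assumes c2: "card S = p\<^sup>2"
  obtains t where "t \<in> stab \<one>" "t \<noteq> \<one>"
proof -
  have "stab \<one> \<noteq> {\<one>}" using card_stab_p[OF c2 G.one_closed] p_gt_1 by auto
  then show ?thesis using that subgroup.one_closed[OF subgroup_stab[OF G.one_closed]] by blast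
qed

lemma zero_on_stab_one:
  assumes b: "exact b" and c2: "card S = p\<^sup>2" and k: "k \<in> stab \<one>" "k \<noteq> \<one>" "b k \<one> = 0" and l: "l \<in> stab \<one>"
  shows "b l \<one> = 0"
proof -
  obtain i where "l = k [^] (i::nat)"
    using pow_if_card[OF subgroup_stab[OF G.one_closed] stab_subset card_stab_p[OF c2 G.one_closed] k(1,2) l] by blast
  then show ?thesis using exact_stab_pow[OF b G.one_closed k(1)] k(3) by simp
qed

lemma finite_SH: "finite (S \<inter> H)" and subgroup_SH: "subgroup (S \<inter> H) G"
  using finS subgroup_stab[OF G.one_closed] by (auto simp: stab_one)

lemma centralizer_subset_normalizer: "centralizer G (S \<inter> H) \<subseteq> normalizer G (S \<inter> H)"
proof
  fix g assume g: "g \<in> centralizer G (S \<inter> H)"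
  then have gG: "g \<in> carrier G" by (simp add: centralizer_def)
  have "g \<otimes> k \<otimes> inv g = k" if k: "k \<in> S \<inter> H" for k
  proof -
    have kG: "k \<in> carrier G" using k S_carrier by blast
    have "g \<otimes> k = k \<otimes> g" using g k unfolding centralizer_def by blast
    then show ?thesis using G.conj_eq_iff(1)[OF gG kG kG] by blast
  qed
  then show "g \<in> normalizer G (S \<inter> H)"
    unfolding G.normalizer_iff[OF subgroup_SH finite_SH] using gG by simp
qed

text \<open>An element \<open>g\<close> normalising but not centralising the base stabiliser sends
  some generator \<open>k\<close> to \<open>k [^] i\<close> with \<open>i\<close> different from 1.
  As \<open>k\<close> also fixes the coset of \<open>g\<close>, invariance and local constancy give
  \<open>i \<cdot> b k \<one> = b k \<one>\<close>. Together with \<open>p\<close>-torsion this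
  kills \<open>b k \<one>\<close>, and the whole family vanishes.\<close>

lemma normalizer_eq_if_nontrivial:
  assumes c2: "card S = p\<^sup>2" and b: "invariant b" and nt: "\<not> GC.triv S b"
  shows "normalizer G (S \<inter> H) = centralizer G (S \<inter> H)"
proof (rule ccontr)
  assume "\<not> ?thesis"
  then obtain g where g: "g \<in> normalizer G (S \<inter> H)" "g \<notin> centralizer G (S \<inter> H)"
    using centralizer_subset_normalizer by blast
  have gG: "g \<in> carrier G" and gN: "\<And>k. k \<in> S \<inter> H \<Longrightarrow> g \<otimes> k \<otimes> inv g \<in> S \<inter> H"
    using g(1) G.normalizer_iff[OF subgroup_SH finite_SH] by auto
  obtain k where k: "k \<in> S \<inter> H" "g \<otimes> k \<noteq> k \<otimes> g" using g(2) gG by (auto simp: centralizer_def)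
  have kG: "k \<in> carrier G" using k S_carrier by blast
  have k1: "k \<noteq> \<one>" using k(2) gG by auto
  let ?l = "g \<otimes> k \<otimes> inv g"
  have l: "?l \<in> stab \<one>" using gN[OF k(1)] by (simp add: stab_one)
  have kst: "k \<in> stab \<one>" using k by (simp add: stab_one)
  have lk: "conj_by g ?l = k"
  proof -
    have "inv g \<otimes> (g \<otimes> k \<otimes> inv g) = k \<otimes> inv g" using gG kG by (simp add: G.m_assoc[symmetric])
    then show ?thesis using gG kG by (simp add: G.m_assoc)
  qed
  have ne: "?l \<noteq> k" using k(2) gG kG G.conj_eq_iff(1)[OF gG kG kG] by simp
  have ex: "exact b" and lc: "loc_const b" using b by (auto simp: invariant_def)
  have "b (conj_by g ?l) (\<one> \<otimes> g) = b ?l \<one>" using invariantD[OF b G.one_closed gG l] .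
  then have "b k g = b ?l \<one>" using lk gG by simp
  moreover have "k \<in> stab g" using gN[OF k(1)] k by (simp add: stab_def)
  then have "b k g = b k \<one>" using loc_constD[OF lc gG G.one_closed _ kst] by simp
  ultimately have bl: "b ?l \<one> = b k \<one>" by simp
  obtain i where i: "i < p" "?l = k [^] (i::nat)"
    using pow_if_card[OF subgroup_stab[OF G.one_closed] stab_subset card_stab_p[OF c2 G.one_closed] kst k1 l] .
  have eq: "i \<cdot> b k \<one> = b k \<one>" using exact_stab_pow[OF ex G.one_closed kst, of i] bl i by simp
  have pk: "p \<cdot> b k \<one> = 0"
    using exact_stab_pow[OF ex G.one_closed kst, of p] exact_stab_pow[OF ex G.one_closed kst, of 0]
      S_exponent[OF stab_S[OF kst]] by simp
  have "b k \<one> = 0"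
  \<comment> \<open>The value is killed by \<open>i - 1\<close>, called \<open>j\<close>, which has
    to be formed in the natural numbers; hence the separate case \<open>i = 0\<close>.\<close>
  proof (cases i)
    case 0
    then show ?thesis using eq by simp
  next
    case (Suc j)
    then have "j \<cdot> b k \<one> = 0" using eq by simp
    moreover have "j \<noteq> 0"
    proof
      assume "j = 0"
      then show False using ne i(2) Suc kG by simp
    qed
    then have "\<not> p dvd j" using i(1) Suc by (auto dest: dvd_imp_le)
    then have "coprime j p" using prime_imp_coprime[OF prime_p] by (simp add: coprime_commute)
    ultimately show ?thesis using ntimes_coprime_zero pk by blast
  qed
  then have "b l \<one> = 0" if "l \<in> stab \<one>" for l
    using zero_on_stab_one[OF ex c2 kst k1 _ that] by blast
  then show False using triv_invariant[OF b] nt by blast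
qed

end

section \<open>The commutator condition\<close>

context core_free_sylow
begin

abbreviation comm :: "'a set" where "comm \<equiv> commutator_subgroup G S (carrier G)"

lemma comm_gen_subset:
  "{a \<otimes> b \<otimes> inv a \<otimes> inv b | a b. a \<in> S \<and> b \<in> carrier G} \<subseteq> S"
proof clarify
  fix a b assume a: "a \<in> S" and b: "b \<in> carrier G"
  have "a \<otimes> (b \<otimes> inv a \<otimes> inv b) \<in> S"
    using S_m[OF a] S.inv_op_closed2[OF b, of "inv a"] subgroup.m_inv_closed[OF S.subgroup_axioms a] by blast
  then show "a \<otimes> b \<otimes> inv a \<otimes> inv b \<in> S" using S_carrier[OF a] b by (simp add: G.m_assoc)
qed

lemma comm_subset: "comm \<subseteq> S"
  unfolding commutator_subgroup_def using G.generate_subgroup_incl[OF comm_gen_subset S.subgroup_axioms] .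

lemma subgroup_comm: "subgroup comm G"
  unfolding commutator_subgroup_def
  using G.generate_is_subgroup comm_gen_subset S.subset by blast

lemma comm_mem: "\<lbrakk>a \<in> S; b \<in> carrier G\<rbrakk> \<Longrightarrow> a \<otimes> b \<otimes> inv a \<otimes> inv b \<in> comm"
  unfolding commutator_subgroup_def by (rule generate.incl) blast

text \<open>Conjugation by \<open>G\<close> is trivial on \<open>S\<close> modulo
  \<open>comm\<close>, so whatever factors through that quotient is invariant.\<close>

lemma conj_in_coset_comm:
  assumes "s \<in> S" "g \<in> carrier G"
  shows "inv s \<otimes> conj_by g s \<in> comm"
proof -
  have "inv s \<otimes> inv g \<otimes> inv (inv s) \<otimes> inv (inv g) \<in> comm"
    using comm_mem[of "inv s" "inv g"] assms by simp
  then show ?thesis using assms S_carrier by (simp add: G.m_assoc)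
qed

text \<open>If \<open>comm\<close> is proper, it is a complement of the base stabiliser in
  \<open>S\<close>. Projection along it extends the character at the base coset to an invariant
  character \<open>\<theta>\<close> of \<open>S\<close>; subtracting \<open>\<theta>\<close> makes
  the family vanish.\<close>

lemma comm_eq_if_nontrivial:
  fixes b :: "'a \<Rightarrow> 'a \<Rightarrow> 'b::ab_group_add"
  assumes c2: "card S = p\<^sup>2" and b: "invariant b" and nt: "\<not> GC.triv S b"
  shows "comm = S"
proof (rule ccontr)
  assume neq: "comm \<noteq> S"
  have one: "\<one> \<in> carrier G" by simp
  note stb = subgroup_stab[OF one]
  have "card S \<noteq> p" using c2 p_gt_1 by (simp add: power2_eq_square)
  then obtain y where y: "y \<in> carrier G" "stab y \<noteq> stab \<one>" using exists_other_stab by blast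
  \<comment> \<open>If \<open>comm\<close> lay in the base stabiliser, conjugation would preserve
    that stabiliser and all stabilisers would coincide.\<close>
  have nsub: "\<not> comm \<subseteq> stab \<one>"
  proof
    assume sub: "comm \<subseteq> stab \<one>"
    have "stab \<one> \<subseteq> stab y"
    proof
      fix k assume k: "k \<in> stab \<one>"
      have kS: "k \<in> S" and kG: "k \<in> carrier G" using stab_S[OF k] S_carrier by auto
      have "k \<otimes> y \<otimes> inv k \<otimes> inv y \<in> stab \<one>" using comm_mem[OF kS y(1)] sub by blast
      then have "inv k \<otimes> (k \<otimes> y \<otimes> inv k \<otimes> inv y) \<in> stab \<one>"
        using subgroup.m_closed[OF stb] subgroup.m_inv_closed[OF stb k] by blast
      moreover have "inv k \<otimes> (k \<otimes> y \<otimes> inv k \<otimes> inv y) = y \<otimes> inv k \<otimes> inv y"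
        using kG y(1) by (simp add: G.m_assoc[symmetric])
      ultimately have "y \<otimes> inv k \<otimes> inv y \<in> S \<inter> H" by (simp only: stab_one)
      then have "inv k \<in> stab y"
        using subgroup.m_inv_closed[OF S.subgroup_axioms kS] unfolding stab_def by blast
      then have "inv (inv k) \<in> stab y" by (rule subgroup.m_inv_closed[OF subgroup_stab[OF y(1)]])
      then show "k \<in> stab y" using kG by simp
    qed
    then show False
      using card_subset_eq[of "stab y" "stab \<one>"] card_stab[OF y(1)] card_stab[OF one] y(2)
        finite_subset[OF stab_subset finS] by auto
  qed
  then obtain t where t: "t \<in> comm" "t \<notin> stab \<one>" by blast
  have tS: "t \<in> S" using t comm_subset by blast
  \<comment> \<open>A nontrivial common element generates the base stabiliser, and with
    \<open>t\<close> from outside it \<open>comm\<close> would be all of \<open>S\<close>.\<close>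
  have disj: "k = \<one>" if k: "k \<in> comm" "k \<in> stab \<one>" for k
  proof (rule ccontr)
    assume k1: "k \<noteq> \<one>"
    have "S \<subseteq> comm"
    proof
      fix s assume s: "s \<in> S"
      obtain i where i: "s \<otimes> t [^] (i::nat) \<in> stab \<one>" using stab_maximal[OF one tS t(2) s] .
      obtain j where j: "s \<otimes> t [^] i = k [^] (j::nat)"
        using pow_if_card[OF stb stab_subset card_stab_p[OF c2 one] k(2) k1 i] by blast
      have "k [^] j \<otimes> inv (t [^] i) \<in> comm"
        using G.pow_in_subgroup[OF subgroup_comm] k(1) t(1) subgroup.m_closed[OF subgroup_comm]
          subgroup.m_inv_closed[OF subgroup_comm] by blast
      moreover have "k [^] j \<otimes> inv (t [^] i) = s"
        unfolding j[symmetric] using S_carrier[OF s] S_carrier[OF tS] by (simp add: G.m_assoc)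
      ultimately show "s \<in> comm" by simp
    qed
    then show False using neq comm_subset by blast
  qed
  have "\<exists>k. k \<in> stab \<one> \<and> inv k \<otimes> s \<in> comm" if s: "s \<in> S" for s
  proof -
    obtain i where i: "s \<otimes> t [^] (i::nat) \<in> stab \<one>" using stab_maximal[OF one tS t(2) s] .
    have "inv (t [^] i) \<in> comm"
      using G.pow_in_subgroup[OF subgroup_comm] t(1) subgroup.m_inv_closed[OF subgroup_comm] by blast
    moreover have "inv (s \<otimes> t [^] i) \<otimes> s = inv (t [^] i)"
      using S_carrier[OF s] S_carrier[OF tS] by (simp add: G.inv_mult_group G.m_assoc)
    ultimately show ?thesis using i by metis
  qed
  \<comment> \<open>The projection of \<open>S\<close> onto the base stabiliser along
    \<open>comm\<close>; trivial intersection makes it unique and hence multiplicative.\<close>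
  then obtain \<kappa> where \<kappa>: "\<And>s. s \<in> S \<Longrightarrow> \<kappa> s \<in> stab \<one> \<and> inv (\<kappa> s) \<otimes> s \<in> comm" by metis
  have \<kappa>_eq: "\<kappa> s = k" if s: "s \<in> S" and k: "k \<in> stab \<one>" "inv k \<otimes> s \<in> comm" for s k
  proof -
    have G: "s \<in> carrier G" "k \<in> carrier G" "\<kappa> s \<in> carrier G"
      using S_carrier s k stab_S \<kappa>[OF s] by blast+
    have "(inv k \<otimes> s) \<otimes> inv (inv (\<kappa> s) \<otimes> s) \<in> comm"
      using k \<kappa>[OF s] subgroup.m_closed[OF subgroup_comm] subgroup.m_inv_closed[OF subgroup_comm] by blast
    moreover have "(inv k \<otimes> s) \<otimes> inv (inv (\<kappa> s) \<otimes> s) = inv k \<otimes> \<kappa> s"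
    proof -
      have "s \<otimes> (inv s \<otimes> \<kappa> s) = \<kappa> s" using G by (simp add: G.m_assoc[symmetric])
      then show ?thesis using G by (simp add: G.inv_mult_group G.m_assoc)
    qed
    moreover have "inv k \<otimes> \<kappa> s \<in> stab \<one>"
      using k \<kappa>[OF s] subgroup.m_closed[OF stb] subgroup.m_inv_closed[OF stb] by blast
    ultimately have "inv k \<otimes> \<kappa> s = \<one>" using disj by simp
    then show ?thesis using G by (metis G.inv_closed G.inv_equality G.inv_inv)
  qed
  have ex: "exact b" and lc: "loc_const b" using b by (auto simp: invariant_def)
  define \<theta> where "\<theta> s = b (\<kappa> s) \<one>" for s
  have \<kappa>_stab: "\<kappa> k = k" if "k \<in> stab \<one>" for k
    using \<kappa>_eq[OF stab_S[OF that] that] subgroup.one_closed[OF subgroup_comm] S_carrier[OF stab_S[OF that]] by simp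
  have \<theta>_mult: "\<theta> (s \<otimes> u) = \<theta> s + \<theta> u" if s: "s \<in> S" and u: "u \<in> S" for s u
  proof -
    have ks: "\<kappa> s \<in> stab \<one>" "inv (\<kappa> s) \<otimes> s \<in> comm" and ku: "\<kappa> u \<in> stab \<one>" "inv (\<kappa> u) \<otimes> u \<in> comm"
      using \<kappa> s u by auto
    note G = S_carrier[OF s] S_carrier[OF u] S_carrier[OF stab_S[OF ks(1)]] S_carrier[OF stab_S[OF ku(1)]]
    have "(inv (\<kappa> s) \<otimes> s) \<otimes> (inv (\<kappa> u) \<otimes> u) \<in> comm" using ks ku subgroup.m_closed[OF subgroup_comm] by blast
    moreover have "(inv (\<kappa> s) \<otimes> s) \<otimes> (inv (\<kappa> u) \<otimes> u) = inv (\<kappa> s \<otimes> \<kappa> u) \<otimes> (s \<otimes> u)"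
    proof -
      have ik: "inv (\<kappa> u) \<in> S" using subgroup.m_inv_closed[OF S.subgroup_axioms stab_S[OF ku(1)]] .
      have "(inv (\<kappa> s) \<otimes> s) \<otimes> inv (\<kappa> u) = inv (\<kappa> u) \<otimes> (inv (\<kappa> s) \<otimes> s)"
        using S_commute[OF _ ik] ks(2) comm_subset by blast
      then have "(inv (\<kappa> s) \<otimes> s) \<otimes> inv (\<kappa> u) \<otimes> u = inv (\<kappa> u) \<otimes> (inv (\<kappa> s) \<otimes> s) \<otimes> u" by simp
      then show ?thesis using G by (simp add: G.m_assoc G.inv_mult_group)
    qed
    ultimately have "\<kappa> (s \<otimes> u) = \<kappa> s \<otimes> \<kappa> u"
      using \<kappa>_eq[OF S_m[OF s u] subgroup.m_closed[OF stb ks(1) ku(1)]] by simp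
    then show ?thesis using exact_stab[OF ex one ks(1) stab_S[OF ku(1)]] by (simp add: \<theta>_def)
  qed
  have \<theta>_inv: "\<theta> (conj_by g s) = \<theta> s" if s: "s \<in> S" and g: "g \<in> carrier G" for s g
  proof -
    have ks: "\<kappa> s \<in> stab \<one>" "inv (\<kappa> s) \<otimes> s \<in> comm" using \<kappa> s by auto
    note G = S_carrier[OF s] S_carrier[OF stab_S[OF ks(1)]] S_carrier[OF conj_by_S[OF g s]]
    have "(inv (\<kappa> s) \<otimes> s) \<otimes> (inv s \<otimes> conj_by g s) \<in> comm"
      using ks(2) conj_in_coset_comm[OF s g] subgroup.m_closed[OF subgroup_comm] by blast
    moreover have "(inv (\<kappa> s) \<otimes> s) \<otimes> (inv s \<otimes> conj_by g s) = inv (\<kappa> s) \<otimes> conj_by g s"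
    proof -
      have "(inv a \<otimes> s) \<otimes> (inv s \<otimes> c) = inv a \<otimes> c" if "a \<in> carrier G" "c \<in> carrier G" for a c
      proof -
        have "s \<otimes> (inv s \<otimes> c) = c" using G(1) that by (simp add: G.m_assoc[symmetric])
        then show ?thesis using G(1) that by (simp add: G.m_assoc)
      qed
      then show ?thesis using G(2,3) by blast
    qed
    ultimately have "\<kappa> (conj_by g s) = \<kappa> s" using \<kappa>_eq[OF conj_by_S[OF g s] ks(1)] by simp
    then show ?thesis by (simp add: \<theta>_def)
  qed
  have "GC.triv S (\<lambda>g z. b g z - \<theta> g)"
  proof (rule triv_invariant)
    show "invariant (\<lambda>g z. b g z - \<theta> g)"
      unfolding invariant_def
    proof (intro conjI ballI)
      show "exact (\<lambda>g z. b g z - \<theta> g)"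
        unfolding exact_def
      proof (intro conjI ballI)
        show "hinv (\<lambda>z. b g z - \<theta> g)" if "g \<in> S" for g using exact_hinv[OF ex that] by (simp add: hinv_def)
        show "b (g \<otimes> h) z - \<theta> (g \<otimes> h) = b g z - \<theta> g + (b h (z \<otimes> g) - \<theta> h)"
          if "g \<in> S" "h \<in> S" "z \<in> carrier G" for g h z
          unfolding exactD[OF ex that] \<theta>_mult[OF that(1,2)] by (simp add: algebra_simps)
      qed
      show "loc_const (\<lambda>g z. b g z - \<theta> g)" using loc_const_diff[OF lc] .
      show "b (conj_by g k) (x \<otimes> g) - \<theta> (conj_by g k) = b k x - \<theta> k"
        if "x \<in> carrier G" "g \<in> carrier G" "k \<in> stab x" for x g k
        unfolding invariantD[OF b that] \<theta>_inv[OF stab_S[OF that(3)] that(2)] ..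
    qed
    show "b k \<one> - \<theta> k = 0" if "k \<in> stab \<one>" for k using \<kappa>_stab[OF that] by (simp add: \<theta>_def)
  qed
  then show False using nt triv_add_const by blast
qed

lemma necessary_conditions:
  fixes b :: "'a \<Rightarrow> 'a \<Rightarrow> circle"
  assumes b: "GC.cocyc (carrier G) b" and t: "\<And>g. g \<in> S \<Longrightarrow> GC.triv (generate G {g}) b"
    and nt: "\<not> GC.triv S b"
  shows "card S = p\<^sup>2" "comm = S" "normalizer G (S \<inter> H) = centralizer G (S \<inter> H)"
proof -
  show c2: "card S = p\<^sup>2" using triv_or_card_S[OF GC.cocyc_subset[OF b S.subset] t nt] .
  obtain e where inv: "invariant (\<lambda>g z. b g z - e g)"
    using invariant_normal_form[OF b t c2] .
  have nt': "\<not> GC.triv S (\<lambda>g z. b g z - e g)" using nt triv_add_const by blast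
  show "comm = S" by (rule comm_eq_if_nontrivial[OF c2 inv nt'])
  show "normalizer G (S \<inter> H) = centralizer G (S \<inter> H)" by (rule normalizer_eq_if_nontrivial[OF c2 inv nt'])
qed

text \<open>The value at \<open>k0\<close> determines an invariant family, because \<open>k0\<close>
  generates the base stabiliser. That value lies in the \<open>p\<close>-torsion of the circle,
  which \<open>b0 k0 \<one>\<close> generates.\<close>

lemma multiple_of_invariant:
  fixes b b0 :: "'a \<Rightarrow> 'a \<Rightarrow> circle"
  assumes b: "GC.cocyc (carrier G) b" and t: "\<And>g. g \<in> S \<Longrightarrow> GC.triv (generate G {g}) b"
    and c2: "card S = p\<^sup>2" and b0: "invariant b0" and k0: "k0 \<in> stab \<one>" "b0 k0 \<one> \<noteq> 0"
  obtains j where "GC.triv S (\<lambda>g z. b g z - j \<cdot> b0 g z)"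
proof -
  obtain e where inv: "invariant (\<lambda>g z. b g z - e g)"
    using invariant_normal_form[OF b t c2] .
  have e: "exact (\<lambda>g z. b g z - e g)" "loc_const (\<lambda>g z. b g z - e g)"
    using inv by (simp_all add: invariant_def)
  have ex0: "exact b0" and lc0: "loc_const b0" using b0 by (auto simp: invariant_def)
  have tor: "p \<cdot> c k0 \<one> = 0" if "exact c" for c :: "'a \<Rightarrow> 'a \<Rightarrow> circle"
    using exact_stab_pow[OF that G.one_closed k0(1), of p] exact_stab_pow[OF that G.one_closed k0(1), of 0]
      S_exponent[OF stab_S[OF k0(1)]] by simp
  obtain j where j: "b k0 \<one> - e k0 = j \<cdot> b0 k0 \<one>"
    using circle_torsion_multiple[OF prime_p tor[OF ex0] k0(2) tor[OF e(1)]] .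
  have k1: "k0 \<noteq> \<one>"
    using k0(2) exact_stab_pow[OF ex0 G.one_closed k0(1), of 0] by auto
  define c where "c g z = b g z - j \<cdot> b0 g z - e g" for g z
  have invc: "invariant c"
    unfolding invariant_def
  proof (intro conjI ballI)
    show "exact c"
      unfolding exact_def
    proof (intro conjI ballI)
      show "hinv (c g)" if "g \<in> S" for g
        using exact_hinv[OF e(1) that] exact_hinv[OF ex0 that] by (simp add: hinv_def c_def)
      show "c (g \<otimes> h) z = c g z + c h (z \<otimes> g)" if "g \<in> S" "h \<in> S" "z \<in> carrier G" for g h z
        using exactD[OF e(1) that] exactD[OF ex0 that]
        by (simp add: c_def ntimes_add_right algebra_simps)
    qed
    show "loc_const c"
      unfolding loc_const_def
    proof (intro ballI)
      fix x y k assume h: "x \<in> carrier G" "y \<in> carrier G" "k \<in> stab x \<inter> stab y"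
      then have "b k x - e k = b k y - e k" "b0 k x = b0 k y"
        using loc_constD[OF e(2) h(1,2)] loc_constD[OF lc0 h(1,2)] by auto
      then show "c k x = c k y" by (simp add: c_def)
    qed
    show "c (conj_by g k) (x \<otimes> g) = c k x" if "x \<in> carrier G" "g \<in> carrier G" "k \<in> stab x" for x g k
    proof -
      have "c (conj_by g k) (x \<otimes> g) = (b (conj_by g k) (x \<otimes> g) - e (conj_by g k)) - j \<cdot> b0 (conj_by g k) (x \<otimes> g)"
        by (simp add: c_def)
      also have "\<dots> = (b k x - e k) - j \<cdot> b0 k x" unfolding invariantD[OF inv that] invariantD[OF b0 that] ..
      finally show ?thesis by (simp add: c_def)
    qed
  qed
  have "c k0 \<one> = 0"
  proof -
    have "c k0 \<one> = (b k0 \<one> - e k0) - j \<cdot> b0 k0 \<one>" by (simp add: c_def)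
    then show ?thesis using j by simp
  qed
  then have "c l \<one> = 0" if "l \<in> stab \<one>" for l
    using zero_on_stab_one[OF _ c2 k0(1) k1 _ that, of c] invc by (simp add: invariant_def)
  then have "GC.triv S c" using triv_invariant[OF invc] by blast
  then have "GC.triv S (\<lambda>g z. b g z - j \<cdot> b0 g z)"
    using triv_add_const[of S "\<lambda>g z. b g z - j \<cdot> b0 g z" e] by (simp add: c_def[abs_def])
  then show ?thesis using that by blast
qed

end

section \<open>A nontrivial class by transfer\<close>

context group
begin

lemma rcoset_eq_iff:
  assumes K: "subgroup K G" and a: "a \<in> carrier G" and b: "b \<in> carrier G"
  shows "K #> a = K #> b \<longleftrightarrow> a \<otimes> inv b \<in> K"
proof
  assume "K #> a = K #> b"
  then have "a \<in> K #> b" using rcos_self[OF a K] by simp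
  then obtain k where k: "k \<in> K" "a = k \<otimes> b" by (auto simp: r_coset_def)
  then show "a \<otimes> inv b \<in> K" using b subgroup.mem_carrier[OF K] by (simp add: m_assoc)
next
  assume "a \<otimes> inv b \<in> K"
  then have "(a \<otimes> inv b) \<otimes> b \<in> K #> b" unfolding r_coset_def by blast
  then have "a \<in> K #> b" using a b by (simp add: m_assoc)
  then show "K #> a = K #> b" using repr_independence[OF _ b K] by simp
qed

text \<open>The component in \<open>K\<close> of \<open>h\<close>, when \<open>h\<close> is written
  as an element of \<open>K\<close> times the chosen representative of its coset.\<close>

definition retr :: "'a set \<Rightarrow> 'a \<Rightarrow> 'a" where
  "retr K h = h \<otimes> inv (SOME x. x \<in> K #> h)"

lemma retr_mem:
  assumes K: "subgroup K G" and h: "h \<in> carrier G"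
  shows "retr K h \<in> K"
proof -
  have "(SOME x. x \<in> K #> h) \<in> K #> h" using rcos_self[OF h K] by (rule someI)
  then obtain k where k: "k \<in> K" "(SOME x. x \<in> K #> h) = k \<otimes> h" by (auto simp: r_coset_def)
  have kG: "k \<in> carrier G" using k(1) subgroup.subset[OF K] by blast
  have "retr K h = inv k"
  proof -
    have "h \<otimes> (inv h \<otimes> inv k) = inv k" using h kG by (simp add: m_assoc[symmetric])
    then show ?thesis using h kG by (simp add: retr_def k(2) inv_mult_group)
  qed
  then show ?thesis using subgroup.m_inv_closed[OF K k(1)] by simp
qed

lemma retr_mult:
  assumes K: "subgroup K G" and h: "h \<in> carrier G" and k: "k \<in> K"
  shows "retr K (k \<otimes> h) = k \<otimes> retr K h"
proof -
  have kG: "k \<in> carrier G" using k subgroup.subset[OF K] by blast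
  have eq: "K #> (k \<otimes> h) = K #> h"
    unfolding rcoset_eq_iff[OF K m_closed[OF kG h] h] using k kG h by (simp add: m_assoc)
  have "(SOME x. x \<in> K #> h) \<in> K #> h" using rcos_self[OF h K] by (rule someI)
  then have "(SOME x. x \<in> K #> h) \<in> carrier G"
    using r_coset_subset_G[OF subgroup.subset[OF K] h] by blast
  then show ?thesis unfolding retr_def eq using kG h by (simp add: m_assoc)
qed

text \<open>The transfer from \<open>H\<close> to \<open>K\<close>, followed by the character
  \<open>a\<close>. Subtracting \<open>a (retr K q)\<close> makes each summand constant on cosets of
  \<open>K\<close>, as \<open>sum_transv\<close> requires. An element \<open>k\<close> of
  \<open>K\<close> commutes with \<open>q\<close> and shifts every summand by \<open>a k\<close>,
  whence the factor equal to the index.\<close>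

lemma transfer_hom:
  fixes a :: "'a \<Rightarrow> 'w::ab_group_add"
  assumes K: "subgroup K G" and H: "subgroup H G" and KH: "K \<subseteq> H"
    and central: "\<And>h k. \<lbrakk>h \<in> H; k \<in> K\<rbrakk> \<Longrightarrow> h \<otimes> k = k \<otimes> h"
    and a: "\<And>k l. \<lbrakk>k \<in> K; l \<in> K\<rbrakk> \<Longrightarrow> a (k \<otimes> l) = a k + a l"
  defines "\<chi> \<equiv> \<lambda>h. \<Sum>q\<in>transv K H. a (retr K (q \<otimes> h)) - a (retr K q)"
  shows "\<lbrakk>h \<in> H; h' \<in> H\<rbrakk> \<Longrightarrow> \<chi> (h \<otimes> h') = \<chi> h + \<chi> h'"
    and "k \<in> K \<Longrightarrow> \<chi> k = card (transv K H) \<cdot> a k"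
    and "\<lbrakk>\<And>k. k \<in> K \<Longrightarrow> n \<cdot> a k = 0; h \<in> H\<rbrakk> \<Longrightarrow> n \<cdot> \<chi> h = 0"
proof -
  have HG: "h \<in> carrier G" if "h \<in> H" for h using that subgroup.subset[OF H] by blast
  have tH: "q \<in> H" if "q \<in> transv K H" for q using that transv_subset[OF K H KH] by blast
  have rm: "retr K h \<in> K" if "h \<in> H" for h using retr_mem[OF K HG[OF that]] .
  note Hm = subgroup.m_closed[OF H]
  show "\<chi> (h \<otimes> h') = \<chi> h + \<chi> h'" if h: "h \<in> H" and h': "h' \<in> H" for h h'
  proof -
    have "(\<Sum>q\<in>transv K H. a (retr K (q \<otimes> h \<otimes> h')) - a (retr K (q \<otimes> h))) = \<chi> h'"
      unfolding \<chi>_def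
    proof (rule sum_transv[OF K H KH _ h, where f = "\<lambda>q. a (retr K (q \<otimes> h')) - a (retr K q)"])
      fix d k assume d: "d \<in> K" and k: "k \<in> H"
      have dG: "d \<in> carrier G" using d KH HG by blast
      have "retr K (d \<otimes> k \<otimes> h') = d \<otimes> retr K (k \<otimes> h')"
        using retr_mult[OF K HG[OF Hm[OF k h']] d] dG HG[OF k] HG[OF h'] by (simp add: m_assoc)
      moreover have "retr K (d \<otimes> k) = d \<otimes> retr K k" using retr_mult[OF K HG[OF k] d] .
      ultimately show "a (retr K (d \<otimes> k \<otimes> h')) - a (retr K (d \<otimes> k)) = a (retr K (k \<otimes> h')) - a (retr K k)"
        using a[OF d rm[OF Hm[OF k h']]] a[OF d rm[OF k]] by simp
    qed
    moreover have "\<chi> (h \<otimes> h') = (\<Sum>q\<in>transv K H. a (retr K (q \<otimes> h \<otimes> h')) - a (retr K q))"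
      unfolding \<chi>_def by (rule sum.cong) (use tH HG h h' in \<open>auto simp: m_assoc\<close>)
    moreover have "\<dots> = (\<Sum>q\<in>transv K H. (a (retr K (q \<otimes> h \<otimes> h')) - a (retr K (q \<otimes> h))) + (a (retr K (q \<otimes> h)) - a (retr K q)))"
      by simp
    ultimately show ?thesis by (simp only: sum.distrib) (simp add: \<chi>_def add.commute)
  qed
  show "\<chi> k = card (transv K H) \<cdot> a k" if k: "k \<in> K" for k
  proof -
    have "a (retr K (q \<otimes> k)) - a (retr K q) = a k" if q: "q \<in> transv K H" for q
    proof -
      have "q \<otimes> k = k \<otimes> q" using central[OF tH[OF q] k] .
      then have "retr K (q \<otimes> k) = k \<otimes> retr K q" using retr_mult[OF K HG[OF tH[OF q]] k] by simp
      then show ?thesis using a[OF k rm[OF tH[OF q]]] by simp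
    qed
    then show ?thesis by (simp add: \<chi>_def sum_constant_ntimes)
  qed
  show "n \<cdot> \<chi> h = 0" if z: "\<And>k. k \<in> K \<Longrightarrow> n \<cdot> a k = 0" and h: "h \<in> H"
    unfolding \<chi>_def ntimes_sum
    by (rule sum.neutral) (use z rm Hm tH h in \<open>auto simp: ntimes_diff_right\<close>)
qed

end

context normal_sylow
begin

text \<open>Different cosets of \<open>S \<inter> D\<close> in \<open>D\<close> lie in different
  cosets of \<open>S\<close>. The index is therefore the order of the image of \<open>D\<close> in
  the quotient, which is prime to \<open>p\<close>.\<close>

lemma coprime_transv:
  assumes D: "subgroup D G"
  shows "subgroup (S \<inter> D) G" "coprime (card (G.transv (S \<inter> D) D)) p" "0 < card (G.transv (S \<inter> D) D)"
proof -
  show SD: "subgroup (S \<inter> D) G" using G.subgroups_Inter_pair[OF S.subgroup_axioms D] .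
  have DG: "h \<in> carrier G" if "h \<in> D" for h using that subgroup.subset[OF D] by blast
  have "card (G.transv (S \<inter> D) D) = card ((\<lambda>k. (S \<inter> D) #> k) ` D)"
    unfolding G.transv_def by (rule card_image[OF G.inj_rep[OF SD D]]) blast
  also have "\<dots> = card ((\<lambda>k. S #> k) ` D)"
  proof (rule card_image_eq)
    fix h h' assume h: "h \<in> D" "h' \<in> D"
    then have "h \<otimes> inv h' \<in> D" using subgroup.m_closed[OF D] subgroup.m_inv_closed[OF D] by blast
    then show "(S \<inter> D) #> h = (S \<inter> D) #> h' \<longleftrightarrow> S #> h = S #> h'"
      using G.rcoset_eq_iff[OF SD DG DG] G.rcoset_eq_iff[OF S.subgroup_axioms DG DG] h by simp
  qed
  finally show cp: "coprime (card (G.transv (S \<inter> D) D)) p" using card_Mod_dvd[OF subgroup_image_Mod[OF D]] by simp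
  then show "0 < card (G.transv (S \<inter> D) D)" using prime_gt_1_nat[OF prime_p] by (cases "card (G.transv (S \<inter> D) D)") auto
qed

end

context core_free_sylow
begin

text \<open>Corestriction from \<open>S \<inter> D\<close> kills the class up to an index prime to
  \<open>p\<close>, and \<open>p ^ k\<close> kills it as well.\<close>

lemma triv_if_triv_on_Sylow:
  assumes D: "subgroup D G" and b: "GC.cocyc (carrier G) b" and t: "GC.triv (S \<inter> D) b"
    and k: "GC.triv D (\<lambda>g x. (p ^ k) \<cdot> b g x)"
  shows "GC.triv D b"
proof -
  note c = coprime_transv[OF D]
  have "GC.triv D (\<lambda>g x. card (G.transv (S \<inter> D) D) \<cdot> b g x)"
    by (rule GC.triv_average[OF c(1) D _ GC.cocyc_subset[OF b subgroup.subset[OF D]] t]) blast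
  moreover have "coprime (card (G.transv (S \<inter> D) D)) (p ^ k)" using c(2) by simp
  ultimately show ?thesis using GC.triv_coprime c(3) k by blast
qed

text \<open>The exponent of a power of \<open>t\<close> is determined modulo \<open>p\<close>, hence
  so is the corresponding multiple of \<open>1 / p\<close> in the circle.\<close>

lemma pow_eq_ntimes:
  assumes t: "t \<in> S" "t \<noteq> \<one>" and eq: "t [^] (i::nat) = t [^] (j::nat)"
  shows "i \<cdot> circ (1 / real p) = j \<cdot> circ (1 / real p)"
proof -
  have *: "i \<cdot> circ (1 / real p) = j \<cdot> circ (1 / real p)" if "i \<le> j" "t [^] i = t [^] j" for i j :: nat
  proof -
    have tG: "t \<in> carrier G" using S_carrier[OF t(1)] .
    have "t [^] i \<otimes> t [^] (j - i) = t [^] j" using that(1) tG by (simp add: G.nat_pow_mult)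
    then have "t [^] i \<otimes> t [^] (j - i) = t [^] i \<otimes> \<one>" using that(2) tG by simp
    then have "t [^] (j - i) = \<one>" using tG by simp
    then have "p dvd j - i" using G.pow_eq_id[OF tG] ord_S[OF t] by simp
    then have "(j - i) \<cdot> circ (1 / real p) = 0" using ntimes_circ_inverse_eq_0_iff[of p "j - i"] p_gt_1 by simp
    moreover have "j = (j - i) + i" using that by simp
    ultimately show ?thesis by (metis ntimes_add_left add_0)
  qed
  show ?thesis
  proof (cases "i \<le> j")
    case True
    then show ?thesis using eq by (rule *)
  next
    case False
    then have "j \<le> i" by simp
    then show ?thesis using eq[symmetric] by (rule *[symmetric])
  qed
qed

text \<open>A nonzero character of the base stabiliser is transferred to \<open>H\<close> and then
  induced to \<open>G\<close>. Condition (c) makes the transfer act on the stabiliser as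
  multiplication by an index prime to \<open>p\<close> and makes the family locally constant;
  condition (b) keeps it from being a coboundary.\<close>

lemma existence:
  assumes c2: "card S = p\<^sup>2" and cm: "comm = S" and nz: "normalizer G (S \<inter> H) = centralizer G (S \<inter> H)"
  obtains b0 :: "'a \<Rightarrow> 'a \<Rightarrow> circle" and k0 where "GC.cocyc (carrier G) b0" "invariant b0" "k0 \<in> stab \<one>" "b0 k0 \<one> \<noteq> 0"
    "\<forall>g\<in>carrier G. \<forall>x\<in>carrier G. p \<cdot> b0 g x = 0" "\<forall>D. subgroup D G \<longrightarrow> \<not> S \<subseteq> D \<longrightarrow> GC.triv D b0"
    "\<not> GC.triv (carrier G) b0"
proof -
  let ?K = "S \<inter> H"
  obtain t where t: "t \<in> stab \<one>" "t \<noteq> \<one>" using stab_one_gen[OF c2] .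
  have tS: "t \<in> S" using t stab_S by blast
  note stb = subgroup_stab[OF G.one_closed]
  have KG: "k \<in> carrier G" if "k \<in> ?K" for k using that S_carrier by blast
  have pow: "\<exists>i. k = t [^] (i::nat)" if "k \<in> ?K" for k
    using pow_if_card[OF stb stab_subset card_stab_p[OF c2 G.one_closed] t] that stab_one by metis
  have powK: "t [^] (i::nat) \<in> ?K" for i using G.pow_in_subgroup[OF stb t(1)] stab_one by blast
  \<comment> \<open>The character sending the generator \<open>t\<close> to
    \<open>1 / p\<close>.\<close>
  define a where "a k = (SOME i::nat. k = t [^] i) \<cdot> circ (1 / real p)" for k
  have at: "a (t [^] (i::nat)) = i \<cdot> circ (1 / real p)" for i
  proof -
    have "t [^] i = t [^] (SOME j::nat. t [^] i = t [^] j)" by (rule someI[of _ i]) simp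
    then show ?thesis unfolding a_def by (rule pow_eq_ntimes[OF tS t(2), symmetric])
  qed
  have a_mult: "a (k \<otimes> l) = a k + a l" if k: "k \<in> ?K" and l: "l \<in> ?K" for k l
  proof -
    obtain i j :: nat where ij: "k = t [^] i" "l = t [^] j" using pow[OF k] pow[OF l] by blast
    then have "k \<otimes> l = t [^] (i + j)" using S_carrier[OF tS] by (simp add: G.nat_pow_mult)
    then show ?thesis using ij by (simp add: at ntimes_add_left)
  qed
  have a_tor: "p \<cdot> a k = 0" if k: "k \<in> ?K" for k
  proof -
    obtain i :: nat where i: "k = t [^] i" using pow[OF k] by blast
    have "p \<cdot> a k = i \<cdot> p \<cdot> circ (1 / real p)" unfolding i at by (rule ntimes_commute)
    also have "p \<cdot> circ (1 / real p) = 0" using ntimes_circ_inverse_eq_0_iff[of p p] p_gt_1 by simp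
    finally show ?thesis by simp
  qed
  \<comment> \<open>\<open>H\<close> normalises \<open>S \<inter> H\<close> because \<open>S\<close>
    is normal, so by hypothesis it centralises it; the transfer formula needs this.\<close>
  have central: "h \<otimes> k = k \<otimes> h" if "h \<in> H" "k \<in> ?K" for h k
  proof -
    have "h \<in> normalizer G ?K"
      unfolding G.normalizer_iff[OF subgroup_SH finite_SH]
    proof (intro conjI ballI IntI)
      show "h \<in> carrier G" using H_carrier[OF that(1)] .
      fix l assume l: "l \<in> ?K"
      show "h \<otimes> l \<otimes> inv h \<in> S" using S.inv_op_closed2[OF H_carrier[OF that(1)]] l by blast
      show "h \<otimes> l \<otimes> inv h \<in> H"
        using l that(1) subgroup.m_closed[OF subgroup_H] subgroup.m_inv_closed[OF subgroup_H] by blast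
    qed
    then show ?thesis using nz that(2) unfolding centralizer_def by blast
  qed
  define \<chi> where "\<chi> h = (\<Sum>q\<in>G.transv ?K H. a (G.retr ?K (q \<otimes> h)) - a (G.retr ?K q))" for h
  define N where "N = card (G.transv ?K H)"
  have KH: "?K \<subseteq> H" by blast
  note tr = G.transfer_hom[OF subgroup_SH subgroup_H KH central a_mult, folded \<chi>_def N_def]
  have \<chi>_mult: "\<chi> (h \<otimes> h') = \<chi> h + \<chi> h'" if "h \<in> H" "h' \<in> H" for h h'
    using tr(1) that unfolding \<chi>_def by blast
  have \<chi>_K: "\<chi> k = N \<cdot> a k" if "k \<in> ?K" for k
    using tr(2) that unfolding \<chi>_def by blast
  have \<chi>_tor: "p \<cdot> \<chi> h = 0" if "h \<in> H" for h
    using tr(3) a_tor that unfolding \<chi>_def by blast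
  have N: "coprime N p" using coprime_transv(2)[OF subgroup_H] by (simp add: N_def)
  define \<rho> where "\<rho> x = G.retr H x" for x
  have \<rho>H: "\<rho> x \<in> H" if "x \<in> carrier G" for x unfolding \<rho>_def by (rule G.retr_mem[OF subgroup_H that])
  have \<rho>m: "\<rho> (h \<otimes> x) = h \<otimes> \<rho> x" if "x \<in> carrier G" "h \<in> H" for h x
    unfolding \<rho>_def by (rule G.retr_mult[OF subgroup_H that])
  \<comment> \<open>Formally the coboundary of \<open>\<chi>\<close> composed with
    \<open>\<rho>\<close>. That composite changes by \<open>\<chi> h\<close> under left
    multiplication by \<open>h\<close>, so only its differences are functions on cosets, and
    \<open>b0\<close> need not be trivial.\<close>
  define b0 where "b0 g x = \<chi> (\<rho> (x \<otimes> g)) - \<chi> (\<rho> x)" for g x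
  have hv: "hinv (b0 g)" if g: "g \<in> carrier G" for g
    unfolding hinv_def
  proof (intro ballI)
    fix x h assume x: "x \<in> carrier G" and h: "h \<in> H"
    have "\<rho> (h \<otimes> x \<otimes> g) = h \<otimes> \<rho> (x \<otimes> g)"
      using \<rho>m[OF G.m_closed[OF x g] h] x g H_carrier[OF h] by (simp add: G.m_assoc)
    then show "b0 g (h \<otimes> x) = b0 g x"
      unfolding b0_def \<rho>m[OF x h] using \<chi>_mult[OF h \<rho>H[OF x]] \<chi>_mult[OF h \<rho>H[OF G.m_closed[OF x g]]] by simp
  qed
  have mult: "b0 (g \<otimes> h) x = b0 g x + b0 h (x \<otimes> g)" if "g \<in> carrier G" "h \<in> carrier G" "x \<in> carrier G" for g h x
    using that by (simp add: b0_def G.m_assoc)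
  have coc: "GC.cocyc (carrier G) b0"
    by (rule GC.cocycI) (use hv mult in \<open>auto simp: mult\<close>)
  have ex: "exact b0" unfolding exact_def using hv mult S_carrier by blast
  have val: "b0 k x = N \<cdot> a (x \<otimes> k \<otimes> inv x)" and valK: "x \<otimes> k \<otimes> inv x \<in> ?K"
    if x: "x \<in> carrier G" and k: "k \<in> stab x" for k x
  proof -
    have kG: "k \<in> carrier G" using S_carrier[OF stab_S[OF k]] .
    show K: "x \<otimes> k \<otimes> inv x \<in> ?K"
      using k S.inv_op_closed2[OF x stab_S[OF k]] by (simp add: stab_def)
    have "x \<otimes> k = (x \<otimes> k \<otimes> inv x) \<otimes> x" using x kG by (simp add: G.m_assoc)
    then have "\<rho> (x \<otimes> k) = (x \<otimes> k \<otimes> inv x) \<otimes> \<rho> x" using \<rho>m[OF x, of "x \<otimes> k \<otimes> inv x"] K by simp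
    then have "b0 k x = \<chi> (x \<otimes> k \<otimes> inv x)"
      unfolding b0_def using \<chi>_mult[OF _ \<rho>H[OF x], of "x \<otimes> k \<otimes> inv x"] K by simp
    then show "b0 k x = N \<cdot> a (x \<otimes> k \<otimes> inv x)" using \<chi>_K[OF K] by simp
  qed
  \<comment> \<open>The quotient of \<open>y\<close> by \<open>x\<close> conjugates one nontrivial
    element of \<open>S \<inter> H\<close> to another. This group has prime order, so it is
    normalised, and by hypothesis centralised, by that quotient.\<close>
  have same: "x \<otimes> k \<otimes> inv x = y \<otimes> k \<otimes> inv y"
    if x: "x \<in> carrier G" and y: "y \<in> carrier G" and k: "k \<in> stab x" "k \<in> stab y" for x y k
  proof (cases "k = \<one>")
    case True
    then show ?thesis using x y by simp
  next
    case False
    have kG: "k \<in> carrier G" using S_carrier[OF stab_S[OF k(1)]] .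
    define u v g where "u = x \<otimes> k \<otimes> inv x" and "v = y \<otimes> k \<otimes> inv y" and "g = y \<otimes> inv x"
    have uK: "u \<in> ?K" and vK: "v \<in> ?K" using valK[OF x k(1)] valK[OF y k(2)] by (simp_all add: u_def v_def)
    have gG: "g \<in> carrier G" using x y by (simp add: g_def)
    have u1: "u \<noteq> \<one>"
    proof
      assume "u = \<one>"
      then have "x \<otimes> k = \<one> \<otimes> x" using G.conj_eq_iff(1)[OF x kG G.one_closed] by (simp add: u_def)
      then show False using False x kG by simp
    qed
    have gu: "g \<otimes> u = v \<otimes> g"
    proof -
      have "inv x \<otimes> (x \<otimes> (k \<otimes> inv x)) = k \<otimes> inv x" "inv y \<otimes> (y \<otimes> inv x) = inv x"
        using x y kG by (simp_all add: G.m_assoc[symmetric])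
      then show ?thesis unfolding g_def u_def v_def using x y kG by (simp add: G.m_assoc)
    qed
    have gu': "g \<otimes> u \<otimes> inv g = v" using gu G.conj_eq_iff(1)[OF gG KG[OF uK] KG[OF vK]] by simp
    have "g \<otimes> w \<otimes> inv g \<in> ?K" if w: "w \<in> ?K" for w
    proof -
      have ust: "u \<in> stab \<one>" and wst: "w \<in> stab \<one>" using uK w stab_one by auto
      obtain i where i: "w = u [^] (i::nat)"
        using pow_if_card[OF stb stab_subset card_stab_p[OF c2 G.one_closed] ust u1 wst] by blast
      have "g \<otimes> u [^] j \<otimes> inv g = v [^] j" for j :: nat
      proof (induction j)
        case (Suc j)
        have "g \<otimes> (u [^] j \<otimes> u) \<otimes> inv g = (g \<otimes> u [^] j \<otimes> inv g) \<otimes> (g \<otimes> u \<otimes> inv g)"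
          by (rule conj_mult) (use gG KG[OF uK] in auto)
        then show ?case using Suc gu' by simp
      qed (use gG in simp)
      then show ?thesis unfolding i using G.pow_in_subgroup[OF subgroup_SH vK] by simp
    qed
    then have "g \<in> centralizer G ?K"
      using nz G.normalizer_iff[OF subgroup_SH finite_SH] gG by blast
    then have "g \<otimes> u = u \<otimes> g" using uK unfolding centralizer_def by blast
    then have "v \<otimes> g = u \<otimes> g" using gu by simp
    then have "v = u" using G.right_cancel[OF gG KG[OF vK] KG[OF uK]] by blast
    then show ?thesis by (simp only: u_def v_def)
  qed
  have lc: "loc_const b0"
    unfolding loc_const_def
  proof (intro ballI)
    fix x y k assume h: "x \<in> carrier G" "y \<in> carrier G" "k \<in> stab x \<inter> stab y"
    then have k: "k \<in> stab x" "k \<in> stab y" by blast+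
    show "b0 k x = b0 k y" using val[OF h(1) k(1)] val[OF h(2) k(2)] same[OF h(1,2) k] by simp
  qed
  have inv: "invariant b0"
    unfolding invariant_def
  proof (intro conjI ballI ex lc)
    fix x g k assume x: "x \<in> carrier G" and g: "g \<in> carrier G" and k: "k \<in> stab x"
    have kG: "k \<in> carrier G" using S_carrier[OF stab_S[OF k]] .
    have "conj_by g k \<in> stab (x \<otimes> g)" using stab_conj_iff[OF x g stab_S[OF k]] k by simp
    then have "b0 (conj_by g k) (x \<otimes> g) = N \<cdot> a (x \<otimes> g \<otimes> conj_by g k \<otimes> inv (x \<otimes> g))"
      using val[OF G.m_closed[OF x g]] by blast
    also have "x \<otimes> g \<otimes> conj_by g k \<otimes> inv (x \<otimes> g) = x \<otimes> k \<otimes> inv x"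
    proof -
      have "g \<otimes> (inv g \<otimes> b) = b" if "b \<in> carrier G" for b
        using that g by (simp flip: G.m_assoc)
      then show ?thesis using x g kG by (simp add: G.m_assoc G.inv_mult_group)
    qed
    finally show "b0 (conj_by g k) (x \<otimes> g) = b0 k x" using val[OF x k] by simp
  qed
  have tor: "p \<cdot> b0 g x = 0" if "g \<in> carrier G" "x \<in> carrier G" for g x
    using that \<chi>_tor \<rho>H by (simp add: b0_def ntimes_diff_right)
  \<comment> \<open>The value is \<open>N / p\<close> in the circle, and the index \<open>N\<close>
    is prime to \<open>p\<close>.\<close>
  have bt: "b0 t \<one> \<noteq> 0"
  proof -
    have "b0 t \<one> = N \<cdot> circ (1 / real p)"
      using val[OF G.one_closed t(1)] at[of 1] S_carrier[OF tS] by simp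
    moreover have "\<not> p dvd N" using N p_gt_1 by (metis coprime_absorb_right nat_dvd_1_iff_1 less_irrefl)
    ultimately show ?thesis using ntimes_circ_inverse_eq_0_iff[of p N] p_gt_1 by simp
  qed
  have trivD: "GC.triv D b0" if D: "subgroup D G" and nS: "\<not> S \<subseteq> D" for D
  proof (rule triv_if_triv_on_Sylow[OF D coc, where k = 1])
    have DG: "g \<in> carrier G" if "g \<in> D" for g using that subgroup.subset[OF D] by blast
    note C = coprime_transv(1)[OF D]
    show "GC.triv D (\<lambda>g x. p ^ 1 \<cdot> b0 g x)"
      using GC.triv_zero tor DG by (subst GC.triv_cong[where b' = "\<lambda>_ _. 0"]) auto
    show "GC.triv (S \<inter> D) b0"
    proof (cases "\<exists>x\<in>carrier G. \<exists>k\<in>stab x \<inter> D. k \<noteq> \<one>")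
      case True
      then obtain x k where x: "x \<in> carrier G" and k: "k \<in> stab x" "k \<in> D" "k \<noteq> \<one>" by blast
      \<comment> \<open>The nontrivial \<open>k\<close> generates \<open>stab x\<close>; with any
        \<open>c\<close> of \<open>S \<inter> D\<close> outside \<open>stab x\<close> it would
        generate \<open>S\<close> inside \<open>D\<close>.\<close>
      have sub: "S \<inter> D \<subseteq> stab x"
      proof (rule ccontr)
        assume "\<not> S \<inter> D \<subseteq> stab x"
        then obtain c where c: "c \<in> S" "c \<in> D" "c \<notin> stab x" by blast
        have "S \<subseteq> D"
        proof
          fix s assume s: "s \<in> S"
          obtain i where i: "s \<otimes> c [^] (i::nat) \<in> stab x" using stab_maximal[OF x c(1,3) s] .
          obtain j where j: "s \<otimes> c [^] i = k [^] (j::nat)"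
            using pow_if_card[OF subgroup_stab[OF x] stab_subset card_stab_p[OF c2 x] k(1,3) i] by blast
          have "k [^] j \<otimes> inv (c [^] i) \<in> D"
            using G.pow_in_subgroup[OF D] k(2) c(2) subgroup.m_closed[OF D] subgroup.m_inv_closed[OF D] by blast
          moreover have "k [^] j \<otimes> inv (c [^] i) = s"
            unfolding j[symmetric] using S_carrier[OF s] S_carrier[OF c(1)] by (simp add: G.m_assoc)
          ultimately show "s \<in> D" by simp
        qed
        then show False using nS by blast
      qed
      \<comment> \<open>On \<open>S \<inter> D\<close> the values at \<open>x\<close> form a
        character. Subtracting it leaves a crossed homomorphism that vanishes on all stabilisers by
        local constancy.\<close>
      have "GC.triv (S \<inter> D) (\<lambda>g z. b0 g z - b0 g x)"
      proof (rule triv_if_zero_on_stabilisers[OF C])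
        show "hinv (\<lambda>z. b0 g z - b0 g x)" if "g \<in> S \<inter> D" for g
          using hv[OF S_carrier] that by (simp add: hinv_def)
        show "b0 (g \<otimes> h) z - b0 (g \<otimes> h) x = b0 g z - b0 g x + (b0 h (z \<otimes> g) - b0 h x)"
          if "g \<in> S \<inter> D" "h \<in> S \<inter> D" "z \<in> carrier G" for g h z
        proof -
          have "b0 (g \<otimes> h) x = b0 g x + b0 h x" using exact_stab[OF ex x] sub that by blast
          moreover have "b0 (g \<otimes> h) z = b0 g z + b0 h (z \<otimes> g)" using exactD[OF ex] that by blast
          ultimately show ?thesis by (simp add: algebra_simps)
        qed
        show "b0 l z - b0 l x = 0" if "l \<in> S \<inter> D" "z \<in> carrier G" "z \<otimes> l \<otimes> inv z \<in> H" for l z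
        proof -
          have "l \<in> stab z" "l \<in> stab x" using that sub by (auto simp: stab_def)
          then have "b0 l z = b0 l x" using loc_constD[OF lc that(2) x] by blast
          then show ?thesis by simp
        qed
      qed
      then show ?thesis by (rule triv_add_const)
    next
      case False
      show ?thesis
      proof (rule triv_if_zero_on_stabilisers[OF C])
        show "hinv (b0 g)" if "g \<in> S \<inter> D" for g using hv S_carrier that by blast
        show "b0 (g \<otimes> h) z = b0 g z + b0 h (z \<otimes> g)"
          if "g \<in> S \<inter> D" "h \<in> S \<inter> D" "z \<in> carrier G" for g h z
          using exactD[OF ex] that by blast
        fix l z assume l: "l \<in> S \<inter> D" and z: "z \<in> carrier G" and lz: "z \<otimes> l \<otimes> inv z \<in> H"
        then have "l \<in> stab z \<inter> D" by (simp add: stab_def)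
        then have "l = \<one>" using False z by blast
        then show "b0 l z = 0"
          using exact_stab_pow[OF ex z subgroup.one_closed[OF subgroup_stab[OF z]], of 0] by simp
      qed
    qed
  qed
  have nt: "\<not> GC.triv (carrier G) b0"
  proof
    assume "GC.triv (carrier G) b0"
    then obtain m e where m: "hinv m"
      and me: "\<And>g x. \<lbrakk>g \<in> carrier G; x \<in> carrier G\<rbrakk> \<Longrightarrow> b0 g x = m (x \<otimes> g) - m x + e g"
      unfolding GC.triv_def by blast
    \<comment> \<open>As \<open>b0\<close> has no defect, \<open>e\<close> is a homomorphism from
      \<open>G\<close> to the circle. It is trivial on \<open>comm = S\<close>, and the coboundary
      term vanishes at \<open>t\<close>, contradicting \<open>bt\<close>.\<close>
    have e_mult: "e (g \<otimes> h) = e g + e h" if "g \<in> carrier G" "h \<in> carrier G" for g h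
    proof -
      have "b0 (g \<otimes> h) \<one> = b0 g \<one> + b0 h g" using mult[OF that G.one_closed] that by simp
      moreover have "b0 (g \<otimes> h) \<one> = m (g \<otimes> h) - m \<one> + e (g \<otimes> h)" using me[of "g \<otimes> h" \<one>] that by simp
      moreover have "b0 g \<one> = m g - m \<one> + e g" using me[of g \<one>] that by simp
      moreover have "b0 h g = m (g \<otimes> h) - m g + e h" using me[of h g] that by simp
      ultimately have "m (g \<otimes> h) - m \<one> + e (g \<otimes> h) = (m g - m \<one> + e g) + (m (g \<otimes> h) - m g + e h)" by simp
      then show ?thesis by (simp add: algebra_simps)
    qed
    have e1: "e \<one> = 0" using e_mult[of \<one> \<one>] by simp
    have e_inv: "e (inv g) = - e g" if "g \<in> carrier G" for g
      using e_mult[of g "inv g"] that e1 by (simp add: eq_neg_iff_add_eq_0 add.commute)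
    have sub: "{a \<otimes> b \<otimes> inv a \<otimes> inv b | a b. a \<in> S \<and> b \<in> carrier G} \<subseteq> {g \<in> carrier G. e g = 0}"
      using S_carrier by (auto simp: e_mult e_inv)
    have "subgroup {g \<in> carrier G. e g = 0} G"
      by (rule G.subgroupI) (auto simp: e_mult e_inv e1 intro: exI[of _ \<one>])
    then have "comm \<subseteq> {g \<in> carrier G. e g = 0}"
      unfolding commutator_subgroup_def using G.generate_subgroup_incl[OF sub] by blast
    then have "e t = 0" using cm tS by blast
    moreover have "m (\<one> \<otimes> t) = m \<one>" using stab_hinv[OF m G.one_closed t(1)] .
    ultimately show False using me[of t \<one>] bt S_carrier[OF tS] by simp
  qed
  show ?thesis
    by (rule that[OF coc inv t(1) bt _ _ nt]) (use tor trivD in blast)+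
qed

end

section \<open>The primary part\<close>

lemma mod_hom: "(\<lambda>i. i mod int p) \<in> hom integer_group (integer_mod_group p)"
  by (cases "p = 0") (auto simp: hom_def carrier_integer_mod_group mod_add_eq)

lemma mod_surj: "(\<lambda>i. i mod int p) ` carrier integer_group = carrier (integer_mod_group p)"
proof (cases "p = 0")
  case False
  then have "i \<in> (\<lambda>i. i mod int p) ` UNIV" if "i \<in> {0..<int p}" for i
    using that by (intro image_eqI[of _ _ i]) auto
  then show ?thesis using False by (auto simp: carrier_integer_mod_group)
qed (simp add: carrier_integer_mod_group)

lemma (in group) cyclic_iso_integer_mod:
  assumes p: "prime p" and x: "x \<in> carrier G" "x \<noteq> \<one>" "x [^] p = \<one>"
    and gen: "\<And>y. y \<in> carrier G \<Longrightarrow> \<exists>j::nat. y = x [^] j"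
  shows "G \<cong> integer_mod_group p"
proof (rule iso_of_equal_kernels)
  have "ord x dvd p" using x pow_eq_id by blast
  moreover have "ord x \<noteq> 1" using ord_eq_1 x by blast
  ultimately have ord: "ord x = p" using p prime_nat_iff by blast
  show "(\<lambda>i::int. x [^] i) \<in> hom integer_group G" by (rule hom_integer_group_pow[OF x(1)])
  show "(\<lambda>i::int. x [^] i) ` carrier integer_group = carrier G"
  proof
    show "carrier G \<subseteq> (\<lambda>i::int. x [^] i) ` carrier integer_group"
    proof
      fix y assume "y \<in> carrier G"
      then obtain j :: nat where "y = x [^] j" using gen by blast
      then have "y = x [^] int j" by (simp add: int_pow_int)
      then show "y \<in> (\<lambda>i::int. x [^] i) ` carrier integer_group" by simp
    qed
  qed (use x in auto)
  show "(x [^] i = \<one>) = (i mod int p = \<one>\<^bsub>integer_mod_group p\<^esub>)" for i :: int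
    using int_pow_eq_id[OF x(1), of i] ord by (simp add: dvd_eq_mod_eq_0)
  show "(\<lambda>i. i mod int p) \<in> hom integer_group (integer_mod_group p)" by (rule mod_hom)
  show "(\<lambda>i. i mod int p) ` carrier integer_group = carrier (integer_mod_group p)" by (rule mod_surj)
qed auto

section \<open>The structure of S and the family of cyclic subgroups\<close>

context core_free_sylow
begin

text \<open>In order \<open>p\<^sup>2\<close> two distinct stabilisers have order \<open>p\<close>
  and meet trivially, so the exponents of a generator of each serve as coordinates on
  \<open>S\<close>. The other direction is a count.\<close>

lemma S_iff_iso: "G\<lparr>carrier := S\<rparr> \<cong> integer_mod_group p \<times>\<times> integer_mod_group p \<longleftrightarrow> card S = p\<^sup>2"
proof
  have p0: "p \<noteq> 0" using p_gt_1 by simp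
  assume "G\<lparr>carrier := S\<rparr> \<cong> integer_mod_group p \<times>\<times> integer_mod_group p"
  then have "card S = card (carrier (integer_mod_group p \<times>\<times> integer_mod_group p))"
    using iso_same_card by fastforce
  then show "card S = p\<^sup>2" using p0 by (simp add: carrier_integer_mod_group power2_eq_square)
next
  assume c2: "card S = p\<^sup>2"
  have "card S \<noteq> p" using c2 p_gt_1 by (simp add: power2_eq_square)
  then obtain y where y: "y \<in> carrier G" "stab y \<noteq> stab \<one>" using exists_other_stab by blast
  note one = G.one_closed
  note st1 = subgroup_stab[OF one] and sty = subgroup_stab[OF y(1)]
  have disj: "k = \<one>" if k: "k \<in> stab \<one>" "k \<in> stab y" for k
  proof (rule ccontr)
    assume "k \<noteq> \<one>"
    then have "stab \<one> = generate G {k}" "stab y = generate G {k}"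
      using generate_eq_if_card[OF st1 stab_subset card_stab_p[OF c2 one] k(1)]
        generate_eq_if_card[OF sty stab_subset card_stab_p[OF c2 y(1)] k(2)] by blast+
    then show False using y(2) by simp
  qed
  obtain u where u: "u \<in> stab y" "u \<notin> stab \<one>" using stab_not_subset[OF y(1) one y(2)] .
  obtain t where t: "t \<in> stab \<one>" "t \<noteq> \<one>" using stab_one_gen[OF c2] .
  have uS: "u \<in> S" and tS: "t \<in> S" using u t stab_S by auto
  have uG: "u \<in> carrier G" and tG: "t \<in> carrier G" using uS tS S_carrier by auto
  have u1: "u \<noteq> \<one>" using u(2) subgroup.one_closed[OF st1] by blast
  have tp: "t [^] (i::int) \<in> stab \<one>" and up: "u [^] (i::int) \<in> stab y" for i
    using G.subgroup_int_pow_closed[OF st1 t(1)] G.subgroup_int_pow_closed[OF sty u(1)] by auto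
  let ?f = "\<lambda>(i::int, j::int). t [^] i \<otimes> u [^] j"
  let ?g = "\<lambda>(i::int, j::int). (i mod int p, j mod int p)"
  let ?P = "integer_group \<times>\<times> integer_group"
  show "G\<lparr>carrier := S\<rparr> \<cong> integer_mod_group p \<times>\<times> integer_mod_group p"
  proof (rule iso_of_equal_kernels)
    show "group ?P" by (simp add: DirProd_group)
    show "group (G\<lparr>carrier := S\<rparr>)" by (rule G.subgroup_imp_group[OF S.subgroup_axioms])
    show "group (integer_mod_group p \<times>\<times> integer_mod_group p)" by (simp add: DirProd_group)
    have "t [^] (i + i') \<otimes> u [^] (j + j') = (t [^] i \<otimes> u [^] j) \<otimes> (t [^] i' \<otimes> u [^] j')" for i i' j j' :: int
    proof -
      have "t [^] i' \<otimes> u [^] j = u [^] j \<otimes> t [^] i'" using S_commute stab_S tp up by blast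
      then have "t [^] i \<otimes> (t [^] i' \<otimes> u [^] j) \<otimes> u [^] j' = t [^] i \<otimes> (u [^] j \<otimes> t [^] i') \<otimes> u [^] j'" by simp
      then show ?thesis using tG uG by (simp add: G.int_pow_mult G.m_assoc)
    qed
    then show "?f \<in> hom ?P (G\<lparr>carrier := S\<rparr>)"
      using S_m[OF stab_S[OF tp] stab_S[OF up]] by (auto simp: hom_def DirProd_def)
    show "?f ` carrier ?P = carrier (G\<lparr>carrier := S\<rparr>)"
    proof
      show "?f ` carrier ?P \<subseteq> carrier (G\<lparr>carrier := S\<rparr>)" using S_m[OF stab_S[OF tp] stab_S[OF up]] by auto
      show "carrier (G\<lparr>carrier := S\<rparr>) \<subseteq> ?f ` carrier ?P"
      proof
        fix s assume "s \<in> carrier (G\<lparr>carrier := S\<rparr>)"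
        then have s: "s \<in> S" by simp
        obtain i where i: "s \<otimes> u [^] (i::nat) \<in> stab \<one>" using stab_maximal[OF one uS u(2) s] .
        obtain j where j: "s \<otimes> u [^] i = t [^] (j::nat)"
          using pow_if_card[OF st1 stab_subset card_stab_p[OF c2 one] t i] by blast
        have "s = t [^] j \<otimes> inv (u [^] i)"
          unfolding j[symmetric] using S_carrier[OF s] uG by (simp add: G.m_assoc)
        also have "\<dots> = t [^] int j \<otimes> u [^] (- int i)"
          using uG by (simp add: int_pow_int G.int_pow_neg)
        finally have "s = ?f (int j, - int i)" by simp
        then show "s \<in> ?f ` carrier ?P" by (rule image_eqI) simp
      qed
    qed
    show "?g \<in> hom ?P (integer_mod_group p \<times>\<times> integer_mod_group p)"
      using mod_hom[of p] by (auto simp: hom_def DirProd_def)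
    show "?g ` carrier ?P = carrier (integer_mod_group p \<times>\<times> integer_mod_group p)"
    proof -
      have "?g ` (UNIV \<times> UNIV) = (\<lambda>i. i mod int p) ` UNIV \<times> (\<lambda>i. i mod int p) ` UNIV"
        by (auto simp: image_iff)
      then show ?thesis using mod_surj[of p] by simp
    qed
    have powt: "t [^] i = \<one> \<longleftrightarrow> i mod int p = 0" and powu: "u [^] i = \<one> \<longleftrightarrow> i mod int p = 0" for i :: int
      using G.int_pow_eq_id[OF tG] G.int_pow_eq_id[OF uG] ord_S[OF tS t(2)] ord_S[OF uS u1]
      by (simp_all add: dvd_eq_mod_eq_0)
    have ker: "t [^] i \<otimes> u [^] j = \<one> \<longleftrightarrow> t [^] i = \<one> \<and> u [^] j = \<one>" for i j :: int
    proof
      assume eq: "t [^] i \<otimes> u [^] j = \<one>"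
      then have "t [^] i = inv (u [^] j)" using tG uG by (metis G.inv_equality G.int_pow_closed)
      then have "t [^] i \<in> stab y" using subgroup.m_inv_closed[OF sty up] by simp
      then have "t [^] i = \<one>" using disj[OF tp] by blast
      then show "t [^] i = \<one> \<and> u [^] j = \<one>" using eq uG by simp
    qed (use uG in simp)
    show "(?f x = \<one>\<^bsub>G\<lparr>carrier := S\<rparr>\<^esub>) = (?g x = \<one>\<^bsub>integer_mod_group p \<times>\<times> integer_mod_group p\<^esub>)"
      if "x \<in> carrier ?P" for x
      by (cases x) (simp add: ker powt powu)
  qed
qed

text \<open>\<open>S\<close> has exponent \<open>p\<close>, and a cyclic group of order
  \<open>n\<close> has at most \<open>p\<close> elements killed by \<open>p\<close>: the powers of
  \<open>g [^] (n div p)\<close> if \<open>p\<close> divides \<open>n\<close>, and only the identity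
  otherwise.\<close>

lemma not_subset_cyclic:
  assumes c2: "card S = p\<^sup>2" and D: "D \<in> cyclic_subgroups G"
  shows "\<not> S \<subseteq> D"
proof
  assume SD: "S \<subseteq> D"
  obtain g where g: "g \<in> carrier G" "D = generate G {g}" using D by (auto simp: cyclic_subgroups_def)
  define n where "n = G.ord g"
  have el: "\<exists>i::nat. s = g [^] i \<and> n dvd i * p" if s: "s \<in> S" for s
  proof -
    have "s \<in> {g [^] k | k. k \<in> (UNIV :: nat set)}"
      using G.generate_pow_on_finite_carrier[OF finG g(1)] SD s g(2) by blast
    then obtain i :: nat where i: "s = g [^] i" by blast
    have "g [^] (i * p) = \<one>" using S_exponent[OF s] g(1) unfolding i by (simp add: G.nat_pow_pow)
    then show ?thesis using i G.pow_eq_id[OF g(1)] n_def by blast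
  qed
  have "card S \<le> p"
  proof (cases "p dvd n")
    case True
    then obtain m where m: "n = p * m" by blast
    have "S \<subseteq> (\<lambda>j. g [^] (m * j)) ` {..<p}"
    proof
      fix s assume "s \<in> S"
      then obtain i where i: "s = g [^] (i::nat)" "n dvd i * p" using el by blast
      then have "p * m dvd p * i" using m by (simp add: mult.commute)
      then have "m dvd i" using p_gt_1 by simp
      then obtain j where j: "i = m * j" by blast
      have "g [^] (m * j) = g [^] (m * (j mod p))"
      proof -
        have "m * (p * q + r) = n * q + m * r" for q r by (simp add: m algebra_simps)
        from this[of "j div p" "j mod p"] have "m * j = n * (j div p) + m * (j mod p)" by simp
        moreover have "g [^] (n * (j div p)) = \<one>"
          using G.pow_eq_id[OF g(1)] by (simp add: n_def)
        ultimately show ?thesis using g(1) by (metis G.l_one G.nat_pow_closed G.nat_pow_mult)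
      qed
      then show "s \<in> (\<lambda>j. g [^] (m * j)) ` {..<p}" using i j p_gt_1 by auto
    qed
    then have "card S \<le> card ((\<lambda>j. g [^] (m * j)) ` {..<p})" by (intro card_mono) auto
    also have "\<dots> \<le> p" using card_image_le[of "{..<p}"] by fastforce
    finally show ?thesis .
  next
    case False
    then have "coprime n p" using prime_imp_coprime[OF prime_p] by (simp add: coprime_commute)
    have "S \<subseteq> {\<one>}"
    proof
      fix s assume "s \<in> S"
      then obtain i where i: "s = g [^] (i::nat)" "n dvd i * p" using el by blast
      then have "n dvd i" using \<open>coprime n p\<close> by (simp add: coprime_dvd_mult_left_iff)
      then show "s \<in> {\<one>}" using G.pow_eq_id[OF g(1)] i(1) n_def by simp
    qed
    then have "card S \<le> card {\<one>}" by (intro card_mono) auto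
    then show ?thesis using p_gt_1 by simp
  qed
  then show False using c2 p_gt_1 by (simp add: power2_eq_square)
qed

lemma admissible_cyclic: "admissible G (cyclic_subgroups G)"
  unfolding admissible_def
proof (intro conjI ballI)
  have "cyclic_subgroups G = (\<lambda>g. generate G {g}) ` carrier G" by (auto simp: cyclic_subgroups_def)
  then show "finite (cyclic_subgroups G)" using finG by simp
  show "subgroup D G" if "D \<in> cyclic_subgroups G" for D
    using that G.generate_is_subgroup by (auto simp: cyclic_subgroups_def)
  fix D g assume "D \<in> cyclic_subgroups G" and g: "g \<in> carrier G"
  then obtain x where x: "x \<in> carrier G" "D = generate G {x}" by (auto simp: cyclic_subgroups_def)
  have DG: "generate G {x} \<subseteq> carrier G" using G.generate_incl[of "{x}"] x by blast
  have cp: "g \<otimes> x [^] k \<otimes> inv g = (g \<otimes> x \<otimes> inv g) [^] k" for k :: nat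
  proof (induction k)
    case (Suc k)
    have "g \<otimes> (x [^] k \<otimes> x) \<otimes> inv g = (g \<otimes> x [^] k \<otimes> inv g) \<otimes> (g \<otimes> x \<otimes> inv g)"
      by (rule conj_mult) (use g x in auto)
    then show ?case using Suc by simp
  qed (use g in simp)
  have xg: "g \<otimes> x \<otimes> inv g \<in> carrier G" using g x by simp
  have "g <# D #> inv g = (\<lambda>d. g \<otimes> d \<otimes> inv g) ` D"
    by (auto simp: l_coset_def r_coset_def)
  also have "\<dots> = generate G {g \<otimes> x \<otimes> inv g}"
    unfolding x(2) G.generate_pow_on_finite_carrier[OF finG x(1)] G.generate_pow_on_finite_carrier[OF finG xg]
    by (auto simp: cp image_iff) (metis cp)
  finally show "g <# D #> inv g \<in> cyclic_subgroups G" using xg by (auto simp: cyclic_subgroups_def)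
qed simp

section \<open>The p-primary part for an admissible family\<close>

abbreviation "Sha \<D> \<equiv> Sha2 G \<D> (J G H) (J_act G)"

context
  fixes \<D>
  assumes adm: "admissible G \<D>"
begin

lemma adm_fin: "finite \<D>" and adm_sub: "D \<in> \<D> \<Longrightarrow> subgroup D G"
  and adm_cyc: "g \<in> carrier G \<Longrightarrow> generate G {g} \<in> \<D>"
  using adm by (auto simp: admissible_def cyclic_subgroups_def)

lemma one_primary: "\<one>\<^bsub>primary_part p (Sha \<D>)\<^esub> = \<one>\<^bsub>H2 G (J G H) (J_act G)\<^esub>"
  by (simp add: primary_part_def GC.Sha2_simps)

lemma primary_cases:
  assumes "y \<in> carrier (primary_part p (Sha \<D>))"
  obtains b k where "GC.cocyc (carrier G) b" "y = GC.\<Phi> b" "\<forall>D\<in>\<D>. GC.triv D b"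
    "GC.triv (carrier G) (\<lambda>g x. (p ^ k) \<cdot> b g x)"
proof -
  obtain k where y: "y \<in> carrier (Sha \<D>)" and k: "y [^]\<^bsub>H2 G (J G H) (J_act G)\<^esub> (p ^ k) = \<one>\<^bsub>H2 G (J G H) (J_act G)\<^esub>"
    using assms by (auto simp: primary_part_def GC.Sha2_simps)
  obtain b where b: "GC.cocyc (carrier G) b" "y = GC.\<Phi> b"
    using y subgroup.subset[OF GC.subgroup_Sha2(1)[OF adm_fin adm_sub]] GC.Phi_surj by blast
  have "\<forall>D\<in>\<D>. GC.triv D b" using GC.Phi_Sha2_iff[OF adm_fin adm_sub b(1)] y b(2) by simp
  moreover have "GC.triv (carrier G) (\<lambda>g x. (p ^ k) \<cdot> b g x)"
    using k GC.Phi_one_iff[OF GC.cocyc_ntimes[OF b(1)]] GC.Phi_pow[OF b(1)] b(2) by simp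
  ultimately show ?thesis using that b by blast
qed

lemma triv_G:
  assumes "GC.cocyc (carrier G) b" "GC.triv S b" "GC.triv (carrier G) (\<lambda>g x. (p ^ k) \<cdot> b g x)"
  shows "GC.triv (carrier G) b"
proof -
  have "S \<inter> carrier G = S" using S.subset by blast
  then show ?thesis using triv_if_triv_on_Sylow[OF G.subgroup_self assms(1) _ assms(3)] assms(2) by simp
qed

text \<open>A class of \<open>p\<close>-power order that is trivial on \<open>S\<close> is trivial,
  because the index of \<open>S\<close> is prime to \<open>p\<close>.\<close>

lemma primary_trivialI:
  assumes "\<And>b :: 'a \<Rightarrow> 'a \<Rightarrow> circle. \<lbrakk>GC.cocyc (carrier G) b; \<forall>D\<in>\<D>. GC.triv D b\<rbrakk> \<Longrightarrow> GC.triv S b"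
  shows "carrier (primary_part p (Sha \<D>)) = {\<one>\<^bsub>primary_part p (Sha \<D>)\<^esub>}"
proof -
  have "y = \<one>\<^bsub>primary_part p (Sha \<D>)\<^esub>" if y: "y \<in> carrier (primary_part p (Sha \<D>))" for y
  proof -
    obtain b k where b: "GC.cocyc (carrier G) b" "y = GC.\<Phi> b" "\<forall>D\<in>\<D>. GC.triv D b"
      "GC.triv (carrier G) (\<lambda>g x. (p ^ k) \<cdot> b g x)"
      using primary_cases[OF y] .
    have "GC.triv (carrier G) b" using triv_G[OF b(1) assms[OF b(1,3)] b(4)] .
    then show ?thesis unfolding one_primary using GC.Phi_one_iff[OF b(1)] b(2) by simp
  qed
  moreover have "\<one>\<^bsub>primary_part p (Sha \<D>)\<^esub> \<in> carrier (primary_part p (Sha \<D>))"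
    using comm_group_primary_part[OF GC.comm_group_Sha2[OF adm_fin adm_sub]]
    by (meson comm_group.axioms(2) group.is_monoid monoid.one_closed)
  ultimately show ?thesis by blast
qed

lemma primary_trivial_if_S_subset:
  assumes "D \<in> \<D>" "S \<subseteq> D"
  shows "carrier (primary_part p (Sha \<D>)) = {\<one>\<^bsub>primary_part p (Sha \<D>)\<^esub>}"
  by (rule primary_trivialI) (use assms GC.triv_subset in blast)

lemma primary_nontrivial_imp:
  assumes "carrier (primary_part p (Sha \<D>)) \<noteq> {\<one>\<^bsub>primary_part p (Sha \<D>)\<^esub>}"
  shows "card S = p\<^sup>2 \<and> comm = S \<and> normalizer G (S \<inter> H) = centralizer G (S \<inter> H)"
proof -
  obtain b :: "'a \<Rightarrow> 'a \<Rightarrow> circle" where b: "GC.cocyc (carrier G) b" "\<forall>D\<in>\<D>. GC.triv D b" "\<not> GC.triv S b"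
    using primary_trivialI assms by blast
  have "GC.triv (generate G {g}) b" if "g \<in> S" for g using b(2) adm_cyc[OF S_carrier[OF that]] by blast
  from necessary_conditions[OF b(1) this b(3)] show ?thesis by blast
qed

lemma primary_iso:
  assumes c2: "card S = p\<^sup>2" and cm: "comm = S" and nz: "normalizer G (S \<inter> H) = centralizer G (S \<inter> H)"
    and nS: "\<And>D. D \<in> \<D> \<Longrightarrow> \<not> S \<subseteq> D"
  shows "primary_part p (Sha \<D>) \<cong> integer_mod_group p"
    and "carrier (primary_part p (Sha \<D>)) \<noteq> {\<one>\<^bsub>primary_part p (Sha \<D>)\<^esub>}"
proof -
  obtain b0 :: "'a \<Rightarrow> 'a \<Rightarrow> circle" and k0 where b0: "GC.cocyc (carrier G) b0" "invariant b0" "k0 \<in> stab \<one>" "b0 k0 \<one> \<noteq> 0"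
    "\<forall>g\<in>carrier G. \<forall>x\<in>carrier G. p \<cdot> b0 g x = 0" "\<forall>D. subgroup D G \<longrightarrow> \<not> S \<subseteq> D \<longrightarrow> GC.triv D b0"
    "\<not> GC.triv (carrier G) b0"
    using existence[OF c2 cm nz] .
  let ?A = "primary_part p (Sha \<D>)"
  interpret A: comm_group ?A
    by (rule comm_group_primary_part[OF GC.comm_group_Sha2[OF adm_fin adm_sub]])
  have powA: "x [^]\<^bsub>?A\<^esub> (n::nat) = x [^]\<^bsub>H2 G (J G H) (J_act G)\<^esub> n" for x n
    by (simp add: primary_part_def nat_pow_def Sha2_def)
  have pz: "GC.triv (carrier G) (\<lambda>g x. p \<cdot> b0 g x)"
    using GC.triv_zero b0(5) by (subst GC.triv_cong[where b' = "\<lambda>_ _. 0"]) auto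
  define x0 where "x0 = GC.\<Phi> b0"
  have x0p: "x0 [^]\<^bsub>?A\<^esub> p = \<one>\<^bsub>?A\<^esub>"
    unfolding powA one_primary x0_def
    using GC.Phi_one_iff[OF GC.cocyc_ntimes[OF b0(1)]] GC.Phi_pow[OF b0(1)] pz by metis
  have "x0 \<in> carrier (Sha \<D>)"
    unfolding x0_def using GC.Phi_Sha2_iff[OF adm_fin adm_sub b0(1)] b0(6) nS adm_sub by blast
  moreover have "x0 [^]\<^bsub>Sha \<D>\<^esub> (p ^ 1) = \<one>\<^bsub>Sha \<D>\<^esub>"
    using x0p by (simp add: powA one_primary GC.Sha2_simps)
  ultimately have "x0 \<in> {x \<in> carrier (Sha \<D>). \<exists>k::nat. x [^]\<^bsub>Sha \<D>\<^esub> (p ^ k) = \<one>\<^bsub>Sha \<D>\<^esub>}" by blast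
  then have x0A: "x0 \<in> carrier ?A" by (simp add: primary_part_def)
  have x01: "x0 \<noteq> \<one>\<^bsub>?A\<^esub>"
    unfolding one_primary x0_def using GC.Phi_one_iff[OF b0(1)] b0(7) by blast
  have gen: "\<exists>j::nat. y = x0 [^]\<^bsub>?A\<^esub> j" if y: "y \<in> carrier ?A" for y
  proof -
    obtain b k where b: "GC.cocyc (carrier G) b" "y = GC.\<Phi> b" "\<forall>D\<in>\<D>. GC.triv D b"
      "GC.triv (carrier G) (\<lambda>g x. (p ^ k) \<cdot> b g x)"
      using primary_cases[OF y] .
    have t: "GC.triv (generate G {g}) b" if "g \<in> S" for g using b(3) adm_cyc[OF S_carrier[OF that]] by blast
    obtain j where j: "GC.triv S (\<lambda>g z. b g z - j \<cdot> b0 g z)"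
      using multiple_of_invariant[OF b(1) t c2 b0(2,3,4)] .
    have cj: "GC.cocyc (carrier G) (\<lambda>g z. j \<cdot> b0 g z)" by (rule GC.cocyc_ntimes[OF b0(1)])
    have cd: "GC.cocyc (carrier G) (\<lambda>g z. b g z - j \<cdot> b0 g z)" by (rule GC.cocyc_diff[OF b(1) cj])
    \<comment> \<open>The exponent \<open>k + 1\<close> suffices for both terms:
      \<open>p ^ k\<close> kills the class of \<open>b\<close>, and \<open>p\<close> kills
      \<open>b0\<close>.\<close>
    have "GC.triv (carrier G) (\<lambda>g x. (p ^ (k + 1)) \<cdot> (b g x - j \<cdot> b0 g x))"
    proof -
      have "GC.triv (carrier G) (\<lambda>g x. p \<cdot> (p ^ k) \<cdot> b g x - (p ^ k * j) \<cdot> p \<cdot> b0 g x)"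
        by (rule GC.triv_diff[OF GC.triv_ntimes[OF b(4)] GC.triv_ntimes[OF pz]])
      moreover have "p \<cdot> (p ^ k) \<cdot> c - (p ^ k * j) \<cdot> p \<cdot> c' = (p ^ (k + 1)) \<cdot> (c - j \<cdot> c')" for c c' :: circle
        by (simp add: ntimes_diff_right mult_ac flip: ntimes_mult)
      ultimately show ?thesis by simp
    qed
    from triv_G[OF cd j this] have "y = GC.\<Phi> (\<lambda>g z. j \<cdot> b0 g z)"
      using GC.Phi_eqI[OF b(1) cj] b(2) by simp
    then show ?thesis unfolding powA x0_def GC.Phi_pow[OF b0(1)] by blast
  qed
  show "?A \<cong> integer_mod_group p"
    by (rule A.cyclic_iso_integer_mod[OF prime_p x0A x01 x0p gen])
  show "carrier ?A \<noteq> {\<one>\<^bsub>?A\<^esub>}" using x0A x01 by blast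
qed

end

end

lemma (in normal_sylow) card_S_Int_H:
  assumes n: "order G = n * card H" "p dvd n" "\<not> p\<^sup>2 dvd n"
  shows "card S = p * card (S \<inter> H)"
proof -
  have finS: "finite S" using finite_subset[OF S.subset finG] .
  obtain a where a: "card S = p ^ a" using card_S by blast
  note SH = coprime_transv(1)[OF subgroup_H]
  define h where "h = card (G.transv (S \<inter> H) H)"
  define c where "c = card (G.transv (S \<inter> H) S)"
  have h: "h * card (S \<inter> H) = card H"
    unfolding h_def by (rule G.card_transv[OF SH subgroup_H]) (use finite_subset[OF subgroup.subset[OF subgroup_H] finG] in auto)
  have c: "c * card (S \<inter> H) = card S"
    unfolding c_def by (rule G.card_transv[OF SH S.subgroup_axioms]) (use finS in auto)
  have hp: "coprime h p" using coprime_transv(2)[OF subgroup_H] by (simp add: h_def)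
  have "card (rcosets S) * card S = order G" by (rule G.lagrange[OF S.subgroup_axioms])
  \<comment> \<open>The order of \<open>G\<close> is counted through \<open>S\<close> and through
    \<open>H\<close>. After cancellation of \<open>card (S \<inter> H)\<close> the index of
    \<open>S\<close> and \<open>h\<close> are prime to \<open>p\<close>, so the power
    \<open>c\<close> of \<open>p\<close> is the exact \<open>p\<close>-part of
    \<open>n\<close>.\<close>
  then have "card (rcosets S) * c * card (S \<inter> H) = n * h * card (S \<inter> H)"
    using c h n(1) by (simp add: mult.assoc)
  moreover have "S \<inter> H \<noteq> {}" using subgroup.one_closed[OF SH] by blast
  then have "card (S \<inter> H) > 0" using finS by (simp add: card_gt_0_iff)
  ultimately have eq: "card (rcosets S) * c = n * h" by simp
  have "c dvd p ^ a" using c a by (metis dvd_triv_left)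
  then obtain e where e: "c = p ^ e" using divides_primepow_nat[OF prime_p] by blast
  have "e \<noteq> 0"
  proof
    assume "e = 0"
    then have "p dvd card (rcosets S)" using eq e n(2) by (metis dvd_mult2 mult.right_neutral power_0)
    then show False using coprime_index prime_gt_1_nat[OF prime_p] by (metis coprime_absorb_left less_irrefl nat_dvd_1_iff_1)
  qed
  moreover have "\<not> 2 \<le> e"
  proof
    assume "2 \<le> e"
    then have "p\<^sup>2 dvd n * h" using e eq by (metis dvd_mult le_imp_power_dvd)
    moreover have "coprime (p\<^sup>2) h" using hp by (simp add: coprime_commute)
    ultimately show False using n(3) by (simp add: coprime_dvd_mult_left_iff)
  qed
  ultimately have "e = 1" by linarith
  then show ?thesis using c e by simp
qed

lemma transitive_core_free_sylow:
  assumes p: "prime p" and tr: "transitive_group n G" and n: "p dvd n" "\<not> p\<^sup>2 dvd n"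
    and cH: "corresponding_subgroup n G H" and syl: "sylow_subgroup p G S" and S: "S \<lhd> G"
  shows "core_free_sylow G H S p"
proof -
  have G_eq: "G = (sym_group n)\<lparr>carrier := carrier G\<rparr>" and sub: "subgroup (carrier G) (sym_group n)"
    and trans: "\<And>i j. \<lbrakk>i \<in> {1..n}; j \<in> {1..n}\<rbrakk> \<Longrightarrow> \<exists>g\<in>carrier G. g i = j"
    using tr by (auto simp: transitive_group_def)
  interpret G: group G
    using group.subgroup_imp_group[OF sym_group_is_group sub] G_eq by metis
  have mult: "x \<otimes>\<^bsub>G\<^esub> y = x \<circ> y" for x y by (subst G_eq) (simp add: sym_group_mult)
  have one: "\<one>\<^bsub>G\<^esub> = id" by (subst G_eq) (simp add: sym_group_one)
  have perm: "g permutes {1..n}" if "g \<in> carrier G" for g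
    using that subgroup.subset[OF sub] by (auto simp: sym_group_carrier)
  have fin: "finite (carrier G)"
    by (rule finite_subset[OF _ finite_permutations[of "{1..n}"]]) (use perm in auto)
  have inv1: "(inv\<^bsub>G\<^esub> x) (x k) = k" and inv2: "x ((inv\<^bsub>G\<^esub> x) k) = k" if "x \<in> carrier G" for x k
    using G.l_inv[OF that] G.r_inv[OF that] by (simp_all add: mult one fun_eq_iff)
  obtain i where i: "i \<in> {1..n}" and H: "H = {g \<in> carrier G. g i = i}"
    using cH by (auto simp: corresponding_subgroup_def stabilizer_def)
  have subH: "subgroup H G"
  proof (rule G.subgroupI)
    show "H \<noteq> {}" using G.one_closed one unfolding H by fastforce
    show "inv\<^bsub>G\<^esub> a \<in> H" if "a \<in> H" for a using that inv1[of a i] unfolding H by auto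
    show "a \<otimes>\<^bsub>G\<^esub> b \<in> H" if "a \<in> H" "b \<in> H" for a b
      using that G.m_closed[of a b] unfolding H by (simp add: mult)
  qed (auto simp: H)
  have ordH: "order G = n * card H"
  proof -
    \<comment> \<open>Right cosets of \<open>H\<close> correspond to points by sending
      \<open>x\<close> to its inverse applied to \<open>i\<close>. The inverse is due to composition
      from right to left: a left factor from \<open>H\<close> then acts on \<open>i\<close>
      first.\<close>
    have "card ((\<lambda>x. H #>\<^bsub>G\<^esub> x) ` carrier G) = card ((\<lambda>x. (inv\<^bsub>G\<^esub> x) i) ` carrier G)"
    proof (rule card_image_eq)
      fix x y assume xy: "x \<in> carrier G" "y \<in> carrier G"
      have "H #>\<^bsub>G\<^esub> x = H #>\<^bsub>G\<^esub> y \<longleftrightarrow> x ((inv\<^bsub>G\<^esub> y) i) = i"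
        unfolding G.rcoset_eq_iff[OF subH xy] using xy G.m_closed[OF xy(1) G.inv_closed[OF xy(2)]]
        by (simp add: H mult)
      also have "\<dots> \<longleftrightarrow> (inv\<^bsub>G\<^esub> x) i = (inv\<^bsub>G\<^esub> y) i"
        using inv1[OF xy(1)] inv2[OF xy(1)] by metis
      finally show "H #>\<^bsub>G\<^esub> x = H #>\<^bsub>G\<^esub> y \<longleftrightarrow> (inv\<^bsub>G\<^esub> x) i = (inv\<^bsub>G\<^esub> y) i" .
    qed
    also have "(\<lambda>x. (inv\<^bsub>G\<^esub> x) i) ` carrier G = {1..n}"
    proof
      show "(\<lambda>x. (inv\<^bsub>G\<^esub> x) i) ` carrier G \<subseteq> {1..n}"
        using permutes_in_image[OF perm] i by blast
      show "{1..n} \<subseteq> (\<lambda>x. (inv\<^bsub>G\<^esub> x) i) ` carrier G"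
      proof
        fix j assume "j \<in> {1..n}"
        then obtain g where g: "g \<in> carrier G" "g i = j" using trans[OF i] by blast
        then show "j \<in> (\<lambda>x. (inv\<^bsub>G\<^esub> x) i) ` carrier G"
          by (intro image_eqI[of _ _ "inv\<^bsub>G\<^esub> g"]) auto
      qed
    qed
    finally have "card (rcosets\<^bsub>G\<^esub> H) = n" by (simp add: RCOSETS_def UNION_singleton_eq_range)
    then show ?thesis using G.lagrange[OF subH] by simp
  qed
  have cS: "card S = p ^ multiplicity p (order G)" using syl by (simp add: sylow_subgroup_def)
  have o0: "order G \<noteq> 0" using fin by (simp add: order_def) blast
  have idx: "coprime p (card (rcosets\<^bsub>G\<^esub> S))"
  proof (rule prime_imp_coprime[OF p])
    show "\<not> p dvd card (rcosets\<^bsub>G\<^esub> S)"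
    proof
      assume "p dvd card (rcosets\<^bsub>G\<^esub> S)"
      then have "p * card S dvd order G"
        using G.lagrange[OF normal_imp_subgroup[OF S]] by (metis dvd_refl mult_dvd_mono)
      then have "p ^ Suc (multiplicity p (order G)) dvd order G" by (simp add: cS)
      then show False
        using power_dvd_iff_le_multiplicity[of "order G" p] o0 p by (metis Suc_n_not_le_n not_prime_unit)
    qed
  qed
  interpret normal_sylow G H S p
    by (intro normal_sylow.intro coset_module.intro coset_module_axioms.intro normal_sylow_axioms.intro
        G.is_group subH S fin p idx exI[of _ "multiplicity p (order G)"] cS)
  show ?thesis
  proof (intro core_free_sylow.intro core_free_sylow_axioms.intro normal_sylow_axioms)
    show "card S = p * card (S \<inter> H)" by (rule card_S_Int_H[OF ordH n])
    fix g assume g: "g \<in> carrier G" and c: "\<And>x. x \<in> carrier G \<Longrightarrow> x \<otimes>\<^bsub>G\<^esub> g \<otimes>\<^bsub>G\<^esub> inv\<^bsub>G\<^esub> x \<in> H"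
    \<comment> \<open>A conjugate of \<open>g\<close> fixes \<open>i\<close>, so \<open>g\<close>
      fixes every point of the orbit of \<open>i\<close>, which is everything by
      transitivity.\<close>
    have "g j = j" for j
    proof (cases "j \<in> {1..n}")
      case True
      then obtain y where y: "y \<in> carrier G" "y i = j" using trans[OF i] by blast
      have "(inv\<^bsub>G\<^esub> y) (g (y i)) = i" using c[OF G.inv_closed[OF y(1)]] y(1) by (simp add: H mult)
      then show ?thesis using y inv2[OF y(1)] by metis
    next
      case False
      then show ?thesis using permutes_not_in[OF perm[OF g]] by blast
    qed
    then show "g = \<one>\<^bsub>G\<^esub>" by (simp add: one fun_eq_iff)
  qed
qed

theorem theorem6p17:
  fixes p n :: nat
    and G :: "(nat \<Rightarrow> nat) monoid"
    and H S :: "(nat \<Rightarrow> nat) set"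
  assumes "prime p"
    and "transitive_group n G"
    and "p dvd n" and "\<not> p\<^sup>2 dvd n"
    and "corresponding_subgroup n G H"
    and "sylow_subgroup p G S"
    and "S \<lhd> G"
  shows
    "((carrier (primary_part p (Sha2_omega G (J G H) (J_act G)))
          \<noteq> {\<one>\<^bsub>primary_part p (Sha2_omega G (J G H) (J_act G))\<^esub>}
        \<longleftrightarrow> G\<lparr>carrier := S\<rparr> \<cong> integer_mod_group p \<times>\<times> integer_mod_group p
            \<and> commutator_subgroup G S (carrier G) = S
            \<and> normalizer G (S \<inter> H) = centralizer G (S \<inter> H))
      \<and> (G\<lparr>carrier := S\<rparr> \<cong> integer_mod_group p \<times>\<times> integer_mod_group p
            \<and> commutator_subgroup G S (carrier G) = S
            \<and> normalizer G (S \<inter> H) = centralizer G (S \<inter> H)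
          \<longrightarrow> (\<forall>\<D>. admissible G \<D> \<longrightarrow>
                ((\<exists>D\<in>\<D>. S \<subseteq> D) \<longrightarrow>
                   carrier (primary_part p (Sha2 G \<D> (J G H) (J_act G)))
                     = {\<one>\<^bsub>primary_part p (Sha2 G \<D> (J G H) (J_act G))\<^esub>})
                \<and> ((\<nexists>D. D \<in> \<D> \<and> S \<subseteq> D) \<longrightarrow>
                   primary_part p (Sha2 G \<D> (J G H) (J_act G)) \<cong> integer_mod_group p))))
     \<and> (\<forall>\<D>. admissible G \<D> \<longrightarrow>
          prime_to_part p (Sha2 G \<D> (J G H) (J_act G))
            \<cong> Sha2 (G Mod S) (quotient_subgroups G S \<D>)
                 (J G (H <#>\<^bsub>G\<^esub> S)) (quotient_act (J_act G)))"
proof -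
  interpret core_free_sylow G H S p
    by (rule transitive_core_free_sylow[OF assms])
  let ?abc = "card S = p\<^sup>2 \<and> commutator_subgroup G S (carrier G) = S
    \<and> normalizer G (S \<inter> H) = centralizer G (S \<inter> H)"
  have omega: "carrier (primary_part p (Sha2_omega G (J G H) (J_act G)))
      \<noteq> {\<one>\<^bsub>primary_part p (Sha2_omega G (J G H) (J_act G))\<^esub>} \<longleftrightarrow> ?abc"
  proof
    assume "carrier (primary_part p (Sha2_omega G (J G H) (J_act G)))
      \<noteq> {\<one>\<^bsub>primary_part p (Sha2_omega G (J G H) (J_act G))\<^esub>}"
    then show ?abc by (rule primary_nontrivial_imp[OF admissible_cyclic])
  next
    assume abc: ?abc
    show "carrier (primary_part p (Sha2_omega G (J G H) (J_act G)))
      \<noteq> {\<one>\<^bsub>primary_part p (Sha2_omega G (J G H) (J_act G))\<^esub>}"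
      by (rule primary_iso(2)[OF admissible_cyclic]) (use abc not_subset_cyclic in auto)
  qed
  have trivial: "carrier (primary_part p (Sha2 G \<D> (J G H) (J_act G)))
      = {\<one>\<^bsub>primary_part p (Sha2 G \<D> (J G H) (J_act G))\<^esub>}"
    if "admissible G \<D>" "\<exists>D\<in>\<D>. S \<subseteq> D" for \<D>
    using primary_trivial_if_S_subset[OF that(1)] that(2) by blast
  have nontrivial: "primary_part p (Sha2 G \<D> (J G H) (J_act G)) \<cong> integer_mod_group p"
    if "?abc" "admissible G \<D>" "\<nexists>D. D \<in> \<D> \<and> S \<subseteq> D" for \<D>
    using primary_iso(1)[OF that(2)] that(1,3) by blast
  show ?thesis
    \<comment> \<open>Under these hypotheses condition (a) amounts to the order of \<open>S\<close>,
      and that is the form in which it was used.\<close>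
    unfolding S_iff_iso
    by (intro conjI[OF conjI[OF omega impI[OF allI[OF impI[OF conjI[OF impI impI]]]]] allI[OF impI]])
      (rule trivial nontrivial prime_to_part_Sha2; assumption)+
qed

end
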